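(* Let $k=1$, let $n\ge 1$ be an integer, let $\alpha>-\frac12$, and let $F\in \mathrm{IGFR}(\alpha)$ have finite mean $\mu$ and finite variance $\sigma^2>0$. (i) Let $-\frac12<\alpha<0$. If $n=1$, then $$\mathbb{E}\frac{R_1^{(1)}-\mu}{\sigma}\le 1,$$ with equality attained for the exponential distribution function $$F(x)=1-\exp\left\{-1-\frac{x-\mu}{\sigma}\right\},\qquad x>\mu-\sigma. \qquad (\ast)$$ If $n\ge2$, then the set $\tilde{\mathcal Y}=\{y>b:\ Y_\alpha(y)\ge 0,\ Z_\alpha(y)=0\}$ is nonempty, and for $y_*=\inf\tilde{\mathcal Y}$ we have $$\mathbb{E}\frac{R_n^{(1)}-\mu}{\sigma}\le C_\alpha(y_* ),$$ where $C_\alpha(y)$ is the square root of $$C_\alpha^2(y)=\left[1-(1-\alpha y)^{1/\alpha}\right]\left[1+\left(\hat g^{(1)}_n(y)-1\right)^2\right]-\hat G^{(1)}_n(y)$$ $$\qquad+\frac{2(1+2\alpha)\left(\hat g^{(1)}_n(y)-1\right)\left[1-y(1+\alpha)-(1-\alpha y)^{1/\alpha+1}\right]}{2-2(1-\alpha y)^{1/\alpha+2}+y(1+2\alpha)(\alpha y+y-2)}\left[\hat g^{(1)}_n(y)\frac{y(1+\alpha)-1+(1-\alpha y)^{1/\alpha+1}}{1+\alpha}-\int_0^y\hat G^{(1)}_n(x)\,dx\right]$$ $$\qquad+\frac{(1-2\alpha)\left(\left[y(1+\alpha)-1+(1-\alpha y)^{1/\alpha+1}\right]\hat g^{(1)}_n(y)-(1+\alpha)\int_0^y\hat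 G^{(1)}_n(x)\,dx\right)^2}{(1+\alpha)\left[2-2(1-\alpha y)^{1/\alpha+2}+y(1+2\alpha)(\alpha y+y-2)\right]}.$$ Equality is attained for the distribution functions $F\in\mathrm{IGFR}(\alpha)$ satisfying $$F^{-1}(W_\alpha(x))=\begin{cases}\dfrac{\sigma}{C_\alpha(y_* )}\left[\hat g^{(1)}_n(y_* )-1+\lambda_\alpha(y_* )(x-y_* )\right]+\mu,&0\le x<y_*,\\[2mm] \dfrac{\sigma}{C_\alpha(y_* )}\left[\hat g^{(1)}_n(x)-1\right]+\mu,&y_*\le x<d.\end{cases}$$ (ii) Let $\alpha=0$. Then $$\mathbb{E}\frac{R_n^{(1)}-\mu}{\sigma}\le n,$$ with equality attained for the exponential distribution function $(\ast)$. (iii) Let $\alpha>0$ and $n\ge1$. Then $$\mathbb{E}\frac{R_n^{(1)}-\mu}{\sigma}\le \sqrt{\frac{(2\alpha+1)\left(2a_*b_*+(\alpha+1)b_*^2\right)+2a_*^2}{(1+\alpha)(2\alpha+1)}},$$ where $$a_*=(1+\alpha)^2(2\alpha+1)\left[\frac{1}{\alpha(1+\alpha)}-\int_0^{1/\alpha}\hat G^{(1)}_n(x)\,dx\right],$$ $$b_*=-\frac{a_*}{1+\alpha}=-(1+\alpha)(2\alpha+1)\left[\frac{1}{\alpha(1+\alpha)}-\int_0^{1/\alpha}\hat G^{(1)}_n(x)\,dx\right].$$ Equality is attained for the distribution function $$F(x)=1-\left(1-\alpha\left(1+\frac{(x-\mu)}{\sigma a_*}\sqrt{\frac{(2\alp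ha+1)\left(2a_*b_*+(\alpha+1)b_*^2\right)+2a_*^2}{(1+\alpha)(2\alpha+1)}}\right)\right)^{1/\alpha}.$$
   Context: Records. Let $X_1,X_2,\dots$ be i.i.d. with distribution function $F$, mean $\mu$ and variance $\sigma^2$, and let $X_{1:j}\le\dots\le X_{j:j}$ be the order statistics of $X_1,\dots,X_j$. For $k\ge1$ the $k$th record times are $T^{(k)}_0=k$, $T^{(k)}_n=\min\{j>T^{(k)}_{n-1}: X_j>X_{T^{(k)}_{n-1}+1-k:T^{(k)}_{n-1}}\}$, and the $k$th record values are $R^{(k)}_n=X_{T^{(k)}_n+1-k:T^{(k)}_n}$, $n=0,1,\dots$. With $F^{-1}$ the quantile function of $F$, the expectation of the record is evaluated by $\mathbb{E}R^{(k)}_n=\int_0^1F^{-1}(u)g^{(k)}_n(u)\,du$, where $$g^{(k)}_n(u)=\frac{k^{n+1}}{n!}[-\ln(1-u)]^n(1-u)^{k-1},\qquad G^{(k)}_n(u)=1-(1-u)^k\sum_{i=0}^n\frac{k^i}{i!}[-\ln(1-u)]^i,\quad 0<u<1.$$ Generalized Pareto distribution: for $\alpha\neq0$, $W_\alpha(x)=1-(1-\alpha x)^{1/\alpha}$, on $x\ge0$ if $\alpha<0$ and on $0\le x\le1/\alpha$ if $\alpha>0$; $W_0(x)=1-e^{-x}$, $x\ge0$. Put $d=\infty$ if $\alpha\le0$ and $d=1/\alpha$ if $\alpha>0$. The density of $W_\alpha$ is $w_\alpha$. $\mathrm{IGFR}(\alpha)$ is the class of distribution functions $F$ such that $F^{-1}\circ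 W_\alpha$ is concave on the support of $W_\alpha$. Notation: $\hat g^{(k)}_n=g^{(k)}_n\circ W_\alpha$, $\hat G^{(k)}_n=G^{(k)}_n\circ W_\alpha$, $h_\alpha=\hat g^{(k)}_n-1$ (here with $k=1$), and $$\lambda_\alpha(y)=\frac{\int_0^y(x-y)(h_\alpha(x)-h_\alpha(y))w_\alpha(x)\,dx}{\int_0^y(x-y)^2w_\alpha(x)\,dx}=\frac{\hat g^{(k)}_n(y)\int_0^yW_\alpha(x)\,dx-\int_0^y\hat G^{(k)}_n(x)\,dx}{2y\int_0^yW_\alpha(x)\,dx-2\int_0^yxW_\alpha(x)\,dx},$$ $$Y_\alpha(y)=\lambda_\alpha(y)-h_\alpha'(y),\qquad Z_\alpha(y)=\int_0^y\left(h_\alpha(x)-h_\alpha(y)-\lambda_\alpha(y)(x-y)\right)w_\alpha(x)\,dx .$$ For $k=1$, $-\frac12<\alpha<0$ and $n\ge2$, the function $h_\alpha$ is strictly convex increasing on $(0,b)$ and strictly concave increasing on $(b,\infty)$; $b$ denotes this inflection point.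
   Formalization: Corrected: in C_α²(y) the tail [W_α(y)−Ĝ(y)] is replaced by ∫_y^∞(ĝ−1)²w_α dx and the factor (1−2α) by (1+2α); in (iii) the extremal F has 1/(1+α) in place of the 1 added to (x−μ)/(σa_* )·√(…). As printed, the equality claims fail. *)

theory Defs
  imports "HOL-Probability.Probability"
begin

definition distribution_function :: "(real \<Rightarrow> real) \<Rightarrow> bool" where
  "distribution_function F \<longleftrightarrow> (\<exists>D. real_distribution D \<and> F = cdf D)"

(* At u = 0 the plain infimum would range over all reals; the value there is the left
   end-point of the support, i.e. the right limit of the quantile function. *)
definition quantile :: "(real \<Rightarrow> real) \<Rightarrow> real \<Rightarrow> real" where
  "quantile F u = (if u \<le> 0 then Inf {x. 0 < F x} else Inf {x. u \<le> F x})"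

(* For a distribution function F, interval_measure F is the law with this distribution function. *)
definition has_mean_variance :: "(real \<Rightarrow> real) \<Rightarrow> real \<Rightarrow> real \<Rightarrow> bool" where
  "has_mean_variance F \<mu> v \<longleftrightarrow>
     integrable (interval_measure F) (\<lambda>x. x) \<and>
     (LINT x|interval_measure F. x) = \<mu> \<and>
     integrable (interval_measure F) (\<lambda>x. (x - \<mu>)\<^sup>2) \<and>
     (LINT x|interval_measure F. (x - \<mu>)\<^sup>2) = v"

(* Observations are indexed from 1. *)
definition iid_sample ::
    "'a measure \<Rightarrow> (nat \<Rightarrow> 'a \<Rightarrow> real) \<Rightarrow> (real \<Rightarrow> real) \<Rightarrow> bool" where
  "iid_sample M X F \<longleftrightarrow> prob_space M \<and>
     prob_space.indep_vars M (\<lambda>_. borel) X {1..} \<and>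
     (\<forall>i\<ge>1. cdf (distr M borel (X i)) = F)"

definition order_stat :: "(nat \<Rightarrow> 'a \<Rightarrow> real) \<Rightarrow> nat \<Rightarrow> nat \<Rightarrow> 'a \<Rightarrow> real" where
  "order_stat X i j \<omega> = sort (map (\<lambda>m. X m \<omega>) [1..<Suc j]) ! (i - 1)"

(* If no later observation exceeds the current record, the record time, and with it the record
   value, stays put.  For the distributions in IGFR below this can happen with positive
   probability only when F has an atom at the right end of its support; with this convention
   the expected record is the integral of the quantile function against the density g k n
   in that case too. *)
primrec record_time :: "nat \<Rightarrow> (nat \<Rightarrow> 'a \<Rightarrow> real) \<Rightarrow> nat \<Rightarrow> 'a \<Rightarrow> nat" where
  "record_time k X 0 \<omega> = k"
| "record_time k X (Suc n) \<omega> =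
     (let T = record_time k X n \<omega>;
          exceeds = (\<lambda>j. j > T \<and> X j \<omega> > order_stat X (T + 1 - k) T \<omega>)
      in if \<exists>j. exceeds j then LEAST j. exceeds j else T)"

definition record_value :: "nat \<Rightarrow> (nat \<Rightarrow> 'a \<Rightarrow> real) \<Rightarrow> nat \<Rightarrow> 'a \<Rightarrow> real" where
  "record_value k X n \<omega> =
     (let T = record_time k X n \<omega> in order_stat X (T + 1 - k) T \<omega>)"

definition std_record_mean ::
    "'a measure \<Rightarrow> nat \<Rightarrow> (nat \<Rightarrow> 'a \<Rightarrow> real) \<Rightarrow> nat \<Rightarrow> real \<Rightarrow> real \<Rightarrow> real" where
  "std_record_mean M k X n \<mu> \<sigma> = (LINT \<omega>|M. (record_value k X n \<omega> - \<mu>) / \<sigma>)"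

definition g :: "nat \<Rightarrow> nat \<Rightarrow> real \<Rightarrow> real" where
  "g k n u = real k ^ (n + 1) / fact n * (- ln (1 - u)) ^ n * (1 - u) ^ (k - 1)"

definition G :: "nat \<Rightarrow> nat \<Rightarrow> real \<Rightarrow> real" where
  "G k n u = 1 - (1 - u) ^ k * (\<Sum>i\<le>n. real k ^ i / fact i * (- ln (1 - u)) ^ i)"

(* W and w are the generalized Pareto distribution function and density; the formulas are
   meaningful on the support only and are used only there. *)
definition W :: "real \<Rightarrow> real \<Rightarrow> real" where
  "W \<alpha> x = (if \<alpha> = 0 then 1 - exp (- x) else 1 - (1 - \<alpha> * x) powr (1 / \<alpha>))"

definition w :: "real \<Rightarrow> real \<Rightarrow> real" where
  "w \<alpha> x = (if \<alpha> = 0 then exp (- x) else (1 - \<alpha> * x) powr (1 / \<alpha> - 1))"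

(* Interior of the support of W: the end-points are omitted because the quantile function may
   tend to minus infinity at 0. *)
definition W_support :: "real \<Rightarrow> real set" where
  "W_support \<alpha> = {x. 0 < x \<and> (\<alpha> > 0 \<longrightarrow> x < 1 / \<alpha>)}"

definition IGFR :: "real \<Rightarrow> (real \<Rightarrow> real) set" where
  "IGFR \<alpha> = {F. distribution_function F \<and> concave_on (W_support \<alpha>) (\<lambda>x. quantile F (W \<alpha> x))}"

definition g_hat :: "nat \<Rightarrow> nat \<Rightarrow> real \<Rightarrow> real \<Rightarrow> real" where
  "g_hat k n \<alpha> x = g k n (W \<alpha> x)"

definition G_hat :: "nat \<Rightarrow> nat \<Rightarrow> real \<Rightarrow> real \<Rightarrow> real" where
  "G_hat k n \<alpha> x = G k n (W \<alpha> x)"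

definition h :: "nat \<Rightarrow> real \<Rightarrow> real \<Rightarrow> real" where
  "h n \<alpha> x = g_hat 1 n \<alpha> x - 1"

definition slope :: "nat \<Rightarrow> real \<Rightarrow> real \<Rightarrow> real" where
  "slope n \<alpha> y =
     integral {0..y} (\<lambda>x. (x - y) * (h n \<alpha> x - h n \<alpha> y) * w \<alpha> x) /
     integral {0..y} (\<lambda>x. (x - y)\<^sup>2 * w \<alpha> x)"

definition Y_fun :: "nat \<Rightarrow> real \<Rightarrow> real \<Rightarrow> real" where
  "Y_fun n \<alpha> y = slope n \<alpha> y - deriv (h n \<alpha>) y"

definition Z_fun :: "nat \<Rightarrow> real \<Rightarrow> real \<Rightarrow> real" where
  "Z_fun n \<alpha> y =
     integral {0..y} (\<lambda>x. (h n \<alpha> x - h n \<alpha> y - slope n \<alpha> y * (x - y)) * w \<alpha> x)"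

definition strictly_convex_on :: "real set \<Rightarrow> (real \<Rightarrow> real) \<Rightarrow> bool" where
  "strictly_convex_on S f \<longleftrightarrow> convex S \<and>
     (\<forall>x\<in>S. \<forall>y\<in>S. \<forall>t. x \<noteq> y \<and> 0 < t \<and> t < 1 \<longrightarrow>
        f ((1 - t) * x + t * y) < (1 - t) * f x + t * f y)"

definition inflection_point :: "nat \<Rightarrow> real \<Rightarrow> real" where
  "inflection_point n \<alpha> = (THE b. 0 < b \<and>
     strictly_convex_on {0<..<b} (h n \<alpha>) \<and> strict_mono_on {0<..<b} (h n \<alpha>) \<and>
     strictly_convex_on {b<..} (\<lambda>x. - h n \<alpha> x) \<and> strict_mono_on {b<..} (h n \<alpha>))"

definition Y_set :: "nat \<Rightarrow> real \<Rightarrow> real set" where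
  "Y_set n \<alpha> = {y. y > inflection_point n \<alpha> \<and> Y_fun n \<alpha> y \<ge> 0 \<and> Z_fun n \<alpha> y = 0}"

definition y_star :: "nat \<Rightarrow> real \<Rightarrow> real" where
  "y_star n \<alpha> = Inf (Y_set n \<alpha>)"

(* C_sq n alpha y is the squared norm, in the L2 space with weight w, of the function equal to
   h y + slope y * (x - y) for x < y and to h x for x >= y.  The first summand comes from
   (h y)^2 on (0,y), the second from h^2 on (y,infinity), the third from the mixed term and
   the last from slope^2, with the integrals of W and (x - y)^2 w evaluated. *)
definition C_sq :: "nat \<Rightarrow> real \<Rightarrow> real \<Rightarrow> real" where
  "C_sq n \<alpha> y =
     (let gy = g_hat 1 n \<alpha> y;
          IG = integral {0..y} (G_hat 1 n \<alpha>);
          Q = 2 - 2 * (1 - \<alpha> * y) powr (1 / \<alpha> + 2) + y * (1 + 2 * \<alpha>) * (\<alpha> * y + y - 2)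
      in (1 - (1 - \<alpha> * y) powr (1 / \<alpha>)) * (gy - 1)\<^sup>2
         + integral {y..} (\<lambda>x. (g_hat 1 n \<alpha> x - 1)\<^sup>2 * w \<alpha> x)
         + 2 * (1 + 2 * \<alpha>) * (gy - 1) * (1 - y * (1 + \<alpha>) - (1 - \<alpha> * y) powr (1 / \<alpha> + 1)) / Q
             * (gy * ((y * (1 + \<alpha>) - 1 + (1 - \<alpha> * y) powr (1 / \<alpha> + 1)) / (1 + \<alpha>)) - IG)
         + (1 + 2 * \<alpha>)
             * ((y * (1 + \<alpha>) - 1 + (1 - \<alpha> * y) powr (1 / \<alpha> + 1)) * gy - (1 + \<alpha>) * IG)\<^sup>2
             / ((1 + \<alpha>) * Q))"

definition C_bound :: "nat \<Rightarrow> real \<Rightarrow> real \<Rightarrow> real" where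
  "C_bound n \<alpha> y = sqrt (C_sq n \<alpha> y)"

definition a_star :: "nat \<Rightarrow> real \<Rightarrow> real" where
  "a_star n \<alpha> = (1 + \<alpha>)\<^sup>2 * (2 * \<alpha> + 1) *
     (1 / (\<alpha> * (1 + \<alpha>)) - integral {0..1 / \<alpha>} (G_hat 1 n \<alpha>))"

definition b_star :: "nat \<Rightarrow> real \<Rightarrow> real" where
  "b_star n \<alpha> = - a_star n \<alpha> / (1 + \<alpha>)"

definition D_bound :: "nat \<Rightarrow> real \<Rightarrow> real" where
  "D_bound n \<alpha> = sqrt
     (((2 * \<alpha> + 1) * (2 * a_star n \<alpha> * b_star n \<alpha> + (\<alpha> + 1) * (b_star n \<alpha>)\<^sup>2)
         + 2 * (a_star n \<alpha>)\<^sup>2)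
      / ((1 + \<alpha>) * (2 * \<alpha> + 1)))"

definition exponential_cdf :: "real \<Rightarrow> real \<Rightarrow> real \<Rightarrow> real" where
  "exponential_cdf \<mu> \<sigma> x =
     (if x > \<mu> - \<sigma> then 1 - exp (- 1 - (x - \<mu>) / \<sigma>) else 0)"

(* Distribution function of mu + sigma * (a_star * V + b_star) / D_bound with V distributed
   according to W; the summand 1/(1+alpha) equals - b_star / a_star, the mean of V. *)
definition pareto_cdf :: "nat \<Rightarrow> real \<Rightarrow> real \<Rightarrow> real \<Rightarrow> real \<Rightarrow> real" where
  "pareto_cdf n \<alpha> \<mu> \<sigma> x =
     (let z = 1 / (1 + \<alpha>) + (x - \<mu>) / (\<sigma> * a_star n \<alpha>) * D_bound n \<alpha>
      in if z \<le> 0 then 0 else if z \<ge> 1 / \<alpha> then 1 else 1 - (1 - \<alpha> * z) powr (1 / \<alpha>))"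

(* A sample space of real sequences carries an i.i.d. sequence for every F; the expectation
   depends on F only. *)
definition attains_equality ::
    "nat \<Rightarrow> real \<Rightarrow> real \<Rightarrow> real \<Rightarrow> real \<Rightarrow> (real \<Rightarrow> real) \<Rightarrow> bool" where
  "attains_equality n \<alpha> \<mu> \<sigma> B F \<longleftrightarrow>
     F \<in> IGFR \<alpha> \<and> has_mean_variance F \<mu> (\<sigma>\<^sup>2) \<and>
     (\<exists>(N :: (nat \<Rightarrow> real) measure) X. iid_sample N X F) \<and>
     (\<forall>(N :: (nat \<Rightarrow> real) measure) X. iid_sample N X F \<longrightarrow>
        integrable N (record_value 1 X n) \<and> std_record_mean N 1 X n \<mu> \<sigma> = B)"

end

theory Submission
  imports Defs
begin

text \<open>The law of the \<open>n\<close>th record follows from a martingale argument: \<open>\<P>(R\<^sub>n \<le> x) = G 1 n (F x)\<close>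
  because the conditional probability of the final record staying below \<open>x\<close>, given the current number
  of records and the current record, is an explicit harmonic function of the record process. Hence the
  standardized mean of \<open>R\<^sub>n\<close> is the inner product of \<open>h n \<alpha>\<close> with a concave function \<open>\<phi>\<close> of mean 0 and
  norm 1 in \<open>L\<^sup>2\<close> of the generalized Pareto law, and the best bound is the norm of the projection of
  \<open>h n \<alpha>\<close> onto the concave functions.

  If a residual is orthogonal to affine functions and negative exactly on an interval, subtracting from
  \<open>\<phi>\<close> its chord over this interval shows that it has nonpositive inner product with \<open>\<phi>\<close>.
  This identifies the projection: it is affine for \<open>\<alpha> \<ge> 0\<close>, where \<open>h n \<alpha>\<close> is convex; it is \<open>h n \<alpha>\<close> itself for
  \<open>\<alpha> < 0\<close> and \<open>n = 1\<close>; and for \<open>\<alpha> < 0\<close> and \<open>n \<ge> 2\<close> it is affine on \<open>(0, y)\<close> and equal to \<open>h n \<alpha>\<close> beyond, for a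
  zero \<open>y\<close> of \<open>Z_fun n \<alpha>\<close>. As the derivative of \<open>h n \<alpha>\<close> is strictly quasiconcave, \<open>Z_fun\<close> is negative
  wherever \<open>Y_fun \<le> 0\<close>, in particular at the inflection point, and it is positive far out, so such a zero
  exists and the condition \<open>Y_fun \<ge> 0\<close> is automatic.\<close>

text \<open>Everything is computed on one space, the standard exponential law \<open>exp1\<close>:
  for T with this law, \<open>quantile F (1 - exp (- T))\<close> has distribution function
  \<open>F\<close>, and \<open>pareto_of_exp \<alpha> T\<close> has distribution function
  \<open>W \<alpha>\<close> on the support. On this scale the \<open>n\<close>th record is a Gamma
  variable, and moments of x become integrals of powers times exponentials. The condition \<alpha> >
  -1/2 makes x square integrable, so affine functions lie in the Hilbert space; the finite variance
  of \<open>F\<close> puts \<phi> there too. The obstacle is that members of \<open>IGFR\<close> may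
  have an atom at the right end of the support. Records may then stop early, and
  \<open>F (quantile F u) = u\<close> fails at the top, so the record value need not have a density.
  Concavity excludes every other atom, and a path that stops early stops where \<open>F\<close>
  equals 1; there the harmonic function is already an indicator, so the martingale limit is still
  the indicator of the right event. For the extremal distribution functions a Galois relation with
  the prescribed quantile identifies them as distribution functions of push-forwards of
  \<open>gpd \<alpha>\<close>.\<close>

section \<open>The standard exponential law\<close>

definition exp1 :: "real measure" where
  "exp1 = density lborel (exponential_density 1)"

lemma sets_exp1 [simp, measurable_cong]: "sets exp1 = sets borel"
  by (simp add: exp1_def)

lemma space_exp1 [simp]: "space exp1 = UNIV"
  by (simp add: exp1_def)

lemma prob_space_exp1: "prob_space exp1"
  unfolding exp1_def by (rule prob_space_exponential_density) simp

lemma AE_exp1: "AE t in exp1. 0 < t"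
proof -
  have "AE t in lborel. t \<noteq> (0::real)"
    by (rule AE_lborel_singleton)
  then show ?thesis
    unfolding exp1_def
    by (subst AE_density) (auto simp: exponential_density_def)
qed

lemma has_bochner_integral_exp1_iff:
  assumes [measurable]: "f \<in> borel_measurable borel"
  shows "has_bochner_integral exp1 f I \<longleftrightarrow>
    has_bochner_integral lborel (\<lambda>t. exponential_density 1 t * f t) I"
proof
  assume "has_bochner_integral exp1 f I"
  then have "integrable exp1 f" "integral\<^sup>L exp1 f = I"
    by (auto simp: has_bochner_integral_iff)
  then show "has_bochner_integral lborel (\<lambda>t. exponential_density 1 t * f t) I"
    unfolding exp1_def has_bochner_integral_iff
    by (auto simp: integrable_density integral_density)
next
  assume "has_bochner_integral lborel (\<lambda>t. exponential_density 1 t * f t) I"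
  then show "has_bochner_integral exp1 f I"
    unfolding exp1_def has_bochner_integral_iff
    by (auto simp: integrable_density integral_density)
qed

lemma has_bochner_integral_erlang:
  assumes "0 < l"
  shows "has_bochner_integral lborel (erlang_density k l) 1"
proof (rule has_bochner_integral_nn_integral)
  show "(\<integral>\<^sup>+ x. ennreal (erlang_density k l x) \<partial>lborel) = ennreal 1"
    using nn_integral_erlang_ith_moment[OF assms, of k 0] by simp
qed (use assms in auto)

text \<open>Up to a factor the integrand against \<open>exp1\<close> is the Erlang density of shape
  \<open>i\<close> and rate \<open>1 - c\<close>. The exponential is there because powers of
  \<open>pareto_of_exp \<alpha> t\<close> are combinations of such terms.\<close>

lemma has_bochner_integral_exp1_moment:
  assumes "c < 1"
  shows "has_bochner_integral exp1 (\<lambda>t. t ^ i * exp (c * t)) (fact i / (1 - c) ^ (i + 1))"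
proof -
  have "has_bochner_integral lborel (\<lambda>t. fact i / (1 - c) ^ (i + 1) * erlang_density i (1 - c) t)
      (fact i / (1 - c) ^ (i + 1) * 1)"
    using assms by (intro has_bochner_integral_mult_right has_bochner_integral_erlang) simp
  also have "(\<lambda>t. fact i / (1 - c) ^ (i + 1) * erlang_density i (1 - c) t) =
      (\<lambda>t. exponential_density 1 t * (t ^ i * exp (c * t)))"
    using assms by (auto simp: fun_eq_iff erlang_density_def exp_diff exp_minus field_simps)
  finally show ?thesis
    by (subst has_bochner_integral_exp1_iff) simp_all
qed

lemma emeasure_exp1_Iic: "0 \<le> a \<Longrightarrow> emeasure exp1 {..a} = ennreal (1 - exp (- a))"
  unfolding exp1_def by (subst emeasure_erlang_density) (auto simp: erlang_CDF_0)

lemma measure_exp1_Iic: "0 \<le> a \<Longrightarrow> measure exp1 {..a} = 1 - exp (- a)"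
  by (simp add: measure_def emeasure_exp1_Iic)

lemma one_minus_exp_le_iff: "p < 1 \<Longrightarrow> 1 - exp (- t) \<le> p \<longleftrightarrow> t \<le> - ln (1 - p)" for p t :: real
  using ln_le_cancel_iff[of "1 - p" "exp (- t)"] by (simp del: ln_le_cancel_iff) linarith

text \<open>\<open>1 - exp (- t)\<close> is uniform on (0,1) under \<open>exp1\<close>. The value p
  = 1 is treated apart, because \<open>ln (1 - p)\<close> is then a default value.\<close>

lemma measure_exp1_le:
  assumes "0 \<le> p" "p \<le> 1"
  shows "measure exp1 {t. 1 - exp (- t) \<le> p} = p"
proof (cases "p < 1")
  case True
  then have "{t. 1 - exp (- t) \<le> p} = {..- ln (1 - p)}"
    by (auto simp: one_minus_exp_le_iff)
  with True assms show ?thesis by (simp add: measure_exp1_Iic)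
next
  case False
  then have "p = 1" using assms by simp
  then show ?thesis
    using prob_space.prob_space[OF prob_space_exp1] by simp
qed

text \<open>In the exponential scale \<open>t = hazard \<alpha> x\<close> the function \<open>g_hat 1 n \<alpha>\<close> becomes
  \<open>t ^ n / fact n\<close>, whatever \<open>\<alpha>\<close> is.\<close>

definition pareto_of_exp :: "real \<Rightarrow> real \<Rightarrow> real" where
  "pareto_of_exp \<alpha> t = (if \<alpha> = 0 then t else (1 - exp (- \<alpha> * t)) / \<alpha>)"

definition hazard :: "real \<Rightarrow> real \<Rightarrow> real" where
  "hazard \<alpha> x = (if \<alpha> = 0 then x else - ln (1 - \<alpha> * x) / \<alpha>)"

section \<open>The generalized Pareto law\<close>

text \<open>As a push-forward, rather than through its density, it turns integrals into exponential
  ones at once. The density is recovered in \<open>gpd_density\<close> for the gauge integrals with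
  weight \<open>w \<alpha>\<close>.\<close>

definition gpd :: "real \<Rightarrow> real measure" where
  "gpd \<alpha> = distr exp1 borel (pareto_of_exp \<alpha>)"

lemma measurable_pareto_of_exp [measurable]: "pareto_of_exp \<alpha> \<in> borel_measurable borel"
  unfolding pareto_of_exp_def by measurable

lemma sets_gpd [simp, measurable_cong]: "sets (gpd \<alpha>) = sets borel"
  by (simp add: gpd_def)

lemma space_gpd [simp]: "space (gpd \<alpha>) = UNIV"
  by (simp add: gpd_def)

lemma prob_space_gpd: "prob_space (gpd \<alpha>)"
  unfolding gpd_def by (intro prob_space.prob_space_distr prob_space_exp1) simp

lemma W_support_open_interval:
  "W_support \<alpha> = (if 0 < \<alpha> then {0<..<1 / \<alpha>} else {0<..})"
  by (auto simp: W_support_def)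

lemma W_support_iff: "x \<in> W_support \<alpha> \<longleftrightarrow> 0 < x \<and> 0 < 1 - \<alpha> * x"
proof (cases "\<alpha> > 0")
  case True
  then show ?thesis by (auto simp: W_support_def field_simps)
next
  case False
  then have "0 < x \<Longrightarrow> \<alpha> * x \<le> 0"
    by (simp add: mult_le_0_iff)
  with False show ?thesis by (fastforce simp: W_support_def)
qed

lemma convex_W_support: "convex (W_support \<alpha>)"
  by (simp add: W_support_open_interval)

lemma open_W_support: "open (W_support \<alpha>)"
  by (simp add: W_support_open_interval)

lemma W_support_down: "x \<in> W_support \<alpha> \<Longrightarrow> 0 < y \<Longrightarrow> y \<le> x \<Longrightarrow> y \<in> W_support \<alpha>"
  by (auto simp: W_support_def)

lemma pareto_of_exp_in: "0 < t \<Longrightarrow> pareto_of_exp \<alpha> t \<in> W_support \<alpha>"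
  by (auto simp: W_support_def pareto_of_exp_def zero_less_divide_iff divide_strict_right_mono mult_less_0_iff
    zero_less_mult_iff)

lemma one_minus_pareto_of_exp: "1 - \<alpha> * pareto_of_exp \<alpha> t = exp (- \<alpha> * t)"
  by (simp add: pareto_of_exp_def)

lemma hazard_pareto_of_exp [simp]: "hazard \<alpha> (pareto_of_exp \<alpha> t) = t"
  using one_minus_pareto_of_exp[of \<alpha> t] by (auto simp: hazard_def pareto_of_exp_def)

lemma pareto_of_exp_hazard: "0 < 1 - \<alpha> * x \<Longrightarrow> pareto_of_exp \<alpha> (hazard \<alpha> x) = x"
  by (simp add: hazard_def pareto_of_exp_def)

lemma W_eq: "0 < 1 - \<alpha> * x \<Longrightarrow> W \<alpha> x = 1 - exp (- hazard \<alpha> x)"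
  by (simp add: W_def hazard_def powr_def)

lemma w_eq: "0 < 1 - \<alpha> * x \<Longrightarrow> w \<alpha> x = exp (- hazard \<alpha> x) / (1 - \<alpha> * x)"
  by (simp add: w_def hazard_def powr_diff) (simp add: powr_def)

lemma hazard_has_derivative:
  "0 < 1 - \<alpha> * x \<Longrightarrow> (hazard \<alpha> has_real_derivative 1 / (1 - \<alpha> * x)) (at x)"
  unfolding hazard_def
  by (cases "\<alpha> = 0") (auto intro!: derivative_eq_intros simp: field_simps)

text \<open>The expressions through \<open>hazard\<close> agree with \<open>W\<close>,
  \<open>h\<close> and \<open>G_hat\<close> where \<open>1 - \<alpha> * x\<close> is positive; this
  set is open, so derivatives carry over.\<close>

lemma DERIV_transform_support:
  assumes "(f has_real_derivative D) (at x)" "0 < 1 - \<alpha> * x"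
    and "\<And>x. 0 < 1 - \<alpha> * x \<Longrightarrow> k x = f x"
  shows "(k has_real_derivative D) (at x)"
proof -
  have "open {x. 0 < 1 - \<alpha> * x}"
    by (intro open_Collect_less continuous_intros)
  from has_field_derivative_transform_within_open[OF assms(1) this] show ?thesis
    using assms(2,3) by simp
qed

lemma W_has_derivative:
  assumes "0 < 1 - \<alpha> * x"
  shows "(W \<alpha> has_real_derivative w \<alpha> x) (at x)"
proof -
  have "((\<lambda>x. 1 - exp (- hazard \<alpha> x)) has_real_derivative w \<alpha> x) (at x)"
    using assms by (auto intro!: derivative_eq_intros hazard_has_derivative simp: w_eq)
  then show ?thesis using assms W_eq by (rule DERIV_transform_support)
qed

lemma W_pareto_of_exp [simp]: "W \<alpha> (pareto_of_exp \<alpha> t) = 1 - exp (- t)"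
  by (subst W_eq) (simp_all add: one_minus_pareto_of_exp)

lemma hazard_0 [simp]: "hazard \<alpha> 0 = 0"
  by (simp add: hazard_def)

lemma W_0 [simp]: "W \<alpha> 0 = 0"
  by (simp add: W_def)

lemma w_pos: "0 < 1 - \<alpha> * x \<Longrightarrow> 0 < w \<alpha> x"
  by (simp add: w_eq)

lemma hazard_strict_mono:
  assumes "x < y" "0 < 1 - \<alpha> * x" "0 < 1 - \<alpha> * y"
  shows "hazard \<alpha> x < hazard \<alpha> y"
proof -
  consider "\<alpha> = 0" | "0 < \<alpha>" | "\<alpha> < 0" by linarith
  then show ?thesis
    using assms by cases (auto simp: hazard_def divide_simps)
qed

lemma hazard_pos: "x \<in> W_support \<alpha> \<Longrightarrow> 0 < hazard \<alpha> x"
  using hazard_strict_mono[of 0 x \<alpha>] by (simp add: W_support_iff)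

lemma pareto_of_exp_strict_mono:
  assumes "s < t"
  shows "pareto_of_exp \<alpha> s < pareto_of_exp \<alpha> t"
proof -
  consider "\<alpha> = 0" | "0 < \<alpha>" | "\<alpha> < 0" by linarith
  then show ?thesis
    using assms by cases (simp_all add: pareto_of_exp_def divide_strict_right_mono divide_strict_right_mono_neg)
qed

lemma pareto_of_exp_le_iff [simp]: "pareto_of_exp \<alpha> s \<le> pareto_of_exp \<alpha> t \<longleftrightarrow> s \<le> t"
  using pareto_of_exp_strict_mono[of s t \<alpha>] pareto_of_exp_strict_mono[of t s \<alpha>]
  by (cases s t rule: linorder_cases) auto

lemma measurable_w [measurable]: "w \<alpha> \<in> borel_measurable borel"
  unfolding w_def by measurable

lemma measurable_W [measurable]: "W \<alpha> \<in> borel_measurable borel"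
  unfolding W_def by measurable

lemma measurable_hazard [measurable]: "hazard \<alpha> \<in> borel_measurable borel"
  unfolding hazard_def by measurable

lemma measurable_W_support [measurable]: "W_support \<alpha> \<in> sets borel"
  by (simp add: open_W_support borel_open)

lemma AE_gpd: "AE x in gpd \<alpha>. x \<in> W_support \<alpha>"
  unfolding gpd_def
proof (subst AE_distr_iff)
  show "AE t in exp1. pareto_of_exp \<alpha> t \<in> W_support \<alpha>"
    using AE_exp1 by eventually_elim (rule pareto_of_exp_in)
qed auto

lemma emeasure_gpd_Iic:
  assumes "x \<in> W_support \<alpha>"
  shows "emeasure (gpd \<alpha>) {..x} = ennreal (W \<alpha> x)"
proof -
  have "emeasure (gpd \<alpha>) {..x} = emeasure exp1 (pareto_of_exp \<alpha> -` {..x})"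
    unfolding gpd_def by (subst emeasure_distr) auto
  also have "pareto_of_exp \<alpha> -` {..x} = {..hazard \<alpha> x}"
    using assms pareto_of_exp_hazard[of \<alpha> x]
    by (auto simp: W_support_iff) (metis pareto_of_exp_le_iff)+
  finally show ?thesis
    using assms hazard_pos[OF assms] by (simp add: emeasure_exp1_Iic W_eq W_support_iff)
qed

lemma emeasure_gpd_Iic_nonpos: "x \<le> 0 \<Longrightarrow> emeasure (gpd \<alpha>) {..x} = 0"
proof -
  assume "x \<le> 0"
  have "AE y in gpd \<alpha>. \<not> y \<le> x"
    using AE_gpd[of \<alpha>] by eventually_elim (use \<open>x \<le> 0\<close> in \<open>auto simp: W_support_def\<close>)
  from emeasure_eq_0_AE[OF this] show ?thesis
    by (simp add: atMost_def)
qed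

lemma emeasure_gpd_Iic_beyond:
  assumes "0 < x" "x \<notin> W_support \<alpha>"
  shows "emeasure (gpd \<alpha>) {..x} = 1"
proof -
  interpret prob_space "gpd \<alpha>" by (rule prob_space_gpd)
  have "AE y in gpd \<alpha>. y \<in> {..x}"
    using AE_gpd[of \<alpha>]
    by eventually_elim (meson W_support_down assms atMost_iff linorder_le_cases)
  then show ?thesis
    by (intro emeasure_eq_1_AE) auto
qed

text \<open>Two probability measures are compared through their distribution functions: on the
  support by integrating the derivative of \<open>W \<alpha>\<close>, outside it because both give
  the support mass 1.\<close>

lemma gpd_density: "gpd \<alpha> = density lborel (\<lambda>x. ennreal (indicator (W_support \<alpha>) x * w \<alpha> x))"
  (is "_ = ?\<nu>")
proof -
  have Iic: "emeasure ?\<nu> {..x} = ennreal (W \<alpha> x)" if x: "x \<in> W_support \<alpha>" for x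
  proof -
    have dom: "0 < 1 - \<alpha> * y" if "0 \<le> y" "y \<le> x" for y
      using W_support_down[OF x, of y] that by (cases "y = 0") (auto simp: W_support_iff)
    have "emeasure ?\<nu> {..x} = (\<integral>\<^sup>+ y. ennreal (indicator (W_support \<alpha>) y * w \<alpha> y) * indicator {..x} y \<partial>lborel)"
      by (simp add: emeasure_density)
    also have "\<dots> = (\<integral>\<^sup>+ y. ennreal (w \<alpha> y) * indicator {0..x} y \<partial>lborel)"
    proof (rule nn_integral_cong_AE)
      have "AE y in lborel. y \<noteq> (0::real)" by (rule AE_lborel_singleton)
      then show "AE y in lborel. ennreal (indicator (W_support \<alpha>) y * w \<alpha> y) * indicator {..x} y =
          ennreal (w \<alpha> y) * indicator {0..x} y"
        by eventually_elim
          (use W_support_down[OF x] x in \<open>auto split: split_indicator simp: W_support_def\<close>)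
    qed
    also have "\<dots> = ennreal (W \<alpha> x - W \<alpha> 0)"
      using x dom w_pos by (intro nn_integral_FTC_Icc)
        (auto intro!: W_has_derivative less_imp_le simp: W_support_def DERIV_subset has_real_derivative_iff_has_vector_derivative[symmetric])
    finally show ?thesis by simp
  qed
  have sup: "emeasure ?\<nu> (W_support \<alpha>) = 1"
  proof -
    \<comment> \<open>These sets exhaust the support with masses tending to 1; \<open>Suc\<close>
      keeps the argument positive, so that each end-point lies inside the support.\<close>
    let ?A = "\<lambda>k. {..pareto_of_exp \<alpha> (real (Suc k))} \<inter> W_support \<alpha>"
    have eq: "emeasure ?\<nu> (?A k) = ennreal (1 - exp (- real (Suc k)))" for k
    proof -
      have "emeasure ?\<nu> (?A k) = emeasure ?\<nu> {..pareto_of_exp \<alpha> (real (Suc k))}"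
        by (simp add: emeasure_density) (auto intro!: nn_integral_cong split: split_indicator)
      then show ?thesis
        using Iic[OF pareto_of_exp_in] by simp
    qed
    have "(\<lambda>k. emeasure ?\<nu> (?A k)) \<longlonglongrightarrow> emeasure ?\<nu> (\<Union>k. ?A k)"
      by (intro Lim_emeasure_incseq) (auto simp: incseq_def intro: order_trans)
    moreover have "(\<Union>k. ?A k) = W_support \<alpha>"
    proof -
      have "\<exists>k. x \<le> pareto_of_exp \<alpha> (real (Suc k))" if x: "x \<in> W_support \<alpha>" for x
      proof -
        obtain k where "hazard \<alpha> x \<le> real k" using real_arch_simple by blast
        then have "pareto_of_exp \<alpha> (hazard \<alpha> x) \<le> pareto_of_exp \<alpha> (real (Suc k))" by simp
        then show ?thesis
          using x by (intro exI[of _ k]) (metis W_support_iff pareto_of_exp_hazard)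
      qed
      then show ?thesis by auto
    qed
    moreover have "(\<lambda>k. ennreal (1 - exp (- real (Suc k)))) \<longlonglongrightarrow> ennreal (1 - 0)"
      by (intro tendsto_ennrealI tendsto_intros filterlim_compose[OF exp_at_bot]
        filterlim_compose[OF filterlim_uminus_at_bot_at_top] filterlim_compose[OF filterlim_real_sequentially] filterlim_Suc)
    ultimately show ?thesis
      unfolding eq using LIMSEQ_unique by fastforce
  qed
  have outside: "emeasure ?\<nu> {..x} = emeasure ?\<nu> ({..x} \<inter> W_support \<alpha>)" for x
    by (simp add: emeasure_density) (auto intro!: nn_integral_cong split: split_indicator)
  have "emeasure ?\<nu> UNIV = emeasure ?\<nu> (W_support \<alpha>)"
    by (simp add: emeasure_density) (auto intro!: nn_integral_cong split: split_indicator)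
  then have prob: "prob_space ?\<nu>"
    using sup by (intro prob_spaceI) simp
  show ?thesis
  proof (rule cdf_unique)
    show "real_distribution (gpd \<alpha>)" "real_distribution ?\<nu>"
      using prob_space_gpd prob by (auto simp: real_distribution_def real_distribution_axioms_def)
    show "cdf (gpd \<alpha>) = cdf ?\<nu>"
    proof
      fix x
      consider "x \<le> 0" | "x \<in> W_support \<alpha>" | "0 < x" "x \<notin> W_support \<alpha>" by fastforce
      then have "emeasure (gpd \<alpha>) {..x} = emeasure ?\<nu> {..x}"
      proof cases
        case 1
        then have "{..x} \<inter> W_support \<alpha> = {}" by (auto simp: W_support_def)
        with 1 show ?thesis by (simp add: outside emeasure_gpd_Iic_nonpos)
      next
        case 2
        then show ?thesis by (simp add: Iic emeasure_gpd_Iic)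
      next
        case 3
        then have "{..x} \<inter> W_support \<alpha> = W_support \<alpha>" by (auto simp: W_support_def split: if_splits)
        with 3 show ?thesis by (simp add: outside sup emeasure_gpd_Iic_beyond)
      qed
      then show "cdf (gpd \<alpha>) x = cdf ?\<nu> x"
        by (simp add: cdf_def measure_def)
    qed
  qed
qed

lemma has_bochner_integral_gpd_iff:
  fixes f :: "real \<Rightarrow> real"
  assumes [measurable]: "f \<in> borel_measurable borel"
  shows "has_bochner_integral (gpd \<alpha>) f I \<longleftrightarrow> has_bochner_integral exp1 (\<lambda>t. f (pareto_of_exp \<alpha> t)) I"
  unfolding gpd_def has_bochner_integral_iff
  by (subst integrable_distr_eq[of _ _ borel], measurable, subst integral_distr[of _ _ borel], measurable)

text \<open>Link between the measure \<open>gpd \<alpha>\<close> and the gauge integrals with weight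
  \<open>w \<alpha>\<close> in \<open>slope\<close>, \<open>Z_fun\<close> and
  \<open>C_sq\<close>.\<close>

lemma has_integral_gpd:
  assumes "integrable (gpd \<alpha>) f" and [measurable]: "f \<in> borel_measurable borel"
  shows "((\<lambda>x. f x * w \<alpha> x) has_integral (LINT x|gpd \<alpha>. f x)) (W_support \<alpha>)"
proof -
  have nn: "AE x in lborel. 0 \<le> indicator (W_support \<alpha>) x * w \<alpha> x"
    using w_pos by (auto simp: W_support_iff intro!: AE_I2 split: split_indicator intro: less_imp_le)
  have "integrable lborel (\<lambda>x. (indicator (W_support \<alpha>) x * w \<alpha> x) * f x)"
    using assms(1) nn unfolding gpd_density by (subst (asm) integrable_density) auto
  from has_integral_integral_lborel[OF this]
  have "((\<lambda>x. (indicator (W_support \<alpha>) x * w \<alpha> x) * f x) has_integral (LINT x|gpd \<alpha>. f x)) UNIV"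
    unfolding gpd_density using nn by (subst integral_density) auto
  also have "(\<lambda>x. (indicator (W_support \<alpha>) x * w \<alpha> x) * f x) = (\<lambda>x. if x \<in> W_support \<alpha> then f x * w \<alpha> x else 0)"
    by (auto split: split_indicator)
  finally show ?thesis
    by (simp add: has_integral_restrict_UNIV)
qed

lemma AE_gpd_neq: "AE x in gpd \<alpha>. x \<noteq> c"
proof -
  have "AE x in lborel. x \<noteq> c" by (rule AE_lborel_singleton)
  then show ?thesis
    unfolding gpd_density by (subst AE_density) auto
qed

section \<open>The law of the records\<close>

text \<open>Applies to records with \<open>k = 1\<close>, where the index \<open>T + 1 - k\<close>
  is \<open>T\<close>.\<close>

lemma order_stat_last:
  assumes "1 \<le> T"
  shows "order_stat X T T \<omega> = Max ((\<lambda>i. X i \<omega>) ` {1..T})"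
proof -
  let ?xs = "map (\<lambda>m. X m \<omega>) [1..<Suc T]"
  have len: "length (sort ?xs) = T" by simp
  have "sort ?xs ! (T - 1) = Max (set (sort ?xs))"
  proof (rule Max_eqI[symmetric])
    show "sort ?xs ! (T - 1) \<in> set (sort ?xs)"
      using assms len by (intro nth_mem) linarith
    fix y assume "y \<in> set (sort ?xs)"
    then obtain i where "i < T" "y = sort ?xs ! i"
      using len by (metis in_set_conv_nth)
    then show "y \<le> sort ?xs ! (T - 1)"
      using len assms by (auto intro!: sorted_nth_mono)
  qed simp
  also have "set (sort ?xs) = (\<lambda>i. X i \<omega>) ` {1..T}"
    by (simp only: set_sort set_map set_upt atLeastLessThanSuc_atLeastAtMost)
  finally show ?thesis by (simp only: order_stat_def)
qed

lemma record_time_pos: "1 \<le> record_time 1 X i \<omega>"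
  by (induction i) (auto simp: Let_def intro: LeastI2)

declare record_time.simps(2) [simp del]

lemma record_value_Max:
  "record_value 1 X i \<omega> = Max ((\<lambda>j. X j \<omega>) ` {1..record_time 1 X i \<omega>})"
  unfolding record_value_def Let_def using order_stat_last[OF record_time_pos] by simp

lemma record_time_Suc:
  "record_time 1 X (Suc i) \<omega> =
    (let T = record_time 1 X i \<omega>; R = record_value 1 X i \<omega>
     in if \<exists>j>T. R < X j \<omega> then LEAST j. T < j \<and> R < X j \<omega> else T)"
  by (simp add: record_time.simps(2) record_value_def Let_def)

text \<open>The number of records after the first one, and the current record, once
  \<open>s 1, \<dots>, s (j + 1)\<close> are known; the process is stopped at the \<open>n\<close>th record.\<close>

primrec record_state :: "nat \<Rightarrow> (nat \<Rightarrow> real) \<Rightarrow> nat \<Rightarrow> nat \<times> real" where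
  "record_state n s 0 = (0, s 1)"
| "record_state n s (Suc j) =
    (if fst (record_state n s j) < n \<and> snd (record_state n s j) < s (Suc (Suc j))
     then (Suc (fst (record_state n s j)), s (Suc (Suc j))) else record_state n s j)"

text \<open>The state with index \<open>j\<close> has used \<open>j + 1\<close> observations, whence
  the range of \<open>i\<close>. Observations matter only while \<open>c < n\<close>, since the
  chain is stopped at \<open>n\<close> records.\<close>

lemma record_state_stay:
  assumes "record_state n s j = (c, m)" "\<And>i. j + 1 < i \<Longrightarrow> i \<le> j + 1 + d \<Longrightarrow> c < n \<Longrightarrow> s i \<le> m"
  shows "record_state n s (j + d) = (c, m)"
  using assms(2)
proof (induction d)
  case (Suc d)
  then have "record_state n s (j + d) = (c, m)" by auto
  moreover have "\<not> (c < n \<and> m < s (Suc (Suc (j + d))))"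
    using Suc.prems[of "Suc (Suc (j + d))"] by auto
  ultimately show ?case by simp
qed (simp add: assms(1))

text \<open>The count \<open>c\<close> can lag behind \<open>i\<close>: \<open>record_time\<close>
  stays put when nothing exceeds the record, whereas \<open>record_state\<close> counts genuine
  records. In that case no later observation exceeds the record value, which the disjunction
  remembers.\<close>

lemma record_state_at_record_time:
  assumes "i \<le> n"
  shows "\<exists>c\<le>i. (c = i \<or> (\<forall>j>record_time 1 X i \<omega>. X j \<omega> \<le> record_value 1 X i \<omega>)) \<and>
    record_state n (\<lambda>j. X j \<omega>) (record_time 1 X i \<omega> - 1) = (c, record_value 1 X i \<omega>)"
  using assms
proof (induction i)
  case 0
  have "record_value 1 X 0 \<omega> = X 1 \<omega>"
    unfolding record_value_Max by simp
  then show ?case by simp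
next
  case (Suc i)
  let ?s = "\<lambda>j. X j \<omega>"
  let ?T = "record_time 1 X i \<omega>" and ?R = "record_value 1 X i \<omega>"
  obtain c where c: "c \<le> i" "c = i \<or> (\<forall>j>?T. ?s j \<le> ?R)" "record_state n ?s (?T - 1) = (c, ?R)"
    using Suc by auto
  show ?case
  proof (cases "\<exists>j>?T. ?R < ?s j")
    case False
    then have T': "record_time 1 X (Suc i) \<omega> = ?T"
      unfolding record_time_Suc Let_def by (rule if_not_P)
    then have R': "record_value 1 X (Suc i) \<omega> = ?R"
      unfolding record_value_Max by simp
    have "\<forall>j>?T. ?s j \<le> ?R"
      using False by (meson not_le)
    then show ?thesis
      using c(1,3) unfolding T' R' by (intro exI[of _ c]) simp
  next
    case True
    define L where "L = (LEAST j. ?T < j \<and> ?R < ?s j)"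
    have T': "record_time 1 X (Suc i) \<omega> = L"
      unfolding record_time_Suc Let_def L_def using True by (rule if_P)
    have L: "?T < L" "?R < ?s L"
      using LeastI_ex[OF True] by (auto simp: L_def)
    have before: "?s j \<le> ?R" if "?T < j" "j < L" for j
      using not_less_Least[of j "\<lambda>j. ?T < j \<and> ?R < ?s j"] that by (auto simp: L_def)
    have upto: "?s j \<le> ?R" if "1 \<le> j" "j \<le> ?T" for j
      unfolding record_value_Max using that by (intro Max_ge) auto
    have "Max (?s ` {1..L}) = ?s L"
    proof (rule Max_eqI)
      fix y assume "y \<in> ?s ` {1..L}"
      then obtain j where "1 \<le> j" "j \<le> L" "y = ?s j" by auto
      then show "y \<le> ?s L"
        using before[of j] upto[of j] L by (cases "j = L"; cases "j \<le> ?T") auto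
    qed (use L record_time_pos[of X i \<omega>] in auto)
    then have R': "record_value 1 X (Suc i) \<omega> = ?s L"
      unfolding record_value_Max T' .
    have "c = i" using c(2) True by auto
    have T1: "1 \<le> ?T" by (rule record_time_pos)
    \<comment> \<open>State \<open>k\<close> has seen the observations 1 to \<open>L - 1\<close>, so
      it is the state just before the new record at time \<open>L\<close>.\<close>
    obtain k where k: "L = Suc (Suc k)"
      using T1 L(1) by (intro that[of "L - 2"]) linarith
    have shift: "?T - 1 + (L - 1 - ?T) = k"
      using T1 L(1) unfolding k by linarith
    have "record_state n ?s (?T - 1 + (L - 1 - ?T)) = (c, ?R)"
      using T1 L by (intro record_state_stay c before) auto
    then have "record_state n ?s k = (c, ?R)"
      unfolding shift .
    then have "record_state n ?s (L - 1) = (Suc i, ?s L)"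
      using L(2) Suc.prems unfolding k \<open>c = i\<close> by simp
    then show ?thesis
      unfolding T' R' by (intro exI[of _ "Suc i"] conjI disjI1 order_refl refl)
  qed
qed

text \<open>Every path becomes constant, also after an early stop. This gives both the measurability
  of the record value, as a limit of states, and the limit in the martingale argument.\<close>

lemma record_state_eventually:
  obtains c J where "c \<le> n" "c = n \<or> (\<forall>j>J. X j \<omega> \<le> record_value 1 X n \<omega>)"
    "\<And>j. J \<le> j \<Longrightarrow> record_state n (\<lambda>j. X j \<omega>) j = (c, record_value 1 X n \<omega>)"
proof -
  let ?T = "record_time 1 X n \<omega>" and ?R = "record_value 1 X n \<omega>"
  obtain c where c: "c \<le> n" "c = n \<or> (\<forall>j>?T. X j \<omega> \<le> ?R)"
    "record_state n (\<lambda>j. X j \<omega>) (?T - 1) = (c, ?R)"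
    using record_state_at_record_time[OF order_refl, of n X \<omega>] by (elim exE conjE)
  show ?thesis
  proof (rule that[of c ?T])
    fix j assume j: "?T \<le> j"
    have "record_state n (\<lambda>j. X j \<omega>) (?T - 1 + (j - (?T - 1))) = (c, ?R)"
      using c record_time_pos[of X n \<omega>] by (intro record_state_stay) auto
    then show "record_state n (\<lambda>j. X j \<omega>) j = (c, ?R)"
      using j by simp
  qed (use c in auto)
qed

lemma record_state_cong:
  "(\<And>i. 1 \<le> i \<Longrightarrow> i \<le> Suc j \<Longrightarrow> s i = s' i) \<Longrightarrow> record_state n s j = record_state n s' j"
  by (induction j) auto

lemma measurable_record_state:
  assumes "{1..Suc j} \<subseteq> I"
  shows "(\<lambda>s. record_state n s j) \<in> PiM I (\<lambda>_. borel) \<rightarrow>\<^sub>M count_space UNIV \<Otimes>\<^sub>M borel"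
  using assms
proof (induction j)
  case 0
  then have "(\<lambda>s. s 1) \<in> PiM I (\<lambda>_. borel) \<rightarrow>\<^sub>M (borel :: real measure)"
    by (intro measurable_component_singleton) auto
  then show ?case by simp
next
  case (Suc j)
  have [measurable]: "(\<lambda>s. record_state n s j) \<in> PiM I (\<lambda>_. borel) \<rightarrow>\<^sub>M count_space UNIV \<Otimes>\<^sub>M borel"
    using Suc.prems by (intro Suc.IH) (auto simp: subset_iff)
  have [measurable]: "(\<lambda>s. s (Suc (Suc j))) \<in> PiM I (\<lambda>_. borel) \<rightarrow>\<^sub>M (borel :: real measure)"
    using Suc.prems by (intro measurable_component_singleton) auto
  show ?case
    unfolding record_state.simps by measurable
qed

section \<open>The quantile function and the harmonic function of the record process\<close>

lemma quantile_pos: "0 < u \<Longrightarrow> quantile F u = Inf {x. u \<le> F x}"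
  by (simp add: quantile_def)

text \<open>Only an atom at a point where \<open>F\<close> reaches 1 remains possible: an atom at x
  with \<open>F x < 1\<close> would make x the quantile of levels strictly below
  \<open>F x\<close>.\<close>

definition no_inner_atoms :: "(real \<Rightarrow> real) \<Rightarrow> bool" where
  "no_inner_atoms F \<longleftrightarrow>
    (\<forall>u\<in>{0<..<1}. F (quantile F u) < 1 \<longrightarrow> F (quantile F u) = u)"

context cdf_distribution
begin

lemma quantile_le_iff:
  assumes "0 < u" "u < 1"
  shows "quantile C u \<le> x \<longleftrightarrow> u \<le> C x"
  unfolding quantile_pos[OF assms(1)] by (rule pseudoinverse[OF assms, symmetric])

lemma measurable_quantile [measurable]: "quantile C \<in> borel_measurable borel"
proof -
  \<comment> \<open>Outside (0,1) the quantile has one value on u \<le> 0, one at 1 and one beyond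
    1, so only the generalized inverse \<open>I\<close> on (0,1) matters for measurability.\<close>
  have "quantile C = (\<lambda>u. indicator {0<..<1} u *\<^sub>R I u +
      (if u \<le> 0 then Inf {x. 0 < C x} else if u < 1 then 0 else if u = 1 then I 1 else Inf {}))"
    (is "_ = ?f")
  proof
    fix u :: real
    have "{x. u \<le> C x} = {}" if "1 < u"
      using that cdf_bounded_prob by (auto simp: not_le intro: le_less_trans)
    then have "I u = Inf {}" if "1 < u" using that by simp
    then show "quantile C u = ?f u"
      by (auto simp: quantile_def not_less not_le split: split_indicator)
  qed
  moreover have "(\<lambda>u. indicator {0<..<1} u *\<^sub>R I u) \<in> borel_measurable borel"
    using measurable_CI by (subst (asm) borel_measurable_restrict_space_iff) auto
  ultimately show ?thesis by simp
qed

text \<open>Inverse transform sampling with the uniform variable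
  \<open>1 - exp (- t)\<close>.\<close>

lemma distr_exp1_quantile: "distr exp1 borel (\<lambda>t. quantile C (1 - exp (- t))) = M"
proof (rule cdf_unique)
  interpret E: prob_space exp1 by (rule prob_space_exp1)
  show "real_distribution M" by standard
  show "real_distribution (distr exp1 borel (\<lambda>t. quantile C (1 - exp (- t))))"
    by (rule E.real_distribution_distr) measurable
  show "cdf (distr exp1 borel (\<lambda>t. quantile C (1 - exp (- t)))) = C"
  proof
    fix x
    have ev: "AE t in exp1. quantile C (1 - exp (- t)) \<le> x \<longleftrightarrow> 1 - exp (- t) \<le> C x"
      using AE_exp1 by eventually_elim (simp add: quantile_le_iff)
    have "cdf (distr exp1 borel (\<lambda>t. quantile C (1 - exp (- t)))) x =
        measure exp1 {t. quantile C (1 - exp (- t)) \<le> x}"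
      by (subst cdf_def, subst measure_distr) (auto simp: vimage_def)
    also have "\<dots> = measure exp1 {t. 1 - exp (- t) \<le> C x}"
      using ev by (intro measure_eq_AE) auto
    also have "\<dots> = C x"
      by (rule measure_exp1_le[OF cdf_nonneg cdf_bounded_prob])
    finally show "cdf (distr exp1 borel (\<lambda>t. quantile C (1 - exp (- t)))) x = C x" .
  qed
qed

lemma has_bochner_integral_quantile_iff:
  fixes f :: "real \<Rightarrow> real"
  assumes [measurable]: "f \<in> borel_measurable borel"
  shows "has_bochner_integral M f J \<longleftrightarrow>
    has_bochner_integral exp1 (\<lambda>t. f (quantile C (1 - exp (- t)))) J"
  unfolding has_bochner_integral_iff
  by (subst (1 2) distr_exp1_quantile[symmetric])
    (subst integrable_distr_eq[of _ _ borel], measurable, subst integral_distr[of _ _ borel], measurable)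

end

text \<open>On the exponential scale records behave like a Poisson process of rate 1: the factor
  after the indicator is the probability of at least \<open>k\<close> points in an interval of
  length \<open>b - t\<close>. Integrating over the first point t beyond \<open>a\<close> gives
  \<open>exp (- a)\<close> times the probability of at least \<open>k + 1\<close> points in length
  \<open>b - a\<close>.\<close>

lemma integral_exp1_tail:
  fixes a b :: real
  assumes "0 \<le> a" "a \<le> b"
  shows "(LINT t|exp1. indicator {a<..b} t * (1 - exp (t - b) * (\<Sum>i<k. (b - t) ^ i / fact i))) =
    exp (- a) - exp (- b) * (\<Sum>i<Suc k. (b - a) ^ i / fact i)"
proof -
  let ?f = "\<lambda>t. exp (- t) - exp (- b) * (\<Sum>i<k. (b - t) ^ i / fact i)"
  \<comment> \<open>At \<open>b\<close> every summand vanishes, and \<open>- exp (- b)\<close>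
    supplies the term with index 0 of the longer sum.\<close>
  let ?F = "\<lambda>t. - exp (- t) + exp (- b) * (\<Sum>i<k. (b - t) ^ Suc i / fact (Suc i))"
  have deriv: "(?F has_real_derivative ?f t) (at t)" for t
  proof -
    have "((\<lambda>t. (b - t) ^ Suc i / fact (Suc i)) has_real_derivative - ((b - t) ^ i / fact i)) (at t)" for i
    proof -
      have "((\<lambda>t. b - t) has_real_derivative - 1) (at t)"
        by (auto intro!: derivative_eq_intros)
      from DERIV_cdivide[OF DERIV_power_Suc[OF this, of i], of "fact (Suc i)"]
      have "((\<lambda>t. (b - t) ^ Suc i / fact (Suc i)) has_real_derivative
          (1 + real i) * (- 1 * (b - t) ^ i) / fact (Suc i)) (at t)" .
      also have "(1 + real i) * (- 1 * (b - t) ^ i) / fact (Suc i) = - ((b - t) ^ i / fact i)"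
        unfolding fact_Suc by (simp add: divide_simps)
      finally show ?thesis .
    qed
    then have sum: "((\<lambda>t. \<Sum>i<k. (b - t) ^ Suc i / fact (Suc i)) has_real_derivative
        (\<Sum>i<k. - ((b - t) ^ i / fact i))) (at t)"
      by (intro DERIV_sum)
    have "((\<lambda>t. - exp (- t)) has_real_derivative exp (- t)) (at t)"
      by (auto intro!: derivative_eq_intros)
    from DERIV_add[OF this DERIV_cmult[OF sum, of "exp (- b)"]]
    show ?thesis
      by (simp add: sum_negf del: power_Suc fact_Suc)
  qed
  have "(LINT t|exp1. indicator {a<..b} t * (1 - exp (t - b) * (\<Sum>i<k. (b - t) ^ i / fact i))) =
      (LINT t|lborel. exponential_density 1 t *
        (indicator {a<..b} t * (1 - exp (t - b) * (\<Sum>i<k. (b - t) ^ i / fact i))))"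
    unfolding exp1_def by (subst integral_density) auto
  also have "\<dots> = (LINT t|lborel. ?f t * indicator {a..b} t)"
  proof (rule integral_cong_AE)
    have "AE t in lborel. t \<noteq> a" by (rule AE_lborel_singleton)
    then show "AE t in lborel. exponential_density 1 t *
        (indicator {a<..b} t * (1 - exp (t - b) * (\<Sum>i<k. (b - t) ^ i / fact i))) =
        ?f t * indicator {a..b} t"
      by eventually_elim
        (use assms in \<open>auto simp: exponential_density_def algebra_simps exp_diff exp_minus divide_simps split: split_indicator\<close>)
  qed measurable
  also have "\<dots> = ?F b - ?F a"
    by (intro integral_FTC_Icc_real assms deriv continuous_intros) simp
  also have "\<dots> = exp (- a) - exp (- b) * (\<Sum>i<Suc k. (b - a) ^ i / fact i)"
    unfolding sum.lessThan_Suc_shift by (simp add: distrib_left del: power_Suc fact_Suc sum.lessThan_Suc)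
  finally show ?thesis .
qed

text \<open>For the law with distribution function \<open>F\<close>: the probability that the record value after \<open>k\<close>
  further records does not exceed \<open>x\<close> if the current record is \<open>m\<close>. It is harmonic for the record
  process, see \<open>integral_record_step\<close>. For \<open>F x = 1\<close> the factor \<open>1 - F x\<close> makes the formula correct
  in spite of the divisions by zero.\<close>

definition record_below :: "(real \<Rightarrow> real) \<Rightarrow> real \<Rightarrow> nat \<Rightarrow> real \<Rightarrow> real" where
  "record_below F x k m = (if m \<le> x then
     1 - (1 - F x) / (1 - F m) * (\<Sum>i<k. (ln ((1 - F m) / (1 - F x))) ^ i / fact i) else 0)"

lemma record_below_0 [simp]: "record_below F x 0 m = (if m \<le> x then 1 else 0)"
  by (simp add: record_below_def)

lemma record_below_1: "F x = 1 \<Longrightarrow> record_below F x k m = (if m \<le> x then 1 else 0)"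
  by (simp add: record_below_def)

context cdf_distribution
begin

lemma measurable_record_below [measurable]: "record_below C x k \<in> borel_measurable borel"
  unfolding record_below_def by measurable

text \<open>The bound is independent of \<open>m\<close> and uniform in \<open>k \<le> n\<close>, so
  it serves as dominating constant for the whole stopped process.\<close>

lemma abs_record_below_le:
  assumes "k \<le> n"
  shows "\<bar>record_below C x k m\<bar> \<le> 1 + (\<Sum>i<n. (- ln (1 - C x)) ^ i / fact i)"
proof -
  have L: "0 \<le> - ln (1 - C x)" if "C x < 1"
    using that cdf_nonneg[of x] by simp
  have K: "0 \<le> (\<Sum>i<n. (- ln (1 - C x)) ^ i / fact i)"
    using L cdf_bounded_prob[of x] by (cases "C x < 1") (auto intro!: sum_nonneg)
  show ?thesis
  proof (cases "m \<le> x \<and> C x < 1")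
    case False
    then show ?thesis
      using K cdf_bounded_prob[of x] by (auto simp: record_below_def not_less)
  next
    case True
    have m: "C m \<le> C x" using True by (auto intro: cdf_nondecreasing)
    let ?l = "ln ((1 - C m) / (1 - C x))"
    have l: "0 \<le> ?l" "?l \<le> - ln (1 - C x)"
      using True m cdf_nonneg[of m] by (auto simp: ln_div)
    have r: "0 \<le> (1 - C x) / (1 - C m)" "(1 - C x) / (1 - C m) \<le> 1"
      using True m by auto
    have "\<bar>record_below C x k m\<bar> \<le> 1 + (1 - C x) / (1 - C m) * (\<Sum>i<k. ?l ^ i / fact i)"
    proof -
      have "0 \<le> (1 - C x) / (1 - C m) * (\<Sum>i<k. ?l ^ i / fact i)"
        using l r by (intro mult_nonneg_nonneg[of "(1 - C x) / (1 - C m)"] sum_nonneg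
          divide_nonneg_nonneg[of "?l ^ _"] zero_le_power) simp_all
      moreover have "record_below C x k m = 1 - (1 - C x) / (1 - C m) * (\<Sum>i<k. ?l ^ i / fact i)"
        using True by (simp add: record_below_def)
      ultimately show ?thesis by linarith
    qed
    also have "(1 - C x) / (1 - C m) * (\<Sum>i<k. ?l ^ i / fact i) \<le> 1 * (\<Sum>i<k. ?l ^ i / fact i)"
      using l r by (intro mult_right_mono sum_nonneg) auto
    also have "1 * (\<Sum>i<k. ?l ^ i / fact i) \<le> (\<Sum>i<k. (- ln (1 - C x)) ^ i / fact i)"
      using l by (simp, intro sum_mono divide_right_mono power_mono) auto
    also have "\<dots> \<le> (\<Sum>i<n. (- ln (1 - C x)) ^ i / fact i)"
      using assms L True by (intro sum_mono2) auto
    finally show ?thesis by simp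
  qed
qed

lemma integrable_record_below: "integrable M (record_below C x k)"
  using abs_record_below_le[OF order_refl]
  by (intro integrable_const_bound[where B = "1 + (\<Sum>i<k. (- ln (1 - C x)) ^ i / fact i)"]) auto

text \<open>This is \<open>integral_exp1_tail\<close> with \<open>a\<close> and \<open>b\<close> the
  exponential levels of \<open>q\<close> and \<open>C x\<close>; the absence of inner atoms gives
  \<open>C (quantile C u) = u\<close> at the levels below that of x. The choice
  \<open>q = C m\<close> serves the step from a record m, and \<open>q = 0\<close> the first
  observation.\<close>

lemma integral_record_below:
  assumes cont: "no_inner_atoms C"
    and "C x < 1" and q: "0 \<le> q" "q \<le> C x"
  shows "(LINT t|exp1. indicator {- ln (1 - q)<..} t * record_below C x k (quantile C (1 - exp (- t)))) =
    (1 - q) - (1 - C x) * (\<Sum>i<Suc k. (ln ((1 - q) / (1 - C x))) ^ i / fact i)"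
proof -
  define a where "a = - ln (1 - q)"
  define b where "b = - ln (1 - C x)"
  have ea: "exp (- a) = 1 - q" and eb: "exp (- b) = 1 - C x"
    using assms by (auto simp: a_def b_def)
  have "0 \<le> a" "a \<le> b"
    using assms by (auto simp: a_def b_def)
  have "(LINT t|exp1. indicator {a<..} t * record_below C x k (quantile C (1 - exp (- t)))) =
      (LINT t|exp1. indicator {a<..b} t * (1 - exp (t - b) * (\<Sum>i<k. (b - t) ^ i / fact i)))"
  proof (rule integral_cong_AE)
    show "AE t in exp1. indicator {a<..} t * record_below C x k (quantile C (1 - exp (- t))) =
        indicator {a<..b} t * (1 - exp (t - b) * (\<Sum>i<k. (b - t) ^ i / fact i))"
      using AE_exp1
    proof eventually_elim
      case (elim t)
      let ?u = "1 - exp (- t)"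
      have u: "0 < ?u" "?u < 1" using elim by auto
      have "quantile C ?u \<le> x \<longleftrightarrow> exp (- b) \<le> exp (- t)"
        unfolding quantile_le_iff[OF u] eb by linarith
      then have le: "quantile C ?u \<le> x \<longleftrightarrow> t \<le> b" by simp
      show ?case
      proof (cases "t \<le> b")
        case True
        then have "C (quantile C ?u) \<le> C x"
          using le by (intro cdf_nondecreasing) simp
        then have "C (quantile C ?u) = ?u"
          using cont u assms(2) unfolding no_inner_atoms_def by (meson greaterThanLessThan_iff le_less_trans)
        moreover have "(1 - C x) / exp (- t) = exp (t - b)"
          by (simp add: eb[symmetric] exp_diff exp_minus field_simps)
        moreover have "ln (exp (- t) / (1 - C x)) = b - t"
          by (simp add: eb[symmetric] exp_diff[symmetric])
        ultimately show ?thesis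
          using True le by (simp add: record_below_def split: split_indicator)
      next
        case False
        then show ?thesis
          using le by (simp add: record_below_def split: split_indicator)
      qed
    qed
  qed measurable
  also have "\<dots> = exp (- a) - exp (- b) * (\<Sum>i<Suc k. (b - a) ^ i / fact i)"
    by (rule integral_exp1_tail) fact+
  also have "b - a = ln ((1 - q) / (1 - C x))"
    using assms by (simp add: a_def b_def ln_div)
  finally show ?thesis
    unfolding ea eb by (simp only: a_def)
qed

text \<open>A new observation leaves the record \<open>m\<close> in place with probability
  \<open>C m\<close>; otherwise one record fewer remains to come. The integral over the second event
  is \<open>1 - C m\<close> times the same value, so the two parts add up.\<close>

lemma integral_record_step:
  assumes cont: "no_inner_atoms C"
  shows "(LINT y|M. (if m < y then record_below C x k y else record_below C x (Suc k) m)) =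
    record_below C x (Suc k) m"
proof (cases "x < m")
  case True
  then have "record_below C x k y = 0" if "m < y" for y
    using that by (simp add: record_below_def)
  moreover have "record_below C x (Suc k) m = 0"
    using True by (simp add: record_below_def)
  ultimately have "(\<lambda>y. if m < y then record_below C x k y else record_below C x (Suc k) m) = (\<lambda>_. 0)"
    by auto
  then show ?thesis
    using \<open>record_below C x (Suc k) m = 0\<close> by simp
next
  case mx: False
  have int: "integrable M (\<lambda>y. indicator {m<..} y * record_below C x k y)"
    using integrable_mult_indicator[OF _ integrable_record_below, of "{m<..}" x k] by simp
  have split: "(LINT y|M. (if m < y then record_below C x k y else record_below C x (Suc k) m)) =
      (LINT y|M. indicator {m<..} y * record_below C x k y) + C m * record_below C x (Suc k) m"
  proof -
    have "(LINT y|M. (if m < y then record_below C x k y else record_below C x (Suc k) m)) =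
       (LINT y|M. indicator {m<..} y * record_below C x k y + indicator {..m} y * record_below C x (Suc k) m)"
      by (intro Bochner_Integration.integral_cong) (auto split: split_indicator)
    also have "\<dots> = (LINT y|M. indicator {m<..} y * record_below C x k y) +
        (LINT y|M. indicator {..m} y * record_below C x (Suc k) m)"
      by (intro Bochner_Integration.integral_add int integrable_mult_left)
        (simp add: emeasure_eq_measure)
    finally show ?thesis
      by (simp add: cdf_def)
  qed
  show ?thesis
  proof (cases "C x < 1")
    case True
    have m: "C m \<le> C x" "0 \<le> C m" "C m < 1"
      using mx True cdf_nonneg[of m] cdf_nondecreasing[of m x] by auto
    have ev: "AE t in exp1. (m < quantile C (1 - exp (- t))) \<longleftrightarrow> - ln (1 - C m) < t"
      using AE_exp1
    proof eventually_elim
      case (elim t)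
      have "quantile C (1 - exp (- t)) \<le> m \<longleftrightarrow> 1 - C m \<le> exp (- t)"
        using elim by (subst quantile_le_iff) auto
      also have "\<dots> \<longleftrightarrow> ln (1 - C m) \<le> - t"
        using ln_le_cancel_iff[of "1 - C m" "exp (- t)"] m by simp
      finally show ?case by linarith
    qed
    have "has_bochner_integral M (\<lambda>y. indicator {m<..} y * record_below C x k y)
        (LINT y|M. indicator {m<..} y * record_below C x k y)"
      by (intro has_bochner_integral_integrable int)
    then have "(LINT y|M. indicator {m<..} y * record_below C x k y) =
        (LINT t|exp1. indicator {m<..} (quantile C (1 - exp (- t))) * record_below C x k (quantile C (1 - exp (- t))))"
      by (subst (asm) has_bochner_integral_quantile_iff) (auto simp: has_bochner_integral_iff)
    also have "\<dots> = (LINT t|exp1. indicator {- ln (1 - C m)<..} t * record_below C x k (quantile C (1 - exp (- t))))"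
      using ev by (intro integral_cong_AE) (measurable, auto split: split_indicator)
    also have "\<dots> = (1 - C m) - (1 - C x) * (\<Sum>i<Suc k. (ln ((1 - C m) / (1 - C x))) ^ i / fact i)"
      by (rule integral_record_below) (use cont True m in auto)
    also have "\<dots> = (1 - C m) * record_below C x (Suc k) m"
      using m mx by (simp add: record_below_def right_diff_distrib del: sum.lessThan_Suc)
    finally show ?thesis
      unfolding split by (simp add: algebra_simps)
  next
    case False
    then have "C x = 1" using cdf_bounded_prob[of x] by linarith
    have "(LINT y|M. indicator {m<..} y * record_below C x k y) = (LINT y|M. indicator {m<..x} y)"
      using \<open>C x = 1\<close> by (intro Bochner_Integration.integral_cong) (auto simp: record_below_1 split: split_indicator)
    also have "\<dots> = 1 - C m"
      using cdf_diff_eq[of m x] mx \<open>C x = 1\<close> by (cases "m = x") auto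
    finally show ?thesis
      unfolding split using mx \<open>C x = 1\<close> by (simp add: record_below_1)
  qed
qed

lemma expectation_record_below:
  assumes cont: "no_inner_atoms C"
  shows "(LINT y|M. record_below C x k y) = G 1 k (C x)"
proof (cases "C x < 1")
  case True
  have "has_bochner_integral M (record_below C x k) (LINT y|M. record_below C x k y)"
    by (intro has_bochner_integral_integrable integrable_record_below)
  then have "(LINT y|M. record_below C x k y) =
      (LINT t|exp1. record_below C x k (quantile C (1 - exp (- t))))"
    by (subst (asm) has_bochner_integral_quantile_iff) (auto simp: has_bochner_integral_iff)
  also have "\<dots> = (LINT t|exp1. indicator {- ln (1 - 0)<..} t * record_below C x k (quantile C (1 - exp (- t))))"
    using AE_exp1 by (intro integral_cong_AE) (measurable, auto split: split_indicator)
  also have "\<dots> = (1 - 0) - (1 - C x) * (\<Sum>i<Suc k. (ln ((1 - 0) / (1 - C x))) ^ i / fact i)"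
    by (rule integral_record_below) (use cont True cdf_nonneg in auto)
  also have "\<dots> = G 1 k (C x)"
    using True by (simp add: G_def ln_div lessThan_Suc_atMost del: sum.lessThan_Suc)
  finally show ?thesis .
next
  case False
  then have "C x = 1" using cdf_bounded_prob[of x] by linarith
  then have "(LINT y|M. record_below C x k y) = (LINT y|M. indicator {..x} y)"
    by (intro Bochner_Integration.integral_cong) (auto simp: record_below_1)
  with \<open>C x = 1\<close> show ?thesis
    by (simp add: G_def cdf_def)
qed

end

section \<open>Independent observations and the law of their record values\<close>

locale iid_observations =
  fixes M :: "'a measure" and X :: "nat \<Rightarrow> 'a \<Rightarrow> real" and F :: "real \<Rightarrow> real"
  assumes iid: "iid_sample M X F"
begin

sublocale prob_space M
  using iid by (simp add: iid_sample_def)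

definition D :: "real measure" where
  "D = distr M borel (X 1)"

lemma indep: "indep_vars (\<lambda>_. borel) X {1..}"
  using iid by (simp add: iid_sample_def)

lemma random_variable_X [measurable]: "1 \<le> i \<Longrightarrow> X i \<in> borel_measurable M"
  using indep by (simp add: indep_vars_def)

lemma cdf_X: "1 \<le> i \<Longrightarrow> cdf (distr M borel (X i)) = F"
  using iid by (simp add: iid_sample_def)

lemma real_distribution_D: "real_distribution D"
  unfolding D_def by (rule real_distribution_distr) (rule random_variable_X, simp)

lemma distr_X: "1 \<le> i \<Longrightarrow> distr M borel (X i) = D"
  unfolding D_def by (rule cdf_unique) (auto simp: cdf_X[unfolded One_nat_def])

sublocale D: cdf_distribution D
  by (simp add: cdf_distribution_def real_distribution_D)

lemma cdf_D: "cdf D = F"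
  unfolding D_def by (rule cdf_X) simp

lemma prob_X_le: "1 \<le> i \<Longrightarrow> prob (X i -` {..x} \<inter> space M) = F x"
  using cdf_X[of i] random_variable_X[of i] by (auto simp: cdf_def measure_distr fun_eq_iff)

abbreviation state :: "nat \<Rightarrow> nat \<Rightarrow> 'a \<Rightarrow> nat \<times> real" where
  "state n j \<omega> \<equiv> record_state n (\<lambda>i. X i \<omega>) j"

lemma state_restrict:
  "state n j \<omega> = record_state n (restrict (\<lambda>i. X i \<omega>) {1..Suc j}) j"
  by (rule record_state_cong) simp

lemma measurable_state [measurable]: "state n j \<in> M \<rightarrow>\<^sub>M count_space UNIV \<Otimes>\<^sub>M borel"
proof -
  have "(\<lambda>\<omega>. restrict (\<lambda>i. X i \<omega>) {1..Suc j}) \<in> M \<rightarrow>\<^sub>M PiM {1..Suc j} (\<lambda>_. borel)"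
    by (intro measurable_restrict random_variable_X) simp
  from measurable_compose[OF this measurable_record_state[OF order_refl]] show ?thesis
    unfolding state_restrict .
qed

text \<open>The state depends on the observations 1 to \<open>j + 1\<close> only, so it is
  independent of the next one; Fubini's theorem on the product of the two blocks allows integrating
  that observation out with its law \<open>D\<close>.\<close>

lemma expectation_indep:
  fixes f :: "(nat \<times> real) \<Rightarrow> real \<Rightarrow> real"
  assumes f [measurable]: "case_prod f \<in> borel_measurable ((count_space UNIV \<Otimes>\<^sub>M borel) \<Otimes>\<^sub>M borel)"
    and B: "\<And>z y. \<bar>f z y\<bar> \<le> B"
  shows "expectation (\<lambda>\<omega>. f (state n j \<omega>) (X (Suc (Suc j)) \<omega>)) =
    expectation (\<lambda>\<omega>. LINT y|D. f (state n j \<omega>) y)"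
proof -
  define k where "k = Suc (Suc j)"
  define S where "S = PiM {1..Suc j} (\<lambda>_. borel :: real measure)"
  define T where "T = PiM {k} (\<lambda>_. borel :: real measure)"
  define past where "past \<omega> = restrict (\<lambda>i. X i \<omega>) {1..Suc j}" for \<omega>
  define new where "new \<omega> = restrict (\<lambda>i. X i \<omega>) {k}" for \<omega>
  have [measurable]: "X k \<in> borel_measurable M"
    by (rule random_variable_X) (simp add: k_def)
  have ind: "indep_var S past T new"
    unfolding S_def T_def past_def[abs_def] new_def[abs_def] k_def
    by (rule indep_var_restrict[OF indep]) auto
  note [measurable] = indep_var_rv1[OF ind] indep_var_rv2[OF ind]
  have eq: "distr M S past \<Otimes>\<^sub>M distr M T new = distr M (S \<Otimes>\<^sub>M T) (\<lambda>\<omega>. (past \<omega>, new \<omega>))"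
    using ind by (simp add: indep_var_distribution_eq)
  have [measurable]: "(\<lambda>s. record_state n s j) \<in> S \<rightarrow>\<^sub>M count_space UNIV \<Otimes>\<^sub>M borel"
    unfolding S_def by (rule measurable_record_state) simp
  have [measurable]: "(\<lambda>s. s k) \<in> borel_measurable T"
    unfolding T_def by (rule measurable_component_singleton) simp
  have [measurable]: "(\<lambda>(s, r). f (record_state n s j) (r k)) \<in> borel_measurable (S \<Otimes>\<^sub>M T)"
    by measurable
  interpret S: prob_space "distr M S past"
    by (rule prob_space_distr) measurable
  interpret T: prob_space "distr M T new"
    by (rule prob_space_distr) measurable
  interpret P: pair_prob_space "distr M S past" "distr M T new" ..
  have int: "integrable (distr M S past \<Otimes>\<^sub>M distr M T new) (\<lambda>(s, r). f (record_state n s j) (r k))"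
    by (rule P.P.integrable_const_bound[where B = B]) (auto simp: B)
  have past: "record_state n (past \<omega>) j = state n j \<omega>" for \<omega>
    unfolding past_def by (rule state_restrict[symmetric])
  have inner: "(LINT r|distr M T new. f z (r k)) = (LINT y|D. f z y)" for z
  proof -
    have z [measurable]: "f z \<in> borel_measurable borel"
      using measurable_compose[OF measurable_Pair1' f, of z] by (simp add: space_pair_measure)
    have "(LINT r|distr M T new. f z (r k)) = (LINT \<omega>|M. f z (X k \<omega>))"
      by (subst integral_distr) (auto simp: new_def)
    also have "\<dots> = (LINT y|distr M borel (X k). f z y)"
      by (rule integral_distr[symmetric]) measurable
    finally show ?thesis
      using distr_X[of k] by (simp add: k_def)
  qed
  have "expectation (\<lambda>\<omega>. f (state n j \<omega>) (X k \<omega>)) =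
      integral\<^sup>L (distr M S past \<Otimes>\<^sub>M distr M T new) (\<lambda>(s, r). f (record_state n s j) (r k))"
    unfolding eq by (subst integral_distr, measurable) (simp add: past new_def)
  also have "\<dots> = (LINT s|distr M S past. LINT r|distr M T new. f (record_state n s j) (r k))"
    using P.integral_fst'[OF int] by simp
  also have "\<dots> = (LINT s|distr M S past. LINT y|D. f (record_state n s j) y)"
    unfolding inner ..
  also have "\<dots> = expectation (\<lambda>\<omega>. LINT y|D. f (state n j \<omega>) y)"
    by (subst integral_distr) (auto simp: past)
  finally show ?thesis
    unfolding k_def .
qed

text \<open>The null set must not depend on \<open>m\<close>, because \<open>m\<close> will be the
  random record value. Rational levels give one null set, and right-continuity finds a rational
  level above \<open>m\<close> at which \<open>F\<close> is still below 1.\<close>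

lemma AE_exceeds: "AE \<omega> in M. \<forall>m J. F m < 1 \<longrightarrow> (\<exists>j>J. m < X j \<omega>)"
proof -
  have null: "AE \<omega> in M. \<exists>j>J. q < X j \<omega>" if q: "F q < 1" for q J
  proof -
    let ?E = "{\<omega> \<in> space M. \<forall>j\<in>{J<..}. X j \<omega> \<le> q}"
    have [measurable]: "?E \<in> sets M"
      by measurable
    have F0: "0 \<le> F q" using D.cdf_nonneg[of q] by (simp add: cdf_D)
    \<comment> \<open>By independence, already the \<open>k\<close> observations after time
      \<open>J\<close> all stay at or below \<open>q\<close> with probability \<open>F q ^ k\<close>
      only.\<close>
    have "prob ?E \<le> F q ^ k" for k
    proof (cases "k = 0")
      case False
      let ?I = "{Suc J..J + k}"
      have "prob ?E \<le> prob (\<Inter>i\<in>?I. X i -` {..q} \<inter> space M)"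
        using False by (intro finite_measure_mono) (auto intro!: sets.finite_INT measurable_sets[OF random_variable_X])
      also have "\<dots> = (\<Prod>i\<in>?I. prob (X i -` {..q} \<inter> space M))"
        by (rule indep_varsD[OF indep]) (use False in auto)
      also have "\<dots> = F q ^ k"
        by (simp add: prob_X_le)
      finally show ?thesis .
    qed simp
    moreover have "(\<lambda>k. F q ^ k) \<longlonglongrightarrow> 0"
      using q F0 by (intro LIMSEQ_realpow_zero) auto
    ultimately have "prob ?E \<le> 0"
      by (intro LIMSEQ_le_const) auto
    then have "prob ?E = 0"
      by (simp add: measure_le_0_iff)
    then have "AE \<omega> in M. \<omega> \<notin> ?E"
      by (subst (asm) prob_eq_0) auto
    then show ?thesis
      using AE_space by eventually_elim (auto simp: not_le)
  qed
  have "AE \<omega> in M. \<forall>q\<in>\<rat>. \<forall>J. F q < 1 \<longrightarrow> (\<exists>j>J. q < X j \<omega>)"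
    unfolding AE_ball_countable[OF countable_rat] AE_all_countable using null by auto
  then show ?thesis
  proof eventually_elim
    case (elim \<omega>)
    show ?case
    proof (intro allI impI)
      fix m J assume "F m < 1"
      have "(F \<longlongrightarrow> F m) (at_right m)"
        using D.cdf_is_right_cont[of m] by (simp add: cdf_D continuous_within)
      then have "eventually (\<lambda>q. F q < 1) (at_right m)"
        using \<open>F m < 1\<close> by (rule order_tendstoD)
      then obtain b where b: "m < b" "\<And>q. m < q \<Longrightarrow> q < b \<Longrightarrow> F q < 1"
        by (auto simp: eventually_at_right_field)
      obtain q where "q \<in> \<rat>" "m < q" "q < b"
        using Rats_dense_in_real[OF b(1)] by auto
      then show "\<exists>j>J. m < X j \<omega>"
        using elim b(2)[of q] by (meson less_trans)
    qed
  qed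
qed

lemma measurable_record_value [measurable]: "record_value 1 X n \<in> borel_measurable M"
proof (rule borel_measurable_LIMSEQ_real)
  show "(\<lambda>\<omega>. snd (state n j \<omega>)) \<in> borel_measurable M" for j
    by measurable
  fix \<omega> assume "\<omega> \<in> space M"
  obtain c J where "\<And>j. J \<le> j \<Longrightarrow> state n j \<omega> = (c, record_value 1 X n \<omega>)"
    by (rule record_state_eventually[of n X \<omega>]) (rule that)
  then have "eventually (\<lambda>j. snd (state n j \<omega>) = record_value 1 X n \<omega>) sequentially"
    unfolding eventually_sequentially by (intro exI[of _ J]) simp
  then show "(\<lambda>j. snd (state n j \<omega>)) \<longlonglongrightarrow> record_value 1 X n \<omega>"
    by (rule tendsto_eventually)
qed

lemmas measurable_record_value_Suc_0 [measurable] = measurable_record_value[unfolded One_nat_def]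

lemma cdf_record_value:
  assumes cont: "no_inner_atoms F"
  shows "cdf (distr M borel (record_value 1 X n)) x = G 1 n (F x)"
proof -
  let ?V = "\<lambda>z. record_below F x (n - fst z) (snd z)"
  let ?B = "1 + (\<Sum>i<n. (- ln (1 - F x)) ^ i / fact i)"
  note cont' = cont[folded cdf_D]
  note [measurable] = D.measurable_record_below[unfolded cdf_D]
  have bound: "\<bar>record_below F x (n - c) m\<bar> \<le> ?B" for c m
    using D.abs_record_below_le[of "n - c" n] by (simp add: cdf_D)
  \<comment> \<open>The count takes countably many values, so measurability is needed for each fixed
    count only.\<close>
  have meas_V [measurable]: "?V \<in> borel_measurable (count_space UNIV \<Otimes>\<^sub>M borel)"
    by (rule measurable_compose_countable[where f = "\<lambda>c z. record_below F x (n - c) (snd z)" and g = fst])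
      measurable
  have const: "expectation (\<lambda>\<omega>. ?V (state n j \<omega>)) = G 1 n (F x)" for j
  proof (induction j)
    case 0
    have "expectation (\<lambda>\<omega>. record_below F x n (X 1 \<omega>)) = (LINT y|D. record_below F x n y)"
      unfolding D_def by (subst integral_distr) (auto intro: random_variable_X)
    then show ?case
      using D.expectation_record_below[OF cont', of x n] by (simp add: cdf_D)
  next
    case (Suc j)
    define f where "f z y = (if fst z < n \<and> snd z < y then ?V (Suc (fst z), y) else ?V z)" for z :: "nat \<times> real" and y
    have step: "(LINT y|D. f (state n j \<omega>) y) = ?V (state n j \<omega>)" for \<omega>
    proof (cases "fst (state n j \<omega>) < n")
      case True
      then obtain k where "n - fst (state n j \<omega>) = Suc k" "n - Suc (fst (state n j \<omega>)) = k"
        by (metis Suc_diff_Suc)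
      with True show ?thesis
        using D.integral_record_step[OF cont', of "snd (state n j \<omega>)" x k]
        unfolding cdf_D f_def by (simp only: fst_conv snd_conv True simp_thms)
    next
      case False
      then show ?thesis by (simp add: f_def D.prob_space[unfolded D.space_eq_univ])
    qed
    have "case_prod f \<in> borel_measurable ((count_space UNIV \<Otimes>\<^sub>M borel) \<Otimes>\<^sub>M borel)"
      unfolding f_def case_prod_beta' by measurable
    moreover have "\<bar>f z y\<bar> \<le> ?B" for z y
      using bound by (simp add: f_def)
    ultimately have "expectation (\<lambda>\<omega>. f (state n j \<omega>) (X (Suc (Suc j)) \<omega>)) =
        expectation (\<lambda>\<omega>. LINT y|D. f (state n j \<omega>) y)"
      by (rule expectation_indep)
    also have "\<dots> = expectation (\<lambda>\<omega>. ?V (state n j \<omega>))"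
      unfolding step ..
    also have "(\<lambda>\<omega>. f (state n j \<omega>) (X (Suc (Suc j)) \<omega>)) = (\<lambda>\<omega>. ?V (state n (Suc j) \<omega>))"
      by (auto simp: f_def)
    finally show ?case
      using Suc.IH by simp
  qed
  have "(\<lambda>j. expectation (\<lambda>\<omega>. ?V (state n j \<omega>))) \<longlonglongrightarrow>
      expectation (\<lambda>\<omega>. if record_value 1 X n \<omega> \<le> x then 1 else 0)"
  proof (rule integral_dominated_convergence[where w = "\<lambda>_. ?B"])
    show "AE \<omega> in M. (\<lambda>j. ?V (state n j \<omega>)) \<longlonglongrightarrow> (if record_value 1 X n \<omega> \<le> x then 1 else 0)"
      using AE_exceeds
    proof eventually_elim
      case (elim \<omega>)
      obtain c J where c: "c \<le> n" "c = n \<or> (\<forall>j>J. X j \<omega> \<le> record_value 1 X n \<omega>)"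
        "\<And>j. J \<le> j \<Longrightarrow> state n j \<omega> = (c, record_value 1 X n \<omega>)"
        by (rule record_state_eventually[of n X \<omega>]) (rule that)
      \<comment> \<open>A path that freezes with fewer than \<open>n\<close> records has a record
        value at which \<open>F\<close> is 1. If this value is at most \<open>x\<close>, then
        \<open>F x = 1\<close> as well, and \<open>record_below\<close> is an indicator whatever the
        count.\<close>
      have "record_below F x (n - c) (record_value 1 X n \<omega>) = (if record_value 1 X n \<omega> \<le> x then 1 else 0)"
      proof (cases "c = n")
        case False
        then have "1 \<le> F (record_value 1 X n \<omega>)"
          using c(2) elim by (meson not_le)
        then have "F x = 1" if "record_value 1 X n \<omega> \<le> x"
          using D.cdf_nondecreasing[OF that] D.cdf_bounded_prob[of x] by (simp add: cdf_D)
        then show ?thesis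
          by (cases "record_value 1 X n \<omega> \<le> x") (simp add: record_below_1, simp add: record_below_def)
      qed simp
      then have "eventually (\<lambda>j. ?V (state n j \<omega>) = (if record_value 1 X n \<omega> \<le> x then 1 else 0)) sequentially"
        using c(3) unfolding eventually_sequentially by (metis fst_conv snd_conv)
      then show ?case by (rule tendsto_eventually)
    qed
    show "(\<lambda>\<omega>. ?V (state n j \<omega>)) \<in> borel_measurable M" for j
      by (rule measurable_compose[OF measurable_state meas_V])
    show "AE \<omega> in M. norm (?V (state n j \<omega>)) \<le> ?B" for j
      by (intro AE_I2) (simp only: real_norm_def bound)
    show "(\<lambda>\<omega>. if record_value 1 X n \<omega> \<le> x then 1 else 0 :: real) \<in> borel_measurable M"
      by measurable
  qed simp
  then have "G 1 n (F x) = expectation (\<lambda>\<omega>. if record_value 1 X n \<omega> \<le> x then 1 else 0)"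
    unfolding const by (simp add: LIMSEQ_const_iff)
  also have "\<dots> = expectation (indicator (record_value 1 X n -` {..x} \<inter> space M))"
    by (intro Bochner_Integration.integral_cong) (auto split: split_indicator)
  finally show ?thesis
    by (subst cdf_def, subst measure_distr) auto
qed

text \<open>\<open>G 1 n p\<close> is the Erlang distribution function at
  \<open>- ln (1 - p)\<close>, and for t > 0 the event
  \<open>quantile F (1 - exp (- t)) \<le> x\<close> means
  \<open>1 - exp (- t) \<le> F x\<close>.\<close>

lemma distr_record_value:
  assumes cont: "no_inner_atoms F"
  shows "distr M borel (record_value 1 X n) =
    distr (density lborel (erlang_density n 1)) borel (\<lambda>t. quantile F (1 - exp (- t)))"
proof (rule cdf_unique)
  note [measurable] = D.measurable_quantile[unfolded cdf_D]
  interpret E: prob_space "density lborel (erlang_density n 1)"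
    by (rule prob_space_erlang_density) simp
  show "real_distribution (distr M borel (record_value 1 X n))"
    by (rule real_distribution_distr) measurable
  show "real_distribution (distr (density lborel (erlang_density n 1)) borel (\<lambda>t. quantile F (1 - exp (- t))))"
    by (rule E.real_distribution_distr) measurable
  show "cdf (distr M borel (record_value 1 X n)) =
      cdf (distr (density lborel (erlang_density n 1)) borel (\<lambda>t. quantile F (1 - exp (- t))))"
  proof
    fix x
    have pos: "AE t in density lborel (erlang_density n 1). 0 < t"
    proof -
      have "AE t in lborel. t \<noteq> (0::real)" by (rule AE_lborel_singleton)
      then show ?thesis
        by (subst AE_density) (auto simp: erlang_density_def)
    qed
    have ev: "AE t in density lborel (erlang_density n 1). quantile F (1 - exp (- t)) \<le> x \<longleftrightarrow> 1 - exp (- t) \<le> F x"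
      using pos by eventually_elim (use D.quantile_le_iff[unfolded cdf_D] in auto)
    have "cdf (distr (density lborel (erlang_density n 1)) borel (\<lambda>t. quantile F (1 - exp (- t)))) x =
        E.prob {t. quantile F (1 - exp (- t)) \<le> x}"
      by (subst cdf_def, subst measure_distr) (auto simp: vimage_def)
    also have "\<dots> = E.prob {t. 1 - exp (- t) \<le> F x}"
      using ev by (intro measure_eq_AE) auto
    also have "\<dots> = G 1 n (F x)"
    proof (cases "F x < 1")
      case True
      then have "{t. 1 - exp (- t) \<le> F x} = {..- ln (1 - F x)}"
        by (auto simp: one_minus_exp_le_iff)
      moreover have "0 \<le> - ln (1 - F x)"
        using True D.cdf_nonneg[of x] by (simp add: cdf_D)
      moreover have "E.prob {..a} = erlang_CDF n 1 a" for a
        by (simp add: measure_def emeasure_erlang_density)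
      ultimately show ?thesis
        using True by (simp add: erlang_CDF_def G_def sum_distrib_left mult.commute)
    next
      case False
      then have "F x = 1" using D.cdf_bounded_prob[of x] by (simp add: cdf_D)
      then show ?thesis
        using E.prob_space by (simp add: G_def)
    qed
    finally show "cdf (distr M borel (record_value 1 X n)) x =
        cdf (distr (density lborel (erlang_density n 1)) borel (\<lambda>t. quantile F (1 - exp (- t)))) x"
      by (simp only: cdf_record_value[OF cont])
  qed
qed

text \<open>The Erlang density is \<open>t ^ n / fact n\<close> times the exponential density; this
  weight is \<open>g 1 n\<close> seen on the exponential scale.\<close>

lemma has_bochner_integral_record_value_iff:
  fixes f :: "real \<Rightarrow> real"
  assumes cont: "no_inner_atoms F"
    and [measurable]: "f \<in> borel_measurable borel"
  shows "has_bochner_integral M (\<lambda>\<omega>. f (record_value 1 X n \<omega>)) J \<longleftrightarrow>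
    has_bochner_integral exp1 (\<lambda>t. t ^ n / fact n * f (quantile F (1 - exp (- t)))) J"
proof -
  note [measurable] = D.measurable_quantile[unfolded cdf_D]
  let ?E = "density lborel (erlang_density n 1)" and ?q = "\<lambda>t. quantile F (1 - exp (- t))"
  have "has_bochner_integral M (\<lambda>\<omega>. f (record_value 1 X n \<omega>)) J \<longleftrightarrow>
      has_bochner_integral (distr M borel (record_value 1 X n)) f J"
    unfolding has_bochner_integral_iff
    by (subst integrable_distr_eq[of _ _ borel], measurable, subst integral_distr[of _ _ borel], measurable)
  also have "\<dots> \<longleftrightarrow> has_bochner_integral ?E (\<lambda>t. f (?q t)) J"
    unfolding distr_record_value[OF cont] has_bochner_integral_iff
    by (simp add: integrable_distr_eq integral_distr)
  also have "\<dots> \<longleftrightarrow> has_bochner_integral lborel (\<lambda>t. erlang_density n 1 t * f (?q t)) J"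
    unfolding has_bochner_integral_iff by (simp add: integrable_density integral_density)
  also have "(\<lambda>t. erlang_density n 1 t * f (?q t)) =
      (\<lambda>t. exponential_density 1 t * (t ^ n / fact n * f (?q t)))"
    by (auto simp: fun_eq_iff erlang_density_def)
  also have "has_bochner_integral lborel \<dots> J \<longleftrightarrow>
      has_bochner_integral exp1 (\<lambda>t. t ^ n / fact n * f (?q t)) J"
    by (rule has_bochner_integral_exp1_iff[symmetric]) measurable
  finally show ?thesis .
qed

end

section \<open>Concave functions and orthogonality\<close>

lemma concave_on_three_points:
  fixes \<phi> :: "real \<Rightarrow> real"
  assumes "concave_on S \<phi>" "a \<in> S" "c \<in> S" "a < b" "b < c"
  shows "(c - b) * \<phi> a + (b - a) * \<phi> c \<le> (c - a) * \<phi> b"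
proof -
  define t where "t = (b - a) / (c - a)"
  have t: "0 \<le> t" "t \<le> 1" "t * (c - a) = b - a" "(1 - t) * (c - a) = c - b"
    using assms by (auto simp: t_def field_simps)
  have "(1 - t) * a + t * c = b"
    using t(3) by (simp add: algebra_simps)
  with concave_onD[OF assms(1) t(1,2) assms(2,3)] have "(1 - t) * \<phi> a + t * \<phi> c \<le> \<phi> b"
    by simp
  then have "(c - a) * ((1 - t) * \<phi> a + t * \<phi> c) \<le> (c - a) * \<phi> b"
    using assms by (intro mult_left_mono) auto
  also have "(c - a) * ((1 - t) * \<phi> a + t * \<phi> c) = ((1 - t) * (c - a)) * \<phi> a + (t * (c - a)) * \<phi> c"
    by (simp add: algebra_simps)
  finally show ?thesis
    unfolding t .
qed

lemma concave_on_chord: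
  fixes \<phi> :: "real \<Rightarrow> real"
  assumes \<phi>: "concave_on S \<phi>" and S: "x1 \<in> S" "x2 \<in> S" and "x1 < x2"
  obtains c d where "\<And>x. x \<in> S \<Longrightarrow> x1 \<le> x \<Longrightarrow> x \<le> x2 \<Longrightarrow> c + d * x \<le> \<phi> x"
    "\<And>x. x \<in> S \<Longrightarrow> x \<le> x1 \<or> x2 \<le> x \<Longrightarrow> \<phi> x \<le> c + d * x"
proof -
  define d where "d = (\<phi> x2 - \<phi> x1) / (x2 - x1)"
  define c where "c = \<phi> x1 - d * x1"
  have d: "(x2 - x1) * d = \<phi> x2 - \<phi> x1"
    using assms by (simp add: d_def)
  have chord: "(x2 - x1) * (c + d * x) = (x2 - x) * \<phi> x1 + (x - x1) * \<phi> x2" for x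
  proof -
    have "(x2 - x1) * (c + d * x) = (x2 - x1) * \<phi> x1 + ((x2 - x1) * d) * (x - x1)"
      by (simp add: c_def algebra_simps)
    also have "\<dots> = (x2 - x) * \<phi> x1 + (x - x1) * \<phi> x2"
      unfolding d by (simp add: algebra_simps)
    finally show ?thesis .
  qed
  have "0 < x2 - x1" using assms by simp
  show ?thesis
  proof (rule that)
    fix x assume x: "x \<in> S" "x1 \<le> x" "x \<le> x2"
    have "(x2 - x1) * (c + d * x) \<le> (x2 - x1) * \<phi> x"
      using concave_on_three_points[OF \<phi> S, of x] x unfolding chord
      by (cases "x = x1"; cases "x = x2") auto
    then show "c + d * x \<le> \<phi> x"
      using \<open>0 < x2 - x1\<close> by (rule mult_left_le_imp_le)
  next
    fix x assume x: "x \<in> S" "x \<le> x1 \<or> x2 \<le> x"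
    have "(x2 - x1) * \<phi> x \<le> (x2 - x1) * (c + d * x)"
    proof -
      consider "x < x1" | "x = x1" | "x = x2" | "x2 < x" using x by linarith
      then show ?thesis
      proof cases
        case 1
        from concave_on_three_points[OF \<phi> x(1) S(2) 1 \<open>x1 < x2\<close>] show ?thesis
          unfolding chord by (simp add: algebra_simps)
      next
        case 4
        from concave_on_three_points[OF \<phi> S(1) x(1) \<open>x1 < x2\<close> 4] show ?thesis
          unfolding chord by (simp add: algebra_simps)
      qed (simp_all add: chord)
    qed
    then show "\<phi> x \<le> c + d * x"
      using \<open>0 < x2 - x1\<close> by (rule mult_left_le_imp_le)
  qed
qed

text \<open>Suited to functions with a kink. Averaging the bound taken at the convex combination
  makes the linear terms cancel.\<close>

lemma concave_on_supergradient:
  fixes f :: "real \<Rightarrow> real"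
  assumes "convex S" and super: "\<And>x. x \<in> S \<Longrightarrow> \<exists>d. \<forall>z\<in>S. f z \<le> f x + d * (z - x)"
  shows "concave_on S f"
  unfolding concave_on_iff
proof (intro conjI ballI allI impI)
  fix x y u v :: real
  assume xy: "x \<in> S" "y \<in> S" and uv: "0 \<le> u" "0 \<le> v" "u + v = 1"
  define m where "m = u * x + v * y"
  have "m \<in> S" unfolding m_def using convexD[OF assms(1) xy uv] by simp
  then obtain d where d: "\<And>z. z \<in> S \<Longrightarrow> f z \<le> f m + d * (z - m)" using super by blast
  have "u * f x + v * f y \<le> u * (f m + d * (x - m)) + v * (f m + d * (y - m))"
    using d xy uv by (intro add_mono mult_left_mono) auto
  also have "\<dots> = (u + v) * f m + d * ((u * x + v * y) - (u + v) * m)"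
    by (simp add: algebra_simps)
  also have "\<dots> = f m" using uv by (simp add: m_def)
  finally show "u * f x + v * f y \<le> f (u *\<^sub>R x + v *\<^sub>R y)" by (simp add: m_def)
qed (rule assms)

text \<open>A function orthogonal to the affine functions whose negativity set is an interval changes
  sign at the two ends of this interval; subtracting from \<open>\<phi>\<close> its chord over it makes the
  integrand of one sign.\<close>

lemma integral_concave_times_le_0:
  fixes \<phi> r :: "real \<Rightarrow> real" and \<nu> :: "real measure"
  assumes S: "convex S" "AE x in \<nu>. x \<in> S" and no_atom: "\<And>c. AE x in \<nu>. x \<noteq> c"
    and \<phi>: "concave_on S \<phi>"
    and neg: "\<And>x1 x2 x3. x1 \<in> S \<Longrightarrow> x3 \<in> S \<Longrightarrow> x1 < x2 \<Longrightarrow> x2 < x3 \<Longrightarrow> r x1 < 0 \<Longrightarrow> r x3 < 0 \<Longrightarrow> r x2 < 0"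
    and int: "has_bochner_integral \<nu> r 0" "has_bochner_integral \<nu> (\<lambda>x. x * r x) 0"
      "integrable \<nu> (\<lambda>x. \<phi> x * r x)"
  shows "(LINT x|\<nu>. \<phi> x * r x) \<le> 0"
proof -
  have lin: "has_bochner_integral \<nu> (\<lambda>x. (c + d * x) * r x) 0" for c d
    using has_bochner_integral_add[OF has_bochner_integral_mult_right[OF int(1), of c]
      has_bochner_integral_mult_right[OF int(2), of d]]
    by (simp add: algebra_simps)
  \<comment> \<open>Affine functions are orthogonal to \<open>r\<close>, so a product of constant
    sign vanishes almost everywhere, and with it \<open>r\<close>, since a nonzero affine function
    has at most one zero and points are null. This settles all cases in which \<open>r\<close>
    changes sign at most once up to a single point.\<close>
  have degenerate: ?thesis
    if cd: "c \<noteq> 0 \<or> d \<noteq> 0" and pos: "\<And>x. x \<in> S \<Longrightarrow> x \<noteq> e \<Longrightarrow> 0 \<le> (c + d * x) * r x" for c d e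
  proof -
    have "AE x in \<nu>. 0 \<le> (c + d * x) * r x"
      using S(2) no_atom[of e] by eventually_elim (use pos in auto)
    then have "AE x in \<nu>. (c + d * x) * r x = 0"
      using lin[of c d] integral_nonneg_eq_0_iff_AE[of \<nu> "\<lambda>x. (c + d * x) * r x"]
      by (simp add: has_bochner_integral_iff)
    then have "AE x in \<nu>. \<phi> x * r x = 0"
      using no_atom[of "- c / d"]
    proof eventually_elim
      case (elim x)
      have "c + d * x \<noteq> 0"
      proof
        assume *: "c + d * x = 0"
        then have "d \<noteq> 0" using cd by auto
        with * have "x = - c / d" by (simp add: field_simps)
        with elim(2) show False ..
      qed
      with elim show ?case by auto
    qed
    then show ?thesis
      by (simp add: integral_eq_zero_AE)
  qed
  have chord: ?thesis if neg: "\<And>x. x \<in> S \<Longrightarrow> (\<phi> x - (c + d * x)) * r x \<le> 0" for c d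
  proof -
    have "(LINT x|\<nu>. (\<phi> x - (c + d * x)) * r x) = (LINT x|\<nu>. \<phi> x * r x - (c + d * x) * r x)"
      by (simp add: left_diff_distrib)
    also have "\<dots> = (LINT x|\<nu>. \<phi> x * r x)"
      using int(3) lin[of c d] by (subst Bochner_Integration.integral_diff) (auto simp: has_bochner_integral_iff)
    finally have "(LINT x|\<nu>. (\<phi> x - (c + d * x)) * r x) = (LINT x|\<nu>. \<phi> x * r x)" .
    moreover have "AE x in \<nu>. (\<phi> x - (c + d * x)) * r x \<le> 0"
      using S(2) by eventually_elim (rule neg)
    then have "AE x in \<nu>. 0 \<le> - ((\<phi> x - (c + d * x)) * r x)"
      by eventually_elim simp
    from integral_nonneg_AE[OF this] have "(LINT x|\<nu>. (\<phi> x - (c + d * x)) * r x) \<le> 0"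
      by simp
    ultimately show ?thesis by simp
  qed
  define N where "N = {x \<in> S. r x < 0}"
  define L where "L = {x \<in> S. \<forall>z\<in>N. x < z}"
  define U where "U = {x \<in> S. \<forall>z\<in>N. z < x}"
  have cover: "x \<in> N \<or> x \<in> L \<or> x \<in> U" if x: "x \<in> S" for x
  proof (rule ccontr)
    assume *: "\<not> ?thesis"
    then obtain z z' where z: "z \<in> N" "z' \<in> N" "z \<le> x" "x \<le> z'"
      using x unfolding L_def U_def by (auto simp: not_less)
    moreover from * z have "z \<noteq> x" "z' \<noteq> x" by auto
    ultimately show False
      using * neg[of z z' x] x unfolding N_def by auto
  qed
  have nonneg: "0 \<le> r x" if "x \<in> S" "x \<notin> N" for x
    using that by (simp add: N_def)
  have neg': "r x < 0" if "x \<in> N" for x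
    using that by (simp add: N_def)
  \<comment> \<open>\<open>L\<close> and \<open>U\<close> are the points of \<open>S\<close> to the
    left and to the right of all of \<open>N\<close>; only when both are nonempty can a chord over
    \<open>N\<close> be needed.\<close>
  consider "N = {}" | "N \<noteq> {}" "L = {}" "U = {}" | "N \<noteq> {}" "L = {}" "U \<noteq> {}"
    | "N \<noteq> {}" "L \<noteq> {}" "U = {}" | "N \<noteq> {}" "L \<noteq> {}" "U \<noteq> {}"
    by blast
  then show ?thesis
  proof cases
    case 1
    then show ?thesis
      by (intro degenerate[of 1 0 0]) (auto intro: nonneg)
  next
    case 2
    have "r x < 0" if "x \<in> S" for x
      using cover[OF that] 2 neg' by auto
    then show ?thesis
      by (intro degenerate[of "- 1" 0 0]) (auto intro: less_imp_le)
  next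
    case 3
    then obtain u where u: "\<And>z. z \<in> N \<Longrightarrow> z < u" by (auto simp: U_def)
    have bdd: "bdd_above N" by (rule bdd_aboveI[of _ u]) (rule less_imp_le[OF u])
    have "0 \<le> (- Sup N + 1 * x) * r x" if x: "x \<in> S" "x \<noteq> Sup N" for x
    proof (cases "x < Sup N")
      case True
      then obtain z where "z \<in> N" "x < z"
        using less_cSup_iff[OF 3(1) bdd] by auto
      then have "x \<notin> U" unfolding U_def by (auto dest: order.asym)
      then have "r x < 0" using cover[OF x(1)] 3 neg' by auto
      then show ?thesis
        using True by (intro mult_nonpos_nonpos) auto
    next
      case False
      then have "x \<notin> N" using cSup_upper[OF _ bdd, of x] x by auto
      then show ?thesis
        using nonneg x(1) False by (intro mult_nonneg_nonneg) auto
    qed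
    then show ?thesis
      by (intro degenerate[of "- Sup N" 1 "Sup N"]) auto
  next
    case 4
    then obtain l where l: "\<And>z. z \<in> N \<Longrightarrow> l < z" by (auto simp: L_def)
    have bdd: "bdd_below N" by (rule bdd_belowI[of _ l]) (rule less_imp_le[OF l])
    have "0 \<le> (Inf N + - 1 * x) * r x" if x: "x \<in> S" "x \<noteq> Inf N" for x
    proof (cases "Inf N < x")
      case True
      then obtain z where "z \<in> N" "z < x"
        using cInf_less_iff[OF 4(1) bdd] by auto
      then have "x \<notin> L" unfolding L_def by (auto dest: order.asym)
      then have "r x < 0" using cover[OF x(1)] 4 neg' by auto
      then show ?thesis
        using True by (intro mult_nonpos_nonpos) auto
    next
      case False
      then have "x \<notin> N" using cInf_lower[OF _ bdd, of x] x by auto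
      then show ?thesis
        using nonneg x(1) False by (intro mult_nonneg_nonneg) auto
    qed
    then show ?thesis
      by (intro degenerate[of "Inf N" "- 1" "Inf N"]) auto
  next
    case 5
    then obtain l u where l: "l \<in> S" "\<And>z. z \<in> N \<Longrightarrow> l < z" and u: "u \<in> S" "\<And>z. z \<in> N \<Longrightarrow> z < u"
      by (auto simp: L_def U_def)
    have bdd: "bdd_below N" "bdd_above N"
      by (rule bdd_belowI[of _ l], rule less_imp_le[OF l(2)], assumption)
        (rule bdd_aboveI[of _ u], rule less_imp_le[OF u(2)], assumption)
    obtain z where z: "z \<in> N" using 5 by auto
    have "l \<le> Inf N" "Sup N \<le> u"
      by (rule cInf_greatest[OF 5(1) less_imp_le[OF l(2)]], assumption)
        (rule cSup_least[OF 5(1) less_imp_le[OF u(2)]], assumption)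
    have zz: "Inf N \<le> z" "z \<le> Sup N"
      using z bdd by (auto intro: cInf_lower cSup_upper)
    have interval: "is_interval S" using S(1) by (simp add: is_interval_convex_1)
    have "Inf N \<in> S" "Sup N \<in> S"
      using mem_is_interval_1_I[OF interval l(1) u(1)] \<open>l \<le> Inf N\<close> \<open>Sup N \<le> u\<close> zz by auto
    have inside: "x \<in> N" if x: "x \<in> S" "Inf N < x" "x < Sup N" for x
    proof -
      obtain y y' where "y \<in> N" "y < x" "y' \<in> N" "x < y'"
        using x cInf_less_iff[OF 5(1) bdd(1)] less_cSup_iff[OF 5(1) bdd(2)] by auto
      then have "x \<notin> L" "x \<notin> U" by (auto simp: L_def U_def dest: order.asym)
      then show ?thesis using cover[OF x(1)] by auto
    qed
    have outside: "x \<notin> N" if "x < Inf N \<or> Sup N < x" for x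
      using that cInf_lower[OF _ bdd(1), of x] cSup_upper[OF _ bdd(2), of x] by auto
    show ?thesis
    proof (cases "Inf N < Sup N")
      case True
      obtain c d where cd: "\<And>x. x \<in> S \<Longrightarrow> Inf N \<le> x \<Longrightarrow> x \<le> Sup N \<Longrightarrow> c + d * x \<le> \<phi> x"
        "\<And>x. x \<in> S \<Longrightarrow> x \<le> Inf N \<or> Sup N \<le> x \<Longrightarrow> \<phi> x \<le> c + d * x"
        using concave_on_chord[OF \<phi> \<open>Inf N \<in> S\<close> \<open>Sup N \<in> S\<close> True] by metis
      show ?thesis
      proof (rule chord[of c d])
        fix x assume x: "x \<in> S"
        consider "x < Inf N \<or> Sup N < x" | "x = Inf N \<or> x = Sup N" | "Inf N < x" "x < Sup N" by linarith
        then show "(\<phi> x - (c + d * x)) * r x \<le> 0"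
        proof cases
          case 1
          then have "\<phi> x \<le> c + d * x" using cd(2)[OF x] by auto
          then show ?thesis
            using nonneg[OF x outside[OF 1]] by (intro mult_nonpos_nonneg) auto
        next
          case 2
          then have "\<phi> x = c + d * x"
            using cd[OF x] True by (intro antisym) auto
          then show ?thesis by simp
        next
          case 3
          then have "c + d * x \<le> \<phi> x" using cd(1)[OF x] by auto
          then show ?thesis
            using neg'[OF inside[OF x 3]] by (intro mult_nonneg_nonpos) auto
        qed
      qed
    next
      case False
      \<comment> \<open>Here \<open>N\<close> is the single point \<open>Sup N\<close>, which
        carries no mass.\<close>
      have "0 \<le> r x" if "x \<in> S" "x \<noteq> Sup N" for x
        by (rule nonneg[OF that(1) outside]) (use that False zz in linarith)
      then show ?thesis
        by (intro degenerate[of 1 0 "Sup N"]) auto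
    qed
  qed
qed

lemma integrable_mult_of_squares:
  fixes f g :: "'a \<Rightarrow> real"
  assumes [measurable]: "f \<in> borel_measurable M" "g \<in> borel_measurable M"
    and "integrable M (\<lambda>x. (f x)\<^sup>2)" "integrable M (\<lambda>x. (g x)\<^sup>2)"
  shows "integrable M (\<lambda>x. f x * g x)"
proof (rule Bochner_Integration.integrable_bound)
  show "integrable M (\<lambda>x. (f x)\<^sup>2 + (g x)\<^sup>2)"
    using assms by simp
  have "norm (f x * g x) \<le> norm ((f x)\<^sup>2 + (g x)\<^sup>2)" for x
  proof -
    have "2 * (\<bar>f x\<bar> * \<bar>g x\<bar>) \<le> (f x)\<^sup>2 + (g x)\<^sup>2"
      using sum_squares_bound[of "\<bar>f x\<bar>" "\<bar>g x\<bar>"] by simp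
    moreover have "0 \<le> \<bar>f x\<bar> * \<bar>g x\<bar>" by simp
    ultimately show ?thesis
      unfolding real_norm_def abs_mult by linarith
  qed
  then show "AE x in M. norm (f x * g x) \<le> norm ((f x)\<^sup>2 + (g x)\<^sup>2)" by (rule AE_I2)
qed measurable

text \<open>Cauchy-Schwarz through the pointwise bound from the square of
  \<open>C * f x - g x\<close>; the weights \<open>C / 2\<close> and \<open>1 / (2 * C)\<close> make
  each of the two parts contribute \<open>C / 2\<close>.\<close>

lemma integral_mult_le_of_norm:
  fixes f g :: "'a \<Rightarrow> real"
  assumes [measurable]: "f \<in> borel_measurable M" "g \<in> borel_measurable M"
    and f: "has_bochner_integral M (\<lambda>x. (f x)\<^sup>2) 1" and g: "has_bochner_integral M (\<lambda>x. (g x)\<^sup>2) (C\<^sup>2)"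
    and "0 < C"
  shows "(LINT x|M. f x * g x) \<le> C"
proof -
  have sq: "has_bochner_integral M (\<lambda>x. (C / 2) * (f x)\<^sup>2 + (1 / (2 * C)) * (g x)\<^sup>2)
      ((C / 2) * 1 + (1 / (2 * C)) * C\<^sup>2)"
    by (intro has_bochner_integral_add has_bochner_integral_mult_right f g)
  have le: "f x * g x \<le> (C / 2) * (f x)\<^sup>2 + (1 / (2 * C)) * (g x)\<^sup>2" for x
  proof -
    have "0 \<le> (C * f x - g x)\<^sup>2 / (2 * C)" using \<open>0 < C\<close> by simp
    also have "\<dots> = (C / 2) * (f x)\<^sup>2 + (1 / (2 * C)) * (g x)\<^sup>2 - f x * g x"
      using \<open>0 < C\<close> by (simp add: field_simps power2_eq_square)
    finally show ?thesis by simp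
  qed
  have "integrable M (\<lambda>x. f x * g x)"
    using f g by (intro integrable_mult_of_squares) (simp_all add: has_bochner_integral_iff)
  then have "(LINT x|M. f x * g x) \<le> (LINT x|M. (C / 2) * (f x)\<^sup>2 + (1 / (2 * C)) * (g x)\<^sup>2)"
    using sq le by (intro integral_mono) (simp_all only: has_bochner_integral_iff)
  also have "\<dots> = C"
    unfolding has_bochner_integral_integral_eq[OF sq] using \<open>0 < C\<close> by (simp add: power2_eq_square)
  finally show ?thesis .
qed

section \<open>Records and projections\<close>

lemma (in prob_space) has_bochner_integral_const:
  "has_bochner_integral M (\<lambda>_. c :: real) c"
  by (simp add: has_bochner_integral_iff prob_space)

lemma g_hat_eq: "0 < 1 - \<alpha> * x \<Longrightarrow> g_hat 1 n \<alpha> x = hazard \<alpha> x ^ n / fact n"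
  by (simp add: g_hat_def g_def W_eq)

lemma h_eq: "0 < 1 - \<alpha> * x \<Longrightarrow> h n \<alpha> x = hazard \<alpha> x ^ n / fact n - 1"
  by (simp add: h_def g_hat_eq[unfolded One_nat_def])

lemma h_pareto_of_exp [simp]: "h n \<alpha> (pareto_of_exp \<alpha> t) = t ^ n / fact n - 1"
  by (subst h_eq) (simp_all add: one_minus_pareto_of_exp)

lemma measurable_h [measurable]: "h n \<alpha> \<in> borel_measurable borel"
  unfolding h_def g_hat_def g_def by measurable

lemma has_bochner_integral_exp1_power: "has_bochner_integral exp1 (\<lambda>t. t ^ i) (fact i)"
  using has_bochner_integral_exp1_moment[of 0 i] by simp

lemma integrable_exp1_power: "integrable exp1 (\<lambda>t. t ^ i)"
  using has_bochner_integral_exp1_power[of i] by (simp add: has_bochner_integral_iff)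

lemma has_bochner_integral_h: "has_bochner_integral (gpd \<alpha>) (h n \<alpha>) 0"
proof -
  interpret prob_space exp1 by (rule prob_space_exp1)
  have "has_bochner_integral exp1 (\<lambda>t. t ^ n / fact n - 1) (fact n / fact n - 1)"
    by (intro has_bochner_integral_diff has_bochner_integral_divide_zero has_bochner_integral_exp1_power
      has_bochner_integral_const)
  then show ?thesis
    by (subst has_bochner_integral_gpd_iff) simp_all
qed

lemma integrable_h_squared: "integrable (gpd \<alpha>) (\<lambda>x. (h n \<alpha> x)\<^sup>2)"
proof -
  interpret prob_space exp1 by (rule prob_space_exp1)
  have "(\<lambda>t. (t ^ n / fact n - 1)\<^sup>2) = (\<lambda>t. t ^ (2 * n) / (fact n)\<^sup>2 - 2 * (t ^ n / fact n) + (1 :: real))"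
    by (simp add: fun_eq_iff power2_diff power_divide power_mult[symmetric] mult.commute)
  moreover have "integrable exp1 (\<lambda>t. t ^ (2 * n) / (fact n)\<^sup>2 - 2 * (t ^ n / fact n) + (1 :: real))"
    by (intro Bochner_Integration.integrable_add Bochner_Integration.integrable_diff integrable_mult_right
      integrable_divide_zero integrable_exp1_power integrable_const)
  ultimately have "integrable exp1 (\<lambda>t. (h n \<alpha> (pareto_of_exp \<alpha> t))\<^sup>2)"
    by simp
  then have "has_bochner_integral (gpd \<alpha>) (\<lambda>x. (h n \<alpha> x)\<^sup>2) (LINT t|exp1. (h n \<alpha> (pareto_of_exp \<alpha> t))\<^sup>2)"
    by (subst has_bochner_integral_gpd_iff) (measurable, rule has_bochner_integral_integrable)
  then show ?thesis by (rule integrable.intros)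
qed

lemma interval_measure_cdf:
  assumes "real_distribution D"
  shows "interval_measure (cdf D) = D"
proof -
  interpret real_distribution D by fact
  show ?thesis
    by (rule cdf_unique)
      (auto intro!: real_distribution_interval_measure assms cdf_nondecreasing cdf_is_right_cont
        cdf_lim_at_bot cdf_lim_at_top_prob simp: cdf_interval_measure[OF cdf_nondecreasing cdf_is_right_cont cdf_lim_at_bot])
qed

lemma has_mean_variance_iff:
  fixes \<alpha> :: real
  assumes "distribution_function F"
  defines "q \<equiv> \<lambda>x. quantile F (W \<alpha> x)"
  shows "has_mean_variance F \<mu> v \<longleftrightarrow>
    has_bochner_integral (gpd \<alpha>) q \<mu> \<and> has_bochner_integral (gpd \<alpha>) (\<lambda>x. (q x - \<mu>)\<^sup>2) v"
proof -
  from assms(1) obtain D where D: "real_distribution D" "F = cdf D"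
    by (auto simp: distribution_function_def)
  interpret cdf_distribution D
    using D by (simp add: cdf_distribution_def)
  have "has_bochner_integral D f J \<longleftrightarrow> has_bochner_integral (gpd \<alpha>) (\<lambda>x. f (q x)) J"
    if [measurable]: "f \<in> borel_measurable borel" for f :: "real \<Rightarrow> real" and J
    unfolding q_def D(2)
    by (subst has_bochner_integral_gpd_iff, measurable) (simp add: has_bochner_integral_quantile_iff)
  from this[of "\<lambda>x. x"] this[of "\<lambda>x. (x - \<mu>)\<^sup>2"] show ?thesis
    unfolding has_mean_variance_def D(2) interval_measure_cdf[OF D(1)]
    by (auto simp: has_bochner_integral_iff D(2))
qed

text \<open>An atom below the top makes the quantile constant between two levels u and u'. A concave
  function that does not increase there cannot increase later, so the quantile does not grow up to a
  level \<open>v\<close> between u' and 1, which forces \<open>F (quantile F u)\<close> to be at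
  least \<open>v\<close>.\<close>

lemma IGFR_no_inner_atoms:
  assumes "F \<in> IGFR \<alpha>"
  shows "no_inner_atoms F"
  unfolding no_inner_atoms_def
proof (intro ballI impI)
  from assms obtain D where D: "real_distribution D" "F = cdf D"
    by (auto simp: distribution_function_def IGFR_def)
  interpret cdf_distribution D
    using D by (simp add: cdf_distribution_def)
  have concave: "concave_on (W_support \<alpha>) (\<lambda>x. quantile F (W \<alpha> x))"
    using assms by (simp add: IGFR_def)
  fix u assume u: "u \<in> {0<..<1}" and less: "F (quantile F u) < 1"
  let ?u' = "F (quantile F u)"
  have le: "u \<le> ?u'"
    using quantile_le_iff[of u "quantile F u"] u by (simp add: D(2))
  have strict: False if "u < ?u'"
  proof -
    define v where "v = (?u' + 1) / 2"
    have v: "?u' < v" "v < 1" using less by (auto simp: v_def)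
    define x where "x p = pareto_of_exp \<alpha> (- ln (1 - p))" for p
    have x_in: "x p \<in> W_support \<alpha>" and W_x: "W \<alpha> (x p) = p" if "0 < p" "p < 1" for p
      using that by (auto simp: x_def intro: pareto_of_exp_in)
    have x_less: "x p < x p'" if "p < p'" "p' < 1" for p p'
      using that by (auto simp: x_def intro: pareto_of_exp_strict_mono)
    have flat: "quantile F ?u' \<le> quantile F u"
      using quantile_le_iff[of ?u' "quantile F u"] u less \<open>u < ?u'\<close> by (simp add: D(2))
    have "(x v - x ?u') * quantile F u + (x ?u' - x u) * quantile F v \<le> (x v - x u) * quantile F ?u'"
      using concave_on_three_points[OF concave, of "x u" "x v" "x ?u'"] x_in[of u] x_in[of v]
        x_less[of u ?u'] x_less[of ?u' v] W_x[of u] W_x[of v] W_x[of ?u'] u v that by simp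
    also have "\<dots> \<le> (x v - x u) * quantile F u"
      using flat x_less[of u v] v that by (intro mult_left_mono) auto
    finally have "(x ?u' - x u) * quantile F v \<le> (x ?u' - x u) * quantile F u"
      by (simp add: algebra_simps)
    then have "quantile F v \<le> quantile F u"
      using x_less[OF that less] by (simp add: mult_le_cancel_left_pos)
    then have "v \<le> ?u'"
      using quantile_le_iff[of v "quantile F u"] v u that by (simp add: D(2))
    with v show False by simp
  qed
  from le strict show "?u' = u" by (cases "u < ?u'") auto
qed

text \<open>The conditions under which a concave \<open>P\<close> is the projection of \<open>h n \<alpha>\<close> onto the cone of concave
  functions, with norm \<open>C\<close>. Concavity of \<open>P\<close> itself matters only for attaining the bound.\<close>

definition is_projection :: "nat \<Rightarrow> real \<Rightarrow> (real \<Rightarrow> real) \<Rightarrow> real \<Rightarrow> bool" where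
  "is_projection n \<alpha> P C \<longleftrightarrow> 0 < C \<and> P \<in> borel_measurable borel \<and>
     has_bochner_integral (gpd \<alpha>) P 0 \<and>
     has_bochner_integral (gpd \<alpha>) (\<lambda>x. (P x)\<^sup>2) (C\<^sup>2) \<and>
     has_bochner_integral (gpd \<alpha>) (\<lambda>x. P x * h n \<alpha> x) (C\<^sup>2) \<and>
     (\<forall>\<phi>. concave_on (W_support \<alpha>) \<phi> \<longrightarrow> \<phi> \<in> borel_measurable borel \<longrightarrow>
        integrable (gpd \<alpha>) (\<lambda>x. (\<phi> x)\<^sup>2) \<longrightarrow> (LINT x|gpd \<alpha>. \<phi> x * (h n \<alpha> x - P x)) \<le> 0)"

context iid_observations
begin

lemma record_mean:
  assumes F: "F \<in> IGFR \<alpha>" and mv: "has_mean_variance F \<mu> (\<sigma>\<^sup>2)" and "0 < \<sigma>"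
  defines "\<phi> \<equiv> \<lambda>x. (quantile F (W \<alpha> x) - \<mu>) / \<sigma>"
  shows "integrable M (record_value 1 X n)"
    and "std_record_mean M 1 X n \<mu> \<sigma> = (LINT x|gpd \<alpha>. \<phi> x * h n \<alpha> x)"
    and "concave_on (W_support \<alpha>) \<phi>" and "\<phi> \<in> borel_measurable borel"
    and "has_bochner_integral (gpd \<alpha>) (\<lambda>x. (\<phi> x)\<^sup>2) 1"
proof -
  interpret gpd: prob_space "gpd \<alpha>" by (rule prob_space_gpd)
  let ?q = "\<lambda>x. quantile F (W \<alpha> x)"
  note [measurable] = D.measurable_quantile[unfolded cdf_D]
  have df: "distribution_function F" using F by (simp add: IGFR_def)
  have q: "has_bochner_integral (gpd \<alpha>) ?q \<mu>" "has_bochner_integral (gpd \<alpha>) (\<lambda>x. (?q x - \<mu>)\<^sup>2) (\<sigma>\<^sup>2)"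
    using mv has_mean_variance_iff[OF df, of \<mu> "\<sigma>\<^sup>2" \<alpha>] by auto
  show \<phi> [measurable]: "\<phi> \<in> borel_measurable borel"
    unfolding \<phi>_def by measurable
  have "has_bochner_integral (gpd \<alpha>) (\<lambda>x. (?q x - \<mu>)\<^sup>2 / \<sigma>\<^sup>2) (\<sigma>\<^sup>2 / \<sigma>\<^sup>2)"
    by (intro has_bochner_integral_divide_zero q)
  then show sq: "has_bochner_integral (gpd \<alpha>) (\<lambda>x. (\<phi> x)\<^sup>2) 1"
    using \<open>0 < \<sigma>\<close> by (simp add: \<phi>_def power_divide)
  have conc: "concave_on (W_support \<alpha>) ?q"
    using F by (simp add: IGFR_def)
  have \<phi>_affine: "\<phi> = (\<lambda>x. (1 / \<sigma>) * ?q x + (- \<mu> / \<sigma>))"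
    by (simp add: \<phi>_def diff_divide_distrib)
  show "concave_on (W_support \<alpha>) \<phi>"
  proof -
    have "concave_on (W_support \<alpha>) (\<lambda>x. (1 / \<sigma>) * ?q x)"
      using conc \<open>0 < \<sigma>\<close> by (intro concave_on_cmul) auto
    moreover have "concave_on (W_support \<alpha>) (\<lambda>_. - \<mu> / \<sigma>)"
      by (simp add: concave_on_const convex_W_support)
    ultimately show ?thesis
      unfolding \<phi>_affine by (rule concave_on_add)
  qed
  have "has_bochner_integral (gpd \<alpha>) (\<lambda>x. (?q x - \<mu>) / \<sigma>) ((\<mu> - \<mu>) / \<sigma>)"
    by (intro has_bochner_integral_divide_zero has_bochner_integral_diff q gpd.has_bochner_integral_const)
  then have mean0: "has_bochner_integral (gpd \<alpha>) \<phi> 0"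
    by (simp add: \<phi>_def)
  have "integrable (gpd \<alpha>) (\<lambda>x. \<phi> x * h n \<alpha> x)"
    using sq integrable_h_squared by (intro integrable_mult_of_squares) (auto simp: has_bochner_integral_iff)
  then have "has_bochner_integral (gpd \<alpha>) (\<lambda>x. \<phi> x * h n \<alpha> x) (LINT x|gpd \<alpha>. \<phi> x * h n \<alpha> x)"
    by (rule has_bochner_integral_integrable)
  \<comment> \<open>As \<phi> has mean 0, \<open>h n \<alpha> x\<close> may be replaced by
    \<open>h n \<alpha> x + 1\<close>, the weight of the record.\<close>
  from has_bochner_integral_add[OF this mean0]
  have "has_bochner_integral (gpd \<alpha>) (\<lambda>x. (h n \<alpha> x + 1) * \<phi> x) (LINT x|gpd \<alpha>. \<phi> x * h n \<alpha> x)"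
    by (simp add: algebra_simps)
  then have "has_bochner_integral exp1 (\<lambda>t. t ^ n / fact n * \<phi> (pareto_of_exp \<alpha> t)) (LINT x|gpd \<alpha>. \<phi> x * h n \<alpha> x)"
    by (subst (asm) has_bochner_integral_gpd_iff) simp_all
  then have R: "has_bochner_integral M (\<lambda>\<omega>. (record_value 1 X n \<omega> - \<mu>) / \<sigma>) (LINT x|gpd \<alpha>. \<phi> x * h n \<alpha> x)"
    using has_bochner_integral_record_value_iff[OF IGFR_no_inner_atoms[OF F], of "\<lambda>r. (r - \<mu>) / \<sigma>" n]
    by (simp add: \<phi>_def)
  then show "std_record_mean M 1 X n \<mu> \<sigma> = (LINT x|gpd \<alpha>. \<phi> x * h n \<alpha> x)"
    unfolding std_record_mean_def by (rule has_bochner_integral_integral_eq)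
  have "integrable M (\<lambda>\<omega>. \<sigma> * ((record_value 1 X n \<omega> - \<mu>) / \<sigma>) + \<mu>)"
    using R by (intro Bochner_Integration.integrable_add integrable_mult_right) (auto simp: has_bochner_integral_iff)
  then show "integrable M (record_value 1 X n)"
    using \<open>0 < \<sigma>\<close> by simp
qed

text \<open>The inner product with \<open>h n \<alpha>\<close> splits into the one with the
  residual, which is nonpositive, and the one with \<open>P\<close>, which is at most the norm
  \<open>C\<close>, as the standardized quantile has norm 1.\<close>

lemma std_record_mean_le:
  assumes F: "F \<in> IGFR \<alpha>" "has_mean_variance F \<mu> (\<sigma>\<^sup>2)" "0 < \<sigma>" and P: "is_projection n \<alpha> P C"
  shows "std_record_mean M 1 X n \<mu> \<sigma> \<le> C"
proof -
  define \<phi> where "\<phi> x = (quantile F (W \<alpha> x) - \<mu>) / \<sigma>" for x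
  note rm = record_mean[OF F, folded \<phi>_def]
  note [measurable] = rm(4)
  have P': "0 < C" "P \<in> borel_measurable borel" "has_bochner_integral (gpd \<alpha>) (\<lambda>x. (P x)\<^sup>2) (C\<^sup>2)"
    and le0: "(LINT x|gpd \<alpha>. \<phi> x * (h n \<alpha> x - P x)) \<le> 0"
    using P rm(3-5) by (auto simp: is_projection_def has_bochner_integral_iff)
  note [measurable] = P'(2)
  have int: "integrable (gpd \<alpha>) (\<lambda>x. \<phi> x * h n \<alpha> x)" "integrable (gpd \<alpha>) (\<lambda>x. \<phi> x * P x)"
    using rm(5) P'(3) integrable_h_squared
    by (auto intro!: integrable_mult_of_squares simp: has_bochner_integral_iff)
  have "(LINT x|gpd \<alpha>. \<phi> x * (h n \<alpha> x - P x)) = (LINT x|gpd \<alpha>. \<phi> x * h n \<alpha> x) - (LINT x|gpd \<alpha>. \<phi> x * P x)"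
    using int by (simp add: right_diff_distrib)
  moreover have "(LINT x|gpd \<alpha>. \<phi> x * P x) \<le> C"
    using rm(5) P' by (intro integral_mult_le_of_norm) auto
  ultimately show ?thesis
    using le0 rm(2) by simp
qed

end

lemma iid_sample_exists:
  assumes "distribution_function F"
  shows "\<exists>(N :: (nat \<Rightarrow> real) measure) X. iid_sample N X F"
proof -
  from assms obtain D where D: "real_distribution D" "F = cdf D"
    by (auto simp: distribution_function_def)
  interpret D: real_distribution D by fact
  define N where "N = PiM (UNIV :: nat set) (\<lambda>_. D)"
  interpret product_prob_space "\<lambda>_. D" "UNIV :: nat set" ..
  interpret N: prob_space N
    unfolding N_def by (rule prob_space_PiM) (rule D.prob_space_axioms)
  have sets: "sets N = sets (PiM UNIV (\<lambda>_. borel))"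
    unfolding N_def by (intro sets_PiM_cong) auto
  have meas: "(\<lambda>\<omega>. \<omega> i) \<in> borel_measurable N" for i
    unfolding measurable_cong_sets[OF sets refl] by (rule measurable_component_singleton) simp
  have distr_i: "distr N borel (\<lambda>\<omega>. \<omega> i) = D" for i
    using PiM_component[of i] D.borel_UNIV unfolding N_def by (simp cong: distr_cong)
  have "N.indep_vars (\<lambda>_. borel) (\<lambda>i \<omega>. \<omega> i) UNIV"
  proof (subst N.indep_vars_iff_distr_eq_PiM)
    have "distr N (PiM UNIV (\<lambda>_. borel)) (\<lambda>\<omega>. \<lambda>i\<in>UNIV. \<omega> i) = distr N N (\<lambda>\<omega>. \<omega>)"
      by (intro distr_cong) (simp_all add: sets restrict_def)
    then show "distr N (PiM UNIV (\<lambda>_. borel)) (\<lambda>\<omega>. \<lambda>i\<in>UNIV. \<omega> i) =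
        (\<Pi>\<^sub>M i\<in>UNIV. distr N borel (\<lambda>\<omega>. \<omega> i))"
      by (simp add: distr_i) (simp add: N_def)
  qed (simp_all add: meas)
  then have "N.indep_vars (\<lambda>_. borel) (\<lambda>i \<omega>. \<omega> i) {1..}"
    by (rule N.indep_vars_subset) simp
  then have "iid_sample N (\<lambda>i \<omega>. \<omega> i) F"
    unfolding iid_sample_def using N.prob_space_axioms distr_i D by simp
  then show ?thesis by blast
qed

text \<open>The standardized quantile is \<open>P\<close> divided by \<open>C\<close>. Its inner
  product with \<open>h n \<alpha>\<close> is \<open>C\<close>, because \<open>P\<close> has the
  same inner product with \<open>h n \<alpha>\<close> as with itself.\<close>

lemma attains_equalityI:
  assumes E: "E \<in> IGFR \<alpha>" and P: "is_projection n \<alpha> P C" and "0 < \<sigma>"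
    and quant: "\<And>x. x \<in> W_support \<alpha> \<Longrightarrow> quantile E (W \<alpha> x) = \<mu> + \<sigma> / C * P x"
  shows "attains_equality n \<alpha> \<mu> \<sigma> C E"
proof -
  interpret gpd: prob_space "gpd \<alpha>" by (rule prob_space_gpd)
  have df: "distribution_function E" using E by (simp add: IGFR_def)
  then obtain D where D: "real_distribution D" "E = cdf D"
    by (auto simp: distribution_function_def)
  then interpret E: cdf_distribution D
    by (simp add: cdf_distribution_def)
  note [measurable] = E.measurable_quantile[folded D(2)]
  have "0 < C" and [measurable]: "P \<in> borel_measurable borel"
    and P0: "has_bochner_integral (gpd \<alpha>) P 0"
    and P2: "has_bochner_integral (gpd \<alpha>) (\<lambda>x. (P x)\<^sup>2) (C\<^sup>2)"
    and Ph: "has_bochner_integral (gpd \<alpha>) (\<lambda>x. P x * h n \<alpha> x) (C\<^sup>2)"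
    using P by (auto simp: is_projection_def)
  have ev: "AE x in gpd \<alpha>. quantile E (W \<alpha> x) = \<mu> + \<sigma> / C * P x"
    using AE_gpd[of \<alpha>] by eventually_elim (rule quant)
  have "has_bochner_integral (gpd \<alpha>) (\<lambda>x. \<mu> + \<sigma> / C * P x) (\<mu> + \<sigma> / C * 0)"
    by (intro has_bochner_integral_add has_bochner_integral_mult_right P0 gpd.has_bochner_integral_const)
  then have mean: "has_bochner_integral (gpd \<alpha>) (\<lambda>x. quantile E (W \<alpha> x)) \<mu>"
    using ev by (subst has_bochner_integral_cong_AE[where g = "\<lambda>x. \<mu> + \<sigma> / C * P x"]) simp_all
  have "has_bochner_integral (gpd \<alpha>) (\<lambda>x. (\<sigma> / C)\<^sup>2 * (P x)\<^sup>2) ((\<sigma> / C)\<^sup>2 * C\<^sup>2)"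
    by (intro has_bochner_integral_mult_right P2)
  then have var: "has_bochner_integral (gpd \<alpha>) (\<lambda>x. (quantile E (W \<alpha> x) - \<mu>)\<^sup>2) (\<sigma>\<^sup>2)"
    using ev \<open>0 < C\<close>
    by (subst has_bochner_integral_cong_AE[where g = "\<lambda>x. (\<sigma> / C)\<^sup>2 * (P x)\<^sup>2"])
      (auto simp: power_mult_distrib power_divide elim!: eventually_mono)
  have mv: "has_mean_variance E \<mu> (\<sigma>\<^sup>2)"
    using mean var has_mean_variance_iff[OF df, of \<mu> "\<sigma>\<^sup>2" \<alpha>] by simp
  have "integrable N (record_value 1 X n) \<and> std_record_mean N 1 X n \<mu> \<sigma> = C"
    if "iid_sample N X E" for N :: "(nat \<Rightarrow> real) measure" and X
  proof -
    interpret iid_observations N X E by standard fact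
    note rm = record_mean[OF E mv \<open>0 < \<sigma>\<close>]
    have "(LINT x|gpd \<alpha>. (quantile E (W \<alpha> x) - \<mu>) / \<sigma> * h n \<alpha> x) = (LINT x|gpd \<alpha>. (1 / C) * (P x * h n \<alpha> x))"
      using ev \<open>0 < \<sigma>\<close> by (intro integral_cong_AE) (measurable, auto elim!: eventually_mono)
    also have "\<dots> = (1 / C) * C\<^sup>2"
      using Ph by (simp add: has_bochner_integral_iff)
    also have "\<dots> = C"
      using \<open>0 < C\<close> by (simp add: power2_eq_square)
    finally show ?thesis
      using rm(1,2)[of n] by simp
  qed
  then show ?thesis
    unfolding attains_equality_def using E mv iid_sample_exists[OF df] by blast
qed

section \<open>The cases where the projection is affine or trivial\<close>

text \<open>The Galois relation says that \<open>E\<close> is the distribution function of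
  \<open>p\<close> under \<open>gpd \<alpha>\<close>; monotonicity, right-continuity and limits of
  \<open>E\<close> come with that.\<close>

lemma quantile_of_galois:
  assumes [measurable]: "p \<in> borel_measurable borel"
    and galois: "\<And>x z. x \<in> W_support \<alpha> \<Longrightarrow> p x \<le> z \<longleftrightarrow> W \<alpha> x \<le> E z"
    and bounds: "\<And>z. 0 \<le> E z" "\<And>z. E z \<le> 1"
  shows "distribution_function E" and "\<And>x. x \<in> W_support \<alpha> \<Longrightarrow> quantile E (W \<alpha> x) = p x"
proof -
  interpret gpd: prob_space "gpd \<alpha>" by (rule prob_space_gpd)
  let ?D = "distr (gpd \<alpha>) borel p"
  have "cdf ?D z = E z" for z
  proof -
    have "cdf ?D z = measure (gpd \<alpha>) {x. p x \<le> z}"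
      by (subst cdf_def, subst measure_distr) (auto simp: vimage_def)
    also have "\<dots> = measure (gpd \<alpha>) {x. W \<alpha> x \<le> E z}"
    proof (rule measure_eq_AE)
      show "AE x in gpd \<alpha>. x \<in> {x. p x \<le> z} \<longleftrightarrow> x \<in> {x. W \<alpha> x \<le> E z}"
        using AE_gpd[of \<alpha>] by eventually_elim (simp add: galois)
    qed measurable
    also have "\<dots> = measure exp1 {t. 1 - exp (- t) \<le> E z}"
      unfolding gpd_def by (subst measure_distr) (auto simp: vimage_def)
    also have "\<dots> = E z"
      by (rule measure_exp1_le) (rule bounds)+
    finally show ?thesis .
  qed
  then have "E = cdf ?D" by auto
  moreover have "real_distribution ?D"
    by (rule gpd.real_distribution_distr) measurable
  ultimately show "distribution_function E"
    unfolding distribution_function_def by blast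
  fix x assume x: "x \<in> W_support \<alpha>"
  then have "0 < W \<alpha> x"
    using hazard_pos[OF x] by (simp add: W_eq W_support_iff)
  moreover have "{z. W \<alpha> x \<le> E z} = {p x..}"
    using galois[OF x] by auto
  ultimately show "quantile E (W \<alpha> x) = p x"
    by (simp add: quantile_pos)
qed

lemma concave_on_transfer:
  assumes "concave_on S f" "\<And>x. x \<in> S \<Longrightarrow> k x = f x"
  shows "concave_on S k"
  using assms(1) unfolding concave_on_iff
  by (auto simp: assms(2) convexD)

lemma IGFR_of_galois:
  assumes "p \<in> borel_measurable borel"
    and "\<And>x z. x \<in> W_support \<alpha> \<Longrightarrow> p x \<le> z \<longleftrightarrow> W \<alpha> x \<le> E z"
    and "\<And>z. 0 \<le> E z" "\<And>z. E z \<le> 1"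
    and "concave_on (W_support \<alpha>) p"
  shows "E \<in> IGFR \<alpha>" and "\<And>x. x \<in> W_support \<alpha> \<Longrightarrow> quantile E (W \<alpha> x) = p x"
  using quantile_of_galois[OF assms(1-4)] concave_on_transfer[OF assms(5)]
  by (simp_all add: IGFR_def)

text \<open>Derivative of \<open>h n \<alpha>\<close> for \<open>n \<ge> 1\<close>, with
  \<open>1 / (1 - \<alpha> * x)\<close> written as an exponential, so that monotonicity can be
  studied in the variable \<open>hazard \<alpha> x\<close> alone.\<close>

definition h_deriv :: "nat \<Rightarrow> real \<Rightarrow> real \<Rightarrow> real" where
  "h_deriv n \<alpha> x = hazard \<alpha> x ^ (n - 1) / fact (n - 1) * exp (\<alpha> * hazard \<alpha> x)"

lemma exp_hazard: "0 < 1 - \<alpha> * x \<Longrightarrow> exp (\<alpha> * hazard \<alpha> x) = 1 / (1 - \<alpha> * x)"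
  by (simp add: hazard_def exp_minus field_simps)

lemma h_has_derivative:
  assumes "1 \<le> n" and x: "0 < 1 - \<alpha> * x"
  shows "(h n \<alpha> has_real_derivative h_deriv n \<alpha> x) (at x)"
proof -
  obtain m where n: "n = Suc m" using \<open>1 \<le> n\<close> by (cases n) auto
  have "((\<lambda>x. hazard \<alpha> x ^ n / fact n - 1) has_real_derivative
      (1 + real m) * (1 / (1 - \<alpha> * x) * hazard \<alpha> x ^ m) / fact n - 0) (at x)"
    unfolding n by (intro DERIV_diff DERIV_cdivide DERIV_power_Suc hazard_has_derivative x DERIV_const)
  also have "(1 + real m) * (1 / (1 - \<alpha> * x) * hazard \<alpha> x ^ m) / fact n - 0 = h_deriv n \<alpha> x"
    unfolding n h_deriv_def exp_hazard[OF x] fact_Suc by (simp add: divide_simps)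
  finally show ?thesis using x h_eq by (rule DERIV_transform_support)
qed

lemma has_bochner_integral_gpdI:
  fixes f :: "real \<Rightarrow> real"
  assumes "f \<in> borel_measurable borel"
    and "has_bochner_integral exp1 (\<lambda>t. f (pareto_of_exp \<alpha> t)) I"
  shows "has_bochner_integral (gpd \<alpha>) f I"
  using assms by (simp only: has_bochner_integral_gpd_iff)

lemma has_bochner_integral_gpd_id:
  assumes "- 1 < \<alpha>"
  shows "has_bochner_integral (gpd \<alpha>) (\<lambda>x. x) (1 / (1 + \<alpha>))"
proof (cases "\<alpha> = 0")
  case True
  have "has_bochner_integral exp1 (\<lambda>t. pareto_of_exp \<alpha> t) (1 / (1 + \<alpha>))"
    using has_bochner_integral_exp1_power[of 1] unfolding pareto_of_exp_def True by simp
  then show ?thesis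
    by (rule has_bochner_integral_gpdI[rotated]) measurable
next
  case False
  have "has_bochner_integral exp1 (\<lambda>t. (t ^ 0 * exp (0 * t) - t ^ 0 * exp (- \<alpha> * t)) / \<alpha>)
      ((fact 0 / (1 - 0) ^ (0 + 1) - fact 0 / (1 - - \<alpha>) ^ (0 + 1)) / \<alpha>)"
    using assms by (intro has_bochner_integral_divide_zero has_bochner_integral_diff
      has_bochner_integral_exp1_moment) auto
  also have "(fact 0 / (1 - 0) ^ (0 + 1) - fact 0 / (1 - - \<alpha>) ^ (0 + 1)) / \<alpha> = 1 / (1 + \<alpha>)"
  proof -
    have "1 + \<alpha> \<noteq> 0" using assms by simp
    with False show ?thesis by (simp add: divide_simps)
  qed
  also have "(\<lambda>t. (t ^ 0 * exp (0 * t) - t ^ 0 * exp (- \<alpha> * t)) / \<alpha>) = (\<lambda>t. pareto_of_exp \<alpha> t)"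
    using False by (simp add: fun_eq_iff pareto_of_exp_def)
  finally show ?thesis
    by (rule has_bochner_integral_gpdI[rotated]) measurable
qed

lemma has_bochner_integral_gpd_square:
  assumes "- 1 / 2 < \<alpha>"
  shows "has_bochner_integral (gpd \<alpha>) (\<lambda>x. x\<^sup>2) (2 / ((1 + \<alpha>) * (1 + 2 * \<alpha>)))"
proof (cases "\<alpha> = 0")
  case True
  have "has_bochner_integral exp1 (\<lambda>t. (pareto_of_exp \<alpha> t)\<^sup>2) (2 / ((1 + \<alpha>) * (1 + 2 * \<alpha>)))"
    using has_bochner_integral_exp1_power[of 2] unfolding pareto_of_exp_def True by (simp add: fact_numeral)
  then show ?thesis
    by (rule has_bochner_integral_gpdI[rotated]) measurable
next
  case False
  have "has_bochner_integral exp1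
      (\<lambda>t. (t ^ 0 * exp (0 * t) - 2 * (t ^ 0 * exp (- \<alpha> * t)) + t ^ 0 * exp ((- 2 * \<alpha>) * t)) / \<alpha>\<^sup>2)
      ((fact 0 / (1 - 0) ^ (0 + 1) - 2 * (fact 0 / (1 - - \<alpha>) ^ (0 + 1)) +
        fact 0 / (1 - (- 2 * \<alpha>)) ^ (0 + 1)) / \<alpha>\<^sup>2)"
    using assms by (intro has_bochner_integral_divide_zero has_bochner_integral_diff
      has_bochner_integral_add has_bochner_integral_mult_right has_bochner_integral_exp1_moment) auto
  also have "(fact 0 / (1 - 0) ^ (0 + 1) - 2 * (fact 0 / (1 - - \<alpha>) ^ (0 + 1)) +
        fact 0 / (1 - (- 2 * \<alpha>)) ^ (0 + 1)) / \<alpha>\<^sup>2 = 2 / ((1 + \<alpha>) * (1 + 2 * \<alpha>))"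
  proof -
    have "1 + \<alpha> \<noteq> 0" "1 + 2 * \<alpha> \<noteq> 0" using assms by auto
    then show ?thesis
      using False by (simp add: divide_simps) (simp add: algebra_simps power2_eq_square)
  qed
  also have "(\<lambda>t. (t ^ 0 * exp (0 * t) - 2 * (t ^ 0 * exp (- \<alpha> * t)) + t ^ 0 * exp ((- 2 * \<alpha>) * t)) / \<alpha>\<^sup>2) =
      (\<lambda>t. (pareto_of_exp \<alpha> t)\<^sup>2)"
    using False by (simp add: fun_eq_iff pareto_of_exp_def power_divide power2_diff exp_double[symmetric] mult.assoc)
  finally show ?thesis
    by (rule has_bochner_integral_gpdI[rotated]) measurable
qed

text \<open>The two variables are \<open>x\<close> and \<open>h n \<alpha> x\<close> under
  \<open>gpd \<alpha>\<close>; the value \<open>n\<close> at \<alpha> = 0 is the limit of the other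
  case.\<close>

definition covariance :: "nat \<Rightarrow> real \<Rightarrow> real" where
  "covariance n \<alpha> = (if \<alpha> = 0 then real n else (1 / (1 + \<alpha>) - 1 / (1 + \<alpha>) ^ (n + 1)) / \<alpha>)"

lemma has_bochner_integral_id_times_h:
  assumes "- 1 < \<alpha>"
  shows "has_bochner_integral (gpd \<alpha>) (\<lambda>x. x * h n \<alpha> x) (covariance n \<alpha>)"
proof (cases "\<alpha> = 0")
  case True
  have "has_bochner_integral exp1 (\<lambda>t. t ^ (n + 1) / fact n - t ^ 1) (fact (n + 1) / fact n - fact 1)"
    by (intro has_bochner_integral_divide_zero has_bochner_integral_diff has_bochner_integral_exp1_power)
  also have "(\<lambda>t. t ^ (n + 1) / fact n - t ^ 1) = (\<lambda>t. pareto_of_exp \<alpha> t * h n \<alpha> (pareto_of_exp \<alpha> t))"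
    unfolding h_pareto_of_exp using True by (simp add: pareto_of_exp_def algebra_simps)
  also have "fact (n + 1) / fact n - fact 1 = covariance n \<alpha>"
    using True by (simp add: covariance_def add_divide_distrib)
  finally show ?thesis
    by (rule has_bochner_integral_gpdI[rotated]) measurable
next
  case False
  have "has_bochner_integral exp1
      (\<lambda>t. ((t ^ n * exp (0 * t) - t ^ n * exp (- \<alpha> * t)) / fact n -
          (t ^ 0 * exp (0 * t) - t ^ 0 * exp (- \<alpha> * t))) / \<alpha>)
      (((fact n / (1 - 0) ^ (n + 1) - fact n / (1 - - \<alpha>) ^ (n + 1)) / fact n -
          (fact 0 / (1 - 0) ^ (0 + 1) - fact 0 / (1 - - \<alpha>) ^ (0 + 1))) / \<alpha>)"
    using assms by (intro has_bochner_integral_divide_zero has_bochner_integral_diff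
      has_bochner_integral_exp1_moment) auto
  also have "((fact n / (1 - 0) ^ (n + 1) - fact n / (1 - - \<alpha>) ^ (n + 1)) / fact n -
          (fact 0 / (1 - 0) ^ (0 + 1) - fact 0 / (1 - - \<alpha>) ^ (0 + 1))) / \<alpha> = covariance n \<alpha>"
    using False by (simp add: covariance_def diff_divide_distrib)
  also have "(\<lambda>t. ((t ^ n * exp (0 * t) - t ^ n * exp (- \<alpha> * t)) / fact n -
          (t ^ 0 * exp (0 * t) - t ^ 0 * exp (- \<alpha> * t))) / \<alpha>) =
      (\<lambda>t. pareto_of_exp \<alpha> t * h n \<alpha> (pareto_of_exp \<alpha> t))"
    using False by (simp add: fun_eq_iff) (simp add: pareto_of_exp_def divide_simps, simp add: algebra_simps)
  finally show ?thesis
    by (rule has_bochner_integral_gpdI[rotated]) measurable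
qed

lemma covariance_pos:
  assumes "1 \<le> n" "- 1 < \<alpha>"
  shows "0 < covariance n \<alpha>"
proof -
  consider "\<alpha> = 0" | "0 < \<alpha>" | "\<alpha> < 0" by linarith
  then show ?thesis
  proof cases
    case 2
    then have "1 / (1 + \<alpha>) ^ (n + 1) < 1 / (1 + \<alpha>) ^ 1"
      using assms by (intro divide_strict_left_mono power_strict_increasing) auto
    with 2 show ?thesis by (simp add: covariance_def)
  next
    case 3
    then have "1 / (1 + \<alpha>) ^ 1 < 1 / (1 + \<alpha>) ^ (n + 1)"
      using assms by (intro divide_strict_left_mono power_strict_decreasing) auto
    with 3 show ?thesis by (simp add: covariance_def divide_neg_neg)
  qed (use assms in \<open>simp add: covariance_def\<close>)
qed

definition gpd_variance :: "real \<Rightarrow> real" where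
  "gpd_variance \<alpha> = 1 / ((1 + \<alpha>)\<^sup>2 * (1 + 2 * \<alpha>))"

lemma gpd_variance_pos: "- 1 / 2 < \<alpha> \<Longrightarrow> 0 < gpd_variance \<alpha>"
  by (simp add: gpd_variance_def)

lemma has_bochner_integral_centered_square:
  assumes "- 1 / 2 < \<alpha>"
  shows "has_bochner_integral (gpd \<alpha>) (\<lambda>x. (x - 1 / (1 + \<alpha>))\<^sup>2) (gpd_variance \<alpha>)"
proof -
  interpret prob_space "gpd \<alpha>" by (rule prob_space_gpd)
  let ?m = "1 / (1 + \<alpha>)"
  have "has_bochner_integral (gpd \<alpha>) (\<lambda>x. x\<^sup>2 - 2 * ?m * x + ?m\<^sup>2)
      (2 / ((1 + \<alpha>) * (1 + 2 * \<alpha>)) - 2 * ?m * ?m + ?m\<^sup>2)"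
    using assms by (intro has_bochner_integral_add has_bochner_integral_diff has_bochner_integral_mult_right
      has_bochner_integral_gpd_id has_bochner_integral_gpd_square has_bochner_integral_const) auto
  also have "2 / ((1 + \<alpha>) * (1 + 2 * \<alpha>)) - 2 * ?m * ?m + ?m\<^sup>2 = gpd_variance \<alpha>"
  proof -
    have "1 + \<alpha> \<noteq> 0" "1 + 2 * \<alpha> \<noteq> 0" using assms by auto
    then show ?thesis
      unfolding gpd_variance_def by (simp add: divide_simps power2_eq_square)
  qed
  finally show ?thesis
    by (simp add: power2_diff algebra_simps)
qed

text \<open>The projection is the regression line, with slope covariance over variance and zero at
  the mean \<open>1 / (1 + \<alpha>)\<close>. The residual is then orthogonal to 1 and x; its
  derivative is nondecreasing, so it is negative on an interval.\<close>

lemma affine_projection: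
  assumes "- 1 / 2 < \<alpha>" "1 \<le> n"
    and mono: "\<And>x y. x \<in> W_support \<alpha> \<Longrightarrow> y \<in> W_support \<alpha> \<Longrightarrow> x \<le> y \<Longrightarrow> h_deriv n \<alpha> x \<le> h_deriv n \<alpha> y"
  defines "a \<equiv> covariance n \<alpha> / gpd_variance \<alpha>"
  shows "is_projection n \<alpha> (\<lambda>x. a * (x - 1 / (1 + \<alpha>))) (a * sqrt (gpd_variance \<alpha>))"
proof -
  interpret prob_space "gpd \<alpha>" by (rule prob_space_gpd)
  let ?m = "1 / (1 + \<alpha>)" and ?V = "gpd_variance \<alpha>" and ?c = "covariance n \<alpha>"
  let ?P = "\<lambda>x. a * (x - ?m)"
  have V: "0 < ?V" and c: "0 < ?c"
    using assms(1,2) by (simp_all add: gpd_variance_pos covariance_pos)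
  have aV: "a * ?V = ?c" using V by (simp add: a_def)
  have "0 < a" using V c by (simp add: a_def)
  have \<alpha>: "- 1 < \<alpha>" using assms(1) by simp
  note id = has_bochner_integral_gpd_id[OF \<alpha>] and xh = has_bochner_integral_id_times_h[OF \<alpha>, of n]
    and sq = has_bochner_integral_centered_square[OF assms(1)]
  have mean: "has_bochner_integral (gpd \<alpha>) (\<lambda>x. x - ?m) (?m - ?m)"
    by (intro has_bochner_integral_diff id has_bochner_integral_const)
  have P0: "has_bochner_integral (gpd \<alpha>) ?P 0"
    using has_bochner_integral_mult_right[OF mean, of a] by simp
  have P2: "has_bochner_integral (gpd \<alpha>) (\<lambda>x. (?P x)\<^sup>2) (a\<^sup>2 * ?V)"
    using has_bochner_integral_mult_right[OF sq, of "a\<^sup>2"] by (simp add: power_mult_distrib)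
  have Ph: "has_bochner_integral (gpd \<alpha>) (\<lambda>x. ?P x * h n \<alpha> x) (a * ?c)"
    using has_bochner_integral_diff[OF has_bochner_integral_mult_right[OF xh, of a]
      has_bochner_integral_mult_right[OF has_bochner_integral_h[of \<alpha> n], of "a * ?m"]]
    by (simp add: algebra_simps)
  have C2: "(a * sqrt ?V)\<^sup>2 = a\<^sup>2 * ?V" and ac: "a * ?c = a\<^sup>2 * ?V"
    using V by (simp add: power_mult_distrib, simp add: aV[symmetric] power2_eq_square)
  let ?r = "\<lambda>x. h n \<alpha> x - ?P x"
  have r0: "has_bochner_integral (gpd \<alpha>) ?r 0"
    using has_bochner_integral_diff[OF has_bochner_integral_h P0] by simp
  have "has_bochner_integral (gpd \<alpha>) (\<lambda>x. x * (x - ?m)) ?V"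
    using has_bochner_integral_add[OF sq has_bochner_integral_mult_right[OF mean, of ?m]]
    by (simp add: power2_eq_square algebra_simps)
  from has_bochner_integral_diff[OF xh has_bochner_integral_mult_right[OF this, of a]]
  have xr0: "has_bochner_integral (gpd \<alpha>) (\<lambda>x. x * ?r x) 0"
    using aV by (simp add: algebra_simps)
  have deriv: "(?r has_real_derivative (h_deriv n \<alpha> x - a)) (at x)" if "x \<in> W_support \<alpha>" for x
    using that assms(2) by (auto intro!: derivative_eq_intros h_has_derivative simp: W_support_iff)
  have neg: "?r x2 < 0" if x: "x1 \<in> W_support \<alpha>" "x3 \<in> W_support \<alpha>" "x1 < x2" "x2 < x3"
    and r: "?r x1 < 0" "?r x3 < 0" for x1 x2 x3
  proof (rule ccontr)
    assume "\<not> ?r x2 < 0"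
    then have r2: "0 \<le> ?r x2" by simp
    have S: "x \<in> W_support \<alpha>" if "x1 \<le> x" "x \<le> x3" for x
      using W_support_down[OF x(2), of x] x(1) that by (auto simp: W_support_iff)
    \<comment> \<open>A rise from below zero followed by a fall would need a larger derivative at
      the earlier point.\<close>
    obtain u where u: "x1 < u" "u < x2" "?r x2 - ?r x1 = (x2 - x1) * (h_deriv n \<alpha> u - a)"
      using MVT2[OF x(3), of ?r "\<lambda>x. h_deriv n \<alpha> x - a"] deriv S x by force
    obtain v where v: "x2 < v" "v < x3" "?r x3 - ?r x2 = (x3 - x2) * (h_deriv n \<alpha> v - a)"
      using MVT2[OF x(4), of ?r "\<lambda>x. h_deriv n \<alpha> x - a"] deriv S x by force
    have "0 < (x2 - x1) * (h_deriv n \<alpha> u - a)" using u(3) r r2 by linarith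
    then have "a < h_deriv n \<alpha> u" using x(3) by (simp add: zero_less_mult_iff)
    moreover have "(x3 - x2) * (h_deriv n \<alpha> v - a) < 0" using v(3) r r2 by linarith
    then have "h_deriv n \<alpha> v < a" using x(4) by (simp add: mult_less_0_iff)
    moreover have "h_deriv n \<alpha> u \<le> h_deriv n \<alpha> v"
      using u v x by (intro mono S) auto
    ultimately show False by simp
  qed
  have "(LINT x|gpd \<alpha>. \<phi> x * ?r x) \<le> 0"
    if \<phi>: "concave_on (W_support \<alpha>) \<phi>" and [measurable]: "\<phi> \<in> borel_measurable borel"
      and int: "integrable (gpd \<alpha>) (\<lambda>x. (\<phi> x)\<^sup>2)" for \<phi>
  proof -
    have "integrable (gpd \<alpha>) (\<lambda>x. \<phi> x * h n \<alpha> x - \<phi> x * ?P x)"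
      using P2 integrable_h_squared int
      by (intro Bochner_Integration.integrable_diff integrable_mult_of_squares)
        (auto simp: has_bochner_integral_iff)
    then have "integrable (gpd \<alpha>) (\<lambda>x. \<phi> x * ?r x)"
      by (simp add: right_diff_distrib)
    with r0 xr0 show ?thesis
      by (intro integral_concave_times_le_0[OF convex_W_support AE_gpd AE_gpd_neq \<phi>]) (use neg in blast)+
  qed
  then show ?thesis
    unfolding is_projection_def C2
    using \<open>0 < a\<close> V P0 P2 Ph by (simp add: ac)
qed

lemma h_deriv_mono:
  assumes "0 \<le> \<alpha>" "x \<in> W_support \<alpha>" "y \<in> W_support \<alpha>" "x \<le> y"
  shows "h_deriv n \<alpha> x \<le> h_deriv n \<alpha> y"
proof -
  have "hazard \<alpha> x \<le> hazard \<alpha> y"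
    using assms hazard_strict_mono[of x y \<alpha>] by (cases "x = y") (auto simp: W_support_iff)
  moreover have "0 \<le> hazard \<alpha> x" using hazard_pos[OF assms(2)] by simp
  ultimately show ?thesis
    unfolding h_deriv_def using assms(1)
    by (intro mult_mono divide_right_mono power_mono) (auto intro: mult_left_mono)
qed

lemma affine_projection_nonneg:
  assumes "0 \<le> \<alpha>" "1 \<le> n"
  defines "a \<equiv> covariance n \<alpha> / gpd_variance \<alpha>"
  shows "is_projection n \<alpha> (\<lambda>x. a * (x - 1 / (1 + \<alpha>))) (a * sqrt (gpd_variance \<alpha>))"
  unfolding a_def using assms by (intro affine_projection h_deriv_mono) auto

text \<open>On the exponential scale \<open>h 1 \<alpha>\<close> is t - 1, with mean 0 and variance
  1; the residual vanishes.\<close>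

lemma trivial_projection: "is_projection 1 \<alpha> (h 1 \<alpha>) 1"
proof -
  interpret prob_space exp1 by (rule prob_space_exp1)
  have "has_bochner_integral exp1 (\<lambda>t. t ^ 2 - 2 * t ^ 1 + 1) (fact 2 - 2 * fact 1 + 1)"
    by (intro has_bochner_integral_add has_bochner_integral_diff has_bochner_integral_mult_right
      has_bochner_integral_exp1_power has_bochner_integral_const)
  also have "(\<lambda>t. t ^ 2 - 2 * t ^ 1 + 1) = (\<lambda>t. (h 1 \<alpha> (pareto_of_exp \<alpha> t))\<^sup>2)"
    unfolding h_pareto_of_exp by (simp add: fun_eq_iff power2_diff)
  also have "fact 2 - 2 * fact 1 + 1 = (1 :: real)"
    by (simp add: fact_numeral)
  finally have "has_bochner_integral (gpd \<alpha>) (\<lambda>x. (h 1 \<alpha> x)\<^sup>2) 1"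
    by (rule has_bochner_integral_gpdI[rotated]) measurable
  then show ?thesis
    unfolding is_projection_def using has_bochner_integral_h[of \<alpha> 1]
    by (simp add: power2_eq_square)
qed

text \<open>Composed with \<open>W \<alpha>\<close>, the quantile is affine in
  \<open>hazard \<alpha>\<close>, which is concave for \<alpha> \<le> 0.\<close>

lemma exponential_cdf_IGFR:
  assumes "\<alpha> \<le> 0" "0 < \<sigma>"
  shows "exponential_cdf \<mu> \<sigma> \<in> IGFR \<alpha>"
    and "\<And>x. x \<in> W_support \<alpha> \<Longrightarrow> quantile (exponential_cdf \<mu> \<sigma>) (W \<alpha> x) = \<mu> + \<sigma> * (hazard \<alpha> x - 1)"
proof -
  let ?p = "\<lambda>x. \<mu> + \<sigma> * (hazard \<alpha> x - 1)"
  have galois: "?p x \<le> z \<longleftrightarrow> W \<alpha> x \<le> exponential_cdf \<mu> \<sigma> z" if x: "x \<in> W_support \<alpha>" for x z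
  proof -
    have H: "0 < hazard \<alpha> x" and W: "W \<alpha> x = 1 - exp (- hazard \<alpha> x)"
      using x hazard_pos[OF x] by (auto simp: W_eq W_support_iff)
    show ?thesis
    proof (cases "\<mu> - \<sigma> < z")
      case True
      have "?p x \<le> z \<longleftrightarrow> hazard \<alpha> x \<le> 1 + (z - \<mu>) / \<sigma>"
        using \<open>0 < \<sigma>\<close> by (simp add: field_simps)
      also have "\<dots> \<longleftrightarrow> exp (- 1 - (z - \<mu>) / \<sigma>) \<le> exp (- hazard \<alpha> x)"
        unfolding exp_le_cancel_iff by linarith
      finally show ?thesis
        using True by (simp add: exponential_cdf_def W)
    next
      case False
      have "0 < \<sigma> * hazard \<alpha> x" using H \<open>0 < \<sigma>\<close> by simp
      then have "\<not> ?p x \<le> z"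
        using False by (simp add: right_diff_distrib)
      with False H show ?thesis
        by (simp add: exponential_cdf_def W)
    qed
  qed
  have bounds: "0 \<le> exponential_cdf \<mu> \<sigma> z" "exponential_cdf \<mu> \<sigma> z \<le> 1" for z
  proof -
    have "- 1 - (z - \<mu>) / \<sigma> \<le> 0" if "\<mu> - \<sigma> < z"
      using that \<open>0 < \<sigma>\<close> by (simp add: field_simps)
    then show "0 \<le> exponential_cdf \<mu> \<sigma> z" "exponential_cdf \<mu> \<sigma> z \<le> 1"
      by (auto simp: exponential_cdf_def)
  qed
  have "convex_on (W_support \<alpha>) (\<lambda>x. - ?p x)"
  proof (rule convex_on_realI)
    show "connected (W_support \<alpha>)"
      by (rule convex_connected[OF convex_W_support])
    show "((\<lambda>x. - ?p x) has_real_derivative - \<sigma> * (1 / (1 - \<alpha> * x))) (at x)" if "x \<in> W_support \<alpha>" for x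
      using that by (auto intro!: derivative_eq_intros hazard_has_derivative simp: W_support_iff)
    show "- \<sigma> * (1 / (1 - \<alpha> * x)) \<le> - \<sigma> * (1 / (1 - \<alpha> * y))"
      if "x \<in> W_support \<alpha>" "y \<in> W_support \<alpha>" "x \<le> y" for x y
    proof -
      have "\<alpha> * y \<le> \<alpha> * x" using that assms by (intro mult_left_mono_neg)
      then have "1 / (1 - \<alpha> * y) \<le> 1 / (1 - \<alpha> * x)"
        using that by (intro divide_left_mono) (auto simp: W_support_iff intro: mult_pos_pos)
      then show ?thesis
        using \<open>0 < \<sigma>\<close> by (intro mult_left_mono_neg) auto
    qed
  qed
  then have conc: "concave_on (W_support \<alpha>) ?p"
    by (simp add: concave_on_def)
  show "exponential_cdf \<mu> \<sigma> \<in> IGFR \<alpha>"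
    and "\<And>x. x \<in> W_support \<alpha> \<Longrightarrow> quantile (exponential_cdf \<mu> \<sigma>) (W \<alpha> x) = ?p x"
    using IGFR_of_galois[of ?p \<alpha> "exponential_cdf \<mu> \<sigma>", OF _ galois bounds conc] by simp_all
qed

lemma G_hat_eq:
  assumes "0 < 1 - \<alpha> * x"
  shows "G_hat 1 n \<alpha> x = 1 - exp (- hazard \<alpha> x) * (\<Sum>i\<le>n. hazard \<alpha> x ^ i / fact i)"
  using assms by (simp add: G_hat_def G_def W_eq)

text \<open>\<open>1 - G_hat\<close> is written as a function times \<open>w \<alpha>\<close>, so
  that its integral becomes a sum of exponential moments, a geometric series with ratio
  \<open>1 / (1 + \<alpha>)\<close>.\<close>

lemma integral_G_hat:
  assumes "0 < \<alpha>"
  shows "integral {0..1 / \<alpha>} (G_hat 1 n \<alpha>) = 1 / (\<alpha> * (1 + \<alpha>) ^ (n + 1))"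
proof -
  let ?f = "\<lambda>x. (1 - \<alpha> * x) * (\<Sum>i\<le>n. hazard \<alpha> x ^ i / fact i)"
  have [measurable]: "?f \<in> borel_measurable borel" by measurable
  have "has_bochner_integral exp1 (\<lambda>t. \<Sum>i\<le>n. t ^ i * exp (- \<alpha> * t) / fact i)
      (\<Sum>i\<le>n. fact i / (1 - - \<alpha>) ^ (i + 1) / fact i)"
    using assms by (intro has_bochner_integral_sum has_bochner_integral_divide_zero
      has_bochner_integral_exp1_moment) auto
  then have "has_bochner_integral (gpd \<alpha>) ?f (\<Sum>i\<le>n. fact i / (1 - - \<alpha>) ^ (i + 1) / fact i)"
    by (subst has_bochner_integral_gpd_iff, measurable)
      (simp add: one_minus_pareto_of_exp sum_distrib_left mult_ac)
  then have "((\<lambda>x. ?f x * w \<alpha> x) has_integral (\<Sum>i\<le>n. fact i / (1 - - \<alpha>) ^ (i + 1) / fact i)) (W_support \<alpha>)"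
    using has_integral_gpd[of \<alpha> ?f] by (simp add: has_bochner_integral_iff)
  moreover have "?f x * w \<alpha> x = 1 - G_hat 1 n \<alpha> x" if "x \<in> W_support \<alpha>" for x
    using that by (simp add: W_support_iff w_eq G_hat_eq[unfolded One_nat_def])
  ultimately have "((\<lambda>x. 1 - G_hat 1 n \<alpha> x) has_integral
      (\<Sum>i\<le>n. fact i / (1 - - \<alpha>) ^ (i + 1) / fact i)) (W_support \<alpha>)"
    by (rule has_integral_eq[rotated])
  moreover have "(\<Sum>i\<le>n. fact i / (1 - - \<alpha>) ^ (i + 1) / fact i) = (1 - 1 / (1 + \<alpha>) ^ (n + 1)) / \<alpha>"
  proof -
    have "(\<Sum>i\<le>n. fact i / (1 - - \<alpha>) ^ (i + 1) / fact i) = (1 / (1 + \<alpha>)) * (\<Sum>i\<le>n. (1 / (1 + \<alpha>)) ^ i)"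
      by (simp add: sum_distrib_left power_divide)
    also have "(\<Sum>i\<le>n. (1 / (1 + \<alpha>)) ^ i) = (1 - (1 / (1 + \<alpha>)) ^ (n + 1)) / (1 - 1 / (1 + \<alpha>))"
      using assms by (subst sum_gp0) auto
    also have "(1 / (1 + \<alpha>)) * ((1 - (1 / (1 + \<alpha>)) ^ (n + 1)) / (1 - 1 / (1 + \<alpha>))) = (1 - 1 / (1 + \<alpha>) ^ (n + 1)) / \<alpha>"
    proof -
      have "(1 / (1 + \<alpha>)) * (z / (1 - 1 / (1 + \<alpha>))) = z / \<alpha>" for z
        using assms by (simp add: divide_simps)
      then show ?thesis by (simp only: power_one_over)
    qed
    finally show ?thesis .
  qed
  moreover have "((\<lambda>_. 1) has_integral (1 / \<alpha>)) {0..1 / \<alpha>}"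
    using has_integral_const_real[of "1 :: real" 0 "1 / \<alpha>"] assms by simp
  ultimately have "((\<lambda>x. 1 - (1 - G_hat 1 n \<alpha> x)) has_integral (1 / \<alpha> - (1 - 1 / (1 + \<alpha>) ^ (n + 1)) / \<alpha>)) {0..1 / \<alpha>}"
    using assms by (intro has_integral_diff)
      (auto simp: W_support_open_interval has_integral_Icc_iff_Ioo)
  then have "integral {0..1 / \<alpha>} (G_hat 1 n \<alpha>) = 1 / \<alpha> - (1 - 1 / (1 + \<alpha>) ^ (n + 1)) / \<alpha>"
    by (simp add: integral_unique)
  then show ?thesis
    by (simp add: diff_divide_distrib mult.commute[of \<alpha>] del: power_Suc power_add)
qed

text \<open>The bracket in \<open>a_star\<close> is the covariance and the factor before it the
  reciprocal of the variance, so \<open>a_star\<close> is the regression slope.\<close>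

lemma a_star_eq:
  assumes "0 < \<alpha>"
  shows "a_star n \<alpha> = covariance n \<alpha> / gpd_variance \<alpha>"
proof -
  have "1 / (\<alpha> * (1 + \<alpha>)) - integral {0..1 / \<alpha>} (G_hat 1 n \<alpha>) = covariance n \<alpha>"
    unfolding integral_G_hat[OF assms] covariance_def using assms
    by (simp add: diff_divide_distrib mult.commute[of \<alpha>] del: power_Suc power_add)
  then show ?thesis
    unfolding a_star_def gpd_variance_def by (simp add: add.commute mult.commute)
qed

lemma D_bound_eq:
  assumes "0 < \<alpha>" "1 \<le> n"
  shows "0 < a_star n \<alpha>" and "D_bound n \<alpha> = a_star n \<alpha> * sqrt (gpd_variance \<alpha>)"
proof -
  let ?a = "a_star n \<alpha>"
  show a: "0 < ?a"
    unfolding a_star_eq[OF assms(1)] using assms covariance_pos[of n \<alpha>] gpd_variance_pos[of \<alpha>] by simp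
  have nz: "1 + \<alpha> \<noteq> 0" "2 * \<alpha> + 1 \<noteq> 0" using assms by auto
  have "((2 * \<alpha> + 1) * (2 * ?a * b_star n \<alpha> + (\<alpha> + 1) * (b_star n \<alpha>)\<^sup>2) + 2 * ?a\<^sup>2) / ((1 + \<alpha>) * (2 * \<alpha> + 1)) =
      ?a\<^sup>2 * gpd_variance \<alpha>"
    unfolding b_star_def gpd_variance_def using nz
    by (simp add: divide_simps) (simp add: algebra_simps power2_eq_square)
  then show "D_bound n \<alpha> = ?a * sqrt (gpd_variance \<alpha>)"
    unfolding D_bound_def using a by (simp add: real_sqrt_mult)
qed

text \<open>The law is an affine image of \<open>gpd \<alpha>\<close>. The auxiliary \<zeta> inverts
  the affine quantile, and the constant branches of \<open>pareto_cdf\<close> belong to values of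
  \<zeta> outside the support.\<close>

lemma pareto_cdf_IGFR:
  assumes "0 < \<alpha>" "1 \<le> n" "0 < \<sigma>"
  shows "pareto_cdf n \<alpha> \<mu> \<sigma> \<in> IGFR \<alpha>"
    and "\<And>x. x \<in> W_support \<alpha> \<Longrightarrow> quantile (pareto_cdf n \<alpha> \<mu> \<sigma>) (W \<alpha> x) =
      \<mu> + \<sigma> / D_bound n \<alpha> * (a_star n \<alpha> * (x - 1 / (1 + \<alpha>)))"
proof -
  define s where "s = \<sigma> / D_bound n \<alpha> * a_star n \<alpha>"
  have "0 < D_bound n \<alpha>"
    unfolding D_bound_eq(2)[OF assms(1,2)] using D_bound_eq(1)[OF assms(1,2)] gpd_variance_pos[of \<alpha>] assms by simp
  then have "0 < s"
    using D_bound_eq(1)[OF assms(1,2)] assms by (simp add: s_def)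
  let ?p = "\<lambda>x. \<mu> + s * (x - 1 / (1 + \<alpha>))"
  let ?E = "pareto_cdf n \<alpha> \<mu> \<sigma>"
  define \<zeta> where "\<zeta> z = 1 / (1 + \<alpha>) + (z - \<mu>) / s" for z
  have E: "?E z = (if \<zeta> z \<le> 0 then 0 else if 1 / \<alpha> \<le> \<zeta> z then 1 else W \<alpha> (\<zeta> z))" for z
  proof -
    have "(z - \<mu>) / (\<sigma> * a_star n \<alpha>) * D_bound n \<alpha> = (z - \<mu>) / s"
      using \<open>0 < D_bound n \<alpha>\<close> by (simp add: s_def)
    then show ?thesis
      using assms(1) by (simp add: pareto_cdf_def \<zeta>_def W_def Let_def)
  qed
  have \<zeta>: "\<zeta> z \<in> W_support \<alpha>" if "\<not> \<zeta> z \<le> 0" "\<not> 1 / \<alpha> \<le> \<zeta> z" for z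
    using that by (auto simp: W_support_def)
  have W_bounds: "0 < W \<alpha> x" "W \<alpha> x < 1" if "x \<in> W_support \<alpha>" for x
    using hazard_pos[OF that] that by (auto simp: W_support_iff W_eq)
  have galois: "?p x \<le> z \<longleftrightarrow> W \<alpha> x \<le> ?E z" if x: "x \<in> W_support \<alpha>" for x z
  proof -
    have "?p x \<le> z \<longleftrightarrow> x \<le> \<zeta> z"
      using \<open>0 < s\<close> by (simp add: \<zeta>_def field_simps)
    also have "\<dots> \<longleftrightarrow> W \<alpha> x \<le> ?E z"
    proof -
      consider "\<zeta> z \<le> 0" | "\<not> \<zeta> z \<le> 0" "1 / \<alpha> \<le> \<zeta> z" | "\<not> \<zeta> z \<le> 0" "\<not> 1 / \<alpha> \<le> \<zeta> z" by blast
      then show ?thesis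
      proof cases
        case 1
        then show ?thesis
          using x W_bounds[OF x] by (simp add: E W_support_def)
      next
        case 2
        then show ?thesis
          using x W_bounds[OF x] assms(1) by (simp add: E W_support_def)
      next
        case 3
        have "x \<le> \<zeta> z \<longleftrightarrow> hazard \<alpha> x \<le> hazard \<alpha> (\<zeta> z)"
          using hazard_strict_mono[of x "\<zeta> z" \<alpha>] hazard_strict_mono[of "\<zeta> z" x \<alpha>] x \<zeta>[OF 3]
          by (cases x "\<zeta> z" rule: linorder_cases) (auto simp: W_support_iff)
        then show ?thesis
          using 3 x \<zeta>[OF 3] by (simp add: E W_support_iff W_eq)
      qed
    qed
    finally show ?thesis .
  qed
  have bounds: "0 \<le> ?E z" "?E z \<le> 1" for z
    using W_bounds[OF \<zeta>, of z] by (auto simp: E intro: less_imp_le)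
  have "concave_on (W_support \<alpha>) ?p"
    by (rule concave_on_supergradient[OF convex_W_support]) (auto intro!: exI[of _ s] simp: right_diff_distrib)
  from IGFR_of_galois[of ?p \<alpha> ?E, OF _ galois bounds this]
  show "?E \<in> IGFR \<alpha>"
    and "\<And>x. x \<in> W_support \<alpha> \<Longrightarrow> quantile ?E (W \<alpha> x) = \<mu> + \<sigma> / D_bound n \<alpha> * (a_star n \<alpha> * (x - 1 / (1 + \<alpha>)))"
    by (simp_all add: s_def mult.assoc)
qed

section \<open>The inflection point\<close>

lemma strictly_convex_onI_deriv:
  assumes "convex S"
    and deriv: "\<And>x. x \<in> S \<Longrightarrow> (f has_real_derivative f' x) (at x)"
    and mono: "\<And>x y. x \<in> S \<Longrightarrow> y \<in> S \<Longrightarrow> x < y \<Longrightarrow> f' x < f' y"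
  shows "strictly_convex_on S f"
  unfolding strictly_convex_on_def
proof (intro conjI ballI allI impI)
  have less: "f ((1 - t) * x + t * y) < (1 - t) * f x + t * f y"
    if xy: "x \<in> S" "y \<in> S" "x < y" and t: "0 < t" "t < 1" for x y t
  proof -
    define z where "z = (1 - t) * x + t * y"
    have z: "z - x = t * (y - x)" "y - z = (1 - t) * (y - x)"
      by (simp_all add: z_def algebra_simps)
    have "0 < z - x" "0 < y - z" unfolding z using xy t by auto
    then have xz: "x < z" "z < y" by auto
    have in_S: "s \<in> S" if "x \<le> s" "s \<le> y" for s
      using mem_is_interval_1_I[of S x y s] assms(1) xy that by (simp add: is_interval_convex_1)
    obtain u where u: "x < u" "u < z" "f z - f x = (z - x) * f' u"
      using MVT2[OF xz(1), of f f'] deriv in_S xz by (metis less_imp_le order_trans)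
    obtain v where v: "z < v" "v < y" "f y - f z = (y - z) * f' v"
      using MVT2[OF xz(2), of f f'] deriv in_S xz by (metis less_imp_le order_trans)
    have "f' u < f' v"
      using u v xz by (intro mono in_S) auto
    have "(1 - t) * f x + t * f y - f z = t * (f y - f z) - (1 - t) * (f z - f x)"
      by (simp add: algebra_simps)
    also have "\<dots> = t * (1 - t) * (y - x) * (f' v - f' u)"
      unfolding u(3) v(3) z by (simp add: algebra_simps)
    also have "\<dots> > 0"
      using t xy \<open>f' u < f' v\<close> by (intro mult_pos_pos) auto
    finally show ?thesis by (simp add: z_def)
  qed
  fix x y t :: real assume xy: "x \<in> S" "y \<in> S" and t: "x \<noteq> y \<and> 0 < t \<and> t < 1"
  show "f ((1 - t) * x + t * y) < (1 - t) * f x + t * f y"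
  proof (cases "x < y")
    case True
    then show ?thesis using less xy t by blast
  next
    case False
    then show ?thesis
      using less[of y x "1 - t"] xy t by (simp add: add.commute)
  qed
qed (rule assms)

locale negative_parameter =
  fixes n :: nat and \<alpha> :: real
  assumes \<alpha>: "- 1 / 2 < \<alpha>" "\<alpha> < 0" and n: "2 \<le> n"
begin

lemma dom: "0 \<le> x \<Longrightarrow> 0 < 1 - \<alpha> * x"
  using \<alpha> mult_nonpos_nonneg[of \<alpha> x] by linarith

lemma support: "W_support \<alpha> = {0<..}"
  using \<alpha> by (auto simp: W_support_def)

lemma hazard_less: "0 \<le> x \<Longrightarrow> x < y \<Longrightarrow> hazard \<alpha> x < hazard \<alpha> y"
  using dom[of x] dom[of y] by (intro hazard_strict_mono) simp_all

lemma hazard_nonneg: "0 \<le> x \<Longrightarrow> 0 \<le> hazard \<alpha> x"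
  using hazard_less[of 0 x] by (cases "x = 0") auto

lemma h_DERIV: "0 \<le> x \<Longrightarrow> (h n \<alpha> has_real_derivative h_deriv n \<alpha> x) (at x)"
  using n by (intro h_has_derivative dom) auto

text \<open>The maximizer of \<open>h_deriv n \<alpha>\<close>: on the hazard scale
  \<open>t ^ (n - 1) * exp (\<alpha> * t)\<close> is largest at \<open>(n - 1) / - \<alpha>\<close>.
  It turns out to be the inflection point.\<close>

definition mode :: real where
  "mode = pareto_of_exp \<alpha> (real (n - 1) / - \<alpha>)"

lemma mode_pos: "0 < mode"
  using pareto_of_exp_in[of "real (n - 1) / - \<alpha>" \<alpha>] n \<alpha>
  by (simp add: mode_def support divide_pos_neg)

lemma hazard_mode: "hazard \<alpha> mode = real (n - 1) / - \<alpha>"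
  by (simp add: mode_def)

lemma power_exp_deriv:
  "((\<lambda>t. t ^ (n - 1) * exp (\<alpha> * t)) has_real_derivative
    t ^ (n - 2) * exp (\<alpha> * t) * (real (n - 1) + \<alpha> * t)) (at t)"
proof -
  obtain m where m: "n = Suc (Suc m)" using n by (metis Suc_le_D numeral_2_eq_2 Suc_le_mono)
  have "((\<lambda>t. t ^ Suc m * exp (\<alpha> * t)) has_real_derivative
      (1 + real m) * (1 * t ^ m) * exp (\<alpha> * t) + exp (\<alpha> * t) * \<alpha> * t ^ Suc m) (at t)"
    by (rule DERIV_mult[OF DERIV_power_Suc[OF DERIV_ident]])
      (auto intro!: derivative_eq_intros)
  then show ?thesis
    by (simp add: m algebra_simps)
qed

lemma h_deriv_less_before_mode:
  assumes "0 \<le> x" "x < y" "y \<le> mode"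
  shows "h_deriv n \<alpha> x < h_deriv n \<alpha> y"
proof -
  let ?s = "hazard \<alpha> x" and ?t = "hazard \<alpha> y"
  have st: "0 \<le> ?s" "?s < ?t" "?t \<le> hazard \<alpha> mode"
    using assms hazard_nonneg[of x] hazard_less[of x y] hazard_less[of y mode] by (auto simp: le_less)
  have "?s ^ (n - 1) * exp (\<alpha> * ?s) < ?t ^ (n - 1) * exp (\<alpha> * ?t)"
  proof (rule DERIV_pos_imp_increasing_open[OF st(2)])
    fix u assume u: "?s < u" "u < ?t"
    then have "u < real (n - 1) / - \<alpha>" using st unfolding hazard_mode by linarith
    then have "0 < real (n - 1) + \<alpha> * u"
      using \<alpha> by (simp add: field_simps)
    then have "0 < u ^ (n - 2) * exp (\<alpha> * u) * (real (n - 1) + \<alpha> * u)"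
      using u st by (intro mult_pos_pos) auto
    then show "\<exists>D. ((\<lambda>t. t ^ (n - 1) * exp (\<alpha> * t)) has_real_derivative D) (at u) \<and> 0 < D"
      using power_exp_deriv by blast
  qed (intro continuous_intros)
  then show ?thesis
    by (simp add: h_deriv_def divide_strict_right_mono)
qed

lemma h_deriv_less_after_mode:
  assumes "mode \<le> x" "x < y"
  shows "h_deriv n \<alpha> y < h_deriv n \<alpha> x"
proof -
  let ?s = "hazard \<alpha> x" and ?t = "hazard \<alpha> y"
  have st: "hazard \<alpha> mode \<le> ?s" "?s < ?t"
    using assms mode_pos hazard_less[of x y] hazard_less[of mode x] by (auto simp: le_less)
  have "?t ^ (n - 1) * exp (\<alpha> * ?t) < ?s ^ (n - 1) * exp (\<alpha> * ?s)"
  proof (rule DERIV_neg_imp_decreasing_open[OF st(2)])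
    fix u assume u: "?s < u" "u < ?t"
    then have less: "real (n - 1) / - \<alpha> < u" using st unfolding hazard_mode by linarith
    then have "real (n - 1) + \<alpha> * u < 0"
      using \<alpha> by (simp add: field_simps)
    moreover have "0 \<le> real (n - 1) / - \<alpha>" using \<alpha> by (simp add: divide_nonneg_neg)
    with less have "0 < u" by linarith
    ultimately have "u ^ (n - 2) * exp (\<alpha> * u) * (real (n - 1) + \<alpha> * u) < 0"
      by (intro mult_pos_neg mult_pos_pos) auto
    then show "\<exists>D. ((\<lambda>t. t ^ (n - 1) * exp (\<alpha> * t)) has_real_derivative D) (at u) \<and> D < 0"
      using power_exp_deriv by blast
  qed (intro continuous_intros)
  then show ?thesis
    by (simp add: h_deriv_def divide_strict_right_mono)
qed

lemma h_deriv_quasi_concave: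
  assumes "0 \<le> x" "x < y" "y < z"
  shows "min (h_deriv n \<alpha> x) (h_deriv n \<alpha> z) < h_deriv n \<alpha> y"
  using h_deriv_less_before_mode[of x y] h_deriv_less_after_mode[of y z] assms
  by (cases "y \<le> mode") auto

lemma h_deriv_pos: "0 < x \<Longrightarrow> 0 < h_deriv n \<alpha> x"
  using hazard_pos[of x \<alpha>] by (simp add: h_deriv_def support)

lemma h_less:
  assumes x: "0 \<le> x" and "x < y"
  shows "h n \<alpha> x < h n \<alpha> y"
proof (rule DERIV_pos_imp_increasing_open[OF assms(2)])
  show "\<exists>D. (h n \<alpha> has_real_derivative D) (at u) \<and> 0 < D" if "x < u" "u < y" for u
    using h_DERIV[of u] h_deriv_pos[of u] x that by (intro exI[of _ "h_deriv n \<alpha> u"]) auto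
  show "continuous_on {x..y} (h n \<alpha>)"
    using x by (intro continuous_at_imp_continuous_on ballI DERIV_isCont[OF h_DERIV]) auto
qed

lemma inflection_point_eq: "inflection_point n \<alpha> = mode"
  unfolding inflection_point_def
proof (rule the_equality)
  let ?inflection = "\<lambda>b. 0 < b \<and> strictly_convex_on {0<..<b} (h n \<alpha>) \<and> strict_mono_on {0<..<b} (h n \<alpha>) \<and>
     strictly_convex_on {b<..} (\<lambda>x. - h n \<alpha> x) \<and> strict_mono_on {b<..} (h n \<alpha>)"
  have 1: "strictly_convex_on {0<..<mode} (h n \<alpha>)"
    by (rule strictly_convex_onI_deriv[where f' = "h_deriv n \<alpha>"])
      (auto intro: h_DERIV h_deriv_less_before_mode)
  have 2: "strictly_convex_on {mode<..} (\<lambda>x. - h n \<alpha> x)"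
    by (rule strictly_convex_onI_deriv[where f' = "\<lambda>x. - h_deriv n \<alpha> x"])
      (use mode_pos in \<open>auto intro!: DERIV_minus h_DERIV h_deriv_less_after_mode\<close>)
  show "?inflection mode"
    using mode_pos 1 2 by (auto simp: strict_mono_on_def intro!: h_less)
  \<comment> \<open>Two candidates would leave an interval on which \<open>h n \<alpha>\<close> is
    both strictly convex and strictly concave; its two trisection points and their midpoint refute
    this.\<close>
  have False if less: "b < b'" and "strictly_convex_on {0<..<b'} (h n \<alpha>)"
    and "strictly_convex_on {b<..} (\<lambda>x. - h n \<alpha> x)" and "0 < b" for b b'
  proof -
    define x where "x = (2 * b + b') / 3"
    define y where "y = (b + 2 * b') / 3"
    have xy: "b < x" "x < y" "y < b'" using less by (auto simp: x_def y_def)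
    have "h n \<alpha> ((1 - 1 / 2) * x + 1 / 2 * y) < (1 - 1 / 2) * h n \<alpha> x + 1 / 2 * h n \<alpha> y"
      using that(2) xy \<open>0 < b\<close> unfolding strictly_convex_on_def
      by (elim conjE ballE[of _ _ x] ballE[of _ _ y] allE[of _ "1 / 2"]) auto
    moreover have "- h n \<alpha> ((1 - 1 / 2) * x + 1 / 2 * y) < (1 - 1 / 2) * - h n \<alpha> x + 1 / 2 * - h n \<alpha> y"
      using that(3) xy unfolding strictly_convex_on_def
      by (elim conjE ballE[of _ _ x] ballE[of _ _ y] allE[of _ "1 / 2"]) auto
    ultimately show False by simp
  qed
  note unique = this
  show "b = mode" if b: "?inflection b" for b
    using unique[of b mode] unique[of mode b] b 1 2 mode_pos by (cases b mode rule: linorder_cases) auto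
qed

section \<open>Truncated moments\<close>

text \<open>The integrals over \<open>{0..y}\<close> in \<open>slope\<close> and
  \<open>Z_fun\<close>, taken as Lebesgue integrals: linearity then follows from integrability on
  the whole support, and the limit for large y from dominated convergence.\<close>

definition trunc :: "real \<Rightarrow> (real \<Rightarrow> real) \<Rightarrow> real" where
  "trunc y f = (LINT x|gpd \<alpha>. indicator {..y} x * f x)"

lemma integrable_trunc:
  fixes f :: "real \<Rightarrow> real"
  shows "integrable (gpd \<alpha>) f \<Longrightarrow> integrable (gpd \<alpha>) (\<lambda>x. indicator {..y} x * f x)"
  using integrable_mult_indicator[of "{..y}" "gpd \<alpha>" f] by simp

lemma trunc_add:
  "integrable (gpd \<alpha>) f \<Longrightarrow> integrable (gpd \<alpha>) f' \<Longrightarrow> trunc y (\<lambda>x. f x + f' x) = trunc y f + trunc y f'"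
  unfolding trunc_def by (simp add: distrib_left integrable_trunc)

lemma trunc_diff:
  "integrable (gpd \<alpha>) f \<Longrightarrow> integrable (gpd \<alpha>) f' \<Longrightarrow> trunc y (\<lambda>x. f x - f' x) = trunc y f - trunc y f'"
  unfolding trunc_def by (simp add: right_diff_distrib integrable_trunc)

lemma trunc_cmult: "trunc y (\<lambda>x. c * f x) = c * trunc y f"
  unfolding trunc_def by (simp add: mult.left_commute)

lemma trunc_has_integral:
  assumes int: "integrable (gpd \<alpha>) f" and [measurable]: "f \<in> borel_measurable borel" and "0 \<le> y"
  shows "((\<lambda>x. f x * w \<alpha> x) has_integral trunc y f) {0..y}"
proof -
  have "((\<lambda>x. indicator {..y} x * f x * w \<alpha> x) has_integral trunc y f) {0<..}"
    using has_integral_gpd[OF integrable_trunc[OF int, of y]] unfolding support trunc_def by simp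
  also have "(\<lambda>x. indicator {..y} x * f x * w \<alpha> x) = (\<lambda>x. if x \<in> {..y} then f x * w \<alpha> x else 0)"
    by (auto split: split_indicator)
  finally have hi: "((\<lambda>x. f x * w \<alpha> x) has_integral trunc y f) ({..y} \<inter> {0<..})"
    by (simp only: has_integral_restrict_Int)
  have null: "negligible {x \<in> {..y} \<inter> {0<..} - {0..y}. f x * w \<alpha> x \<noteq> 0}"
    "negligible {x \<in> {0..y} - {..y} \<inter> {0<..}. f x * w \<alpha> x \<noteq> 0}"
    by (rule negligible_subset[of "{0}"]; auto)+
  show ?thesis
    by (rule has_integral_spike_set_eq[OF null, THEN iffD1, OF hi])
qed

lemma trunc_integral:
  "integrable (gpd \<alpha>) f \<Longrightarrow> f \<in> borel_measurable borel \<Longrightarrow> 0 \<le> y \<Longrightarrow>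
    integral {0..y} (\<lambda>x. f x * w \<alpha> x) = trunc y f"
  by (rule integral_unique) (rule trunc_has_integral)

lemma trunc_continuous:
  assumes "integrable (gpd \<alpha>) f" "f \<in> borel_measurable borel"
  shows "continuous_on {0..c} (\<lambda>y. trunc y f)"
proof (cases "0 \<le> c")
  case True
  have "continuous_on {0..c} (\<lambda>y. integral {0..y} (\<lambda>x. f x * w \<alpha> x))"
    using trunc_has_integral[OF assms True]
    by (intro indefinite_integral_continuous_1) (rule has_integral_integrable)
  then show ?thesis
    by (rule continuous_on_cong[THEN iffD1, rotated -1]) (use assms in \<open>auto simp: trunc_integral\<close>)
qed simp

lemma trunc_tendsto:
  assumes "integrable (gpd \<alpha>) f"
  shows "((\<lambda>y. trunc y f) \<longlongrightarrow> (LINT x|gpd \<alpha>. f x)) at_top"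
  using tendsto_integral_at_top[OF _ assms] unfolding trunc_def by simp

text \<open>Every interval (0,y) has the positive mass \<open>W \<alpha> y\<close>.\<close>

lemma gpd_charges:
  assumes "AE x in gpd \<alpha>. Q x" "0 < y"
  obtains x where "0 < x" "x < y" "Q x"
proof (rule ccontr)
  assume "\<not> thesis"
  with that have none: "\<not> (0 < x \<and> x < y \<and> Q x)" for x by blast
  have "AE x in gpd \<alpha>. \<not> x \<le> y"
    using assms(1) AE_gpd[of \<alpha>] AE_gpd_neq[of y \<alpha>]
  proof eventually_elim
    case (elim x)
    then show ?case using none[of x] by (auto simp: support)
  qed
  from emeasure_eq_0_AE[OF this] have "emeasure (gpd \<alpha>) {..y} = 0"
    by (simp add: atMost_def)
  moreover have "0 < W \<alpha> y"
    using hazard_pos[of y \<alpha>] assms(2) dom[of y] by (simp add: support W_eq)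
  ultimately show False
    using emeasure_gpd_Iic[of y \<alpha>] assms(2) by (simp add: support)
qed

lemma integrable_id: "integrable (gpd \<alpha>) (\<lambda>x. x)"
  and integrable_square: "integrable (gpd \<alpha>) (\<lambda>x. x\<^sup>2)"
  and integrable_h: "integrable (gpd \<alpha>) (h n \<alpha>)"
  and integrable_id_h: "integrable (gpd \<alpha>) (\<lambda>x. x * h n \<alpha> x)"
  and integrable_one: "integrable (gpd \<alpha>) (\<lambda>_. c :: real)"
proof -
  interpret prob_space "gpd \<alpha>" by (rule prob_space_gpd)
  show "integrable (gpd \<alpha>) (\<lambda>x. x)" "integrable (gpd \<alpha>) (\<lambda>x. x\<^sup>2)" "integrable (gpd \<alpha>) (h n \<alpha>)"
    "integrable (gpd \<alpha>) (\<lambda>x. x * h n \<alpha> x)" "integrable (gpd \<alpha>) (\<lambda>_. c)"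
    using has_bochner_integral_gpd_id[of \<alpha>] has_bochner_integral_gpd_square[of \<alpha>] \<alpha>
      has_bochner_integral_h[of \<alpha> n] has_bochner_integral_id_times_h[of \<alpha> n]
    by (auto simp: has_bochner_integral_iff)
qed

end

context negative_parameter
begin

lemmas integrable_intros = integrable_id integrable_square integrable_h integrable_id_h integrable_one
  Bochner_Integration.integrable_add Bochner_Integration.integrable_diff integrable_mult_right

definition B where "B y = trunc y (\<lambda>x. (x - y)\<^sup>2)"

text \<open>Residual of the weighted least-squares fit on (0,y) among the lines through the point of
  the graph of \<open>h n \<alpha>\<close> above y.\<close>

definition rest :: "real \<Rightarrow> real \<Rightarrow> real" where
  "rest y x = h n \<alpha> x - h n \<alpha> y - slope n \<alpha> y * (x - y)"

lemma measurable_rest [measurable]: "rest y \<in> borel_measurable borel"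
  unfolding rest_def by measurable

lemma rest_at [simp]: "rest y y = 0"
  by (simp add: rest_def)

lemma integrable_quadratic: "integrable (gpd \<alpha>) (\<lambda>x. (x - y)\<^sup>2)"
proof -
  have "(\<lambda>x. (x - y)\<^sup>2) = (\<lambda>x. x\<^sup>2 - (2 * y) * x + y\<^sup>2)"
    by (simp add: fun_eq_iff power2_diff)
  then show ?thesis by (simp only:) (intro integrable_intros)
qed

lemma integrable_cross: "integrable (gpd \<alpha>) (\<lambda>x. (x - y) * (h n \<alpha> x - c))"
proof -
  have "(\<lambda>x. (x - y) * (h n \<alpha> x - c)) = (\<lambda>x. (x * h n \<alpha> x - c * x) - (y * h n \<alpha> x - y * c))"
    by (simp add: fun_eq_iff algebra_simps)
  then show ?thesis by (simp only:) (intro integrable_intros)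
qed

lemma integrable_rest: "integrable (gpd \<alpha>) (rest y)"
  unfolding rest_def[abs_def] by (intro integrable_intros)

lemma integrable_id_rest: "integrable (gpd \<alpha>) (\<lambda>x. (x - c) * rest y x)"
proof -
  have "(\<lambda>x. (x - c) * rest y x) = (\<lambda>x. (x - c) * (h n \<alpha> x - h n \<alpha> y) - slope n \<alpha> y * (x\<^sup>2 - (c + y) * x + c * y))"
    by (simp add: fun_eq_iff rest_def algebra_simps power2_eq_square)
  then show ?thesis by (simp only:) (intro integrable_cross integrable_intros)
qed

lemma trunc_nonneg_strict:
  assumes int: "integrable (gpd \<alpha>) f" and "0 < y"
    and nonneg: "\<And>x. 0 < x \<Longrightarrow> x < y \<Longrightarrow> 0 \<le> f x" and pos: "\<And>x. 0 < x \<Longrightarrow> x < y \<Longrightarrow> x \<noteq> c \<Longrightarrow> f x \<noteq> 0"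
  shows "0 < trunc y f"
proof -
  have ae: "AE x in gpd \<alpha>. 0 \<le> indicator {..y} x * f x"
    using AE_gpd[of \<alpha>] AE_gpd_neq[of y \<alpha>]
    by eventually_elim (auto simp: support nonneg split: split_indicator)
  then have "0 \<le> trunc y f"
    unfolding trunc_def by (rule integral_nonneg_AE)
  moreover have "trunc y f \<noteq> 0"
  proof
    assume "trunc y f = 0"
    then have "AE x in gpd \<alpha>. indicator {..y} x * f x = 0"
      using integral_nonneg_eq_0_iff_AE[OF integrable_trunc[OF int] ae] by (simp add: trunc_def)
    then have "AE x in gpd \<alpha>. indicator {..y} x * f x = 0 \<and> x \<noteq> c"
      using AE_gpd_neq[of c \<alpha>] by eventually_elim simp
    then obtain x where "0 < x" "x < y" "indicator {..y} x * f x = 0" "x \<noteq> c"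
      using gpd_charges[OF _ \<open>0 < y\<close>] by blast
    then show False using pos[of x] by simp
  qed
  ultimately show ?thesis by simp
qed

lemma B_pos: "0 < y \<Longrightarrow> 0 < B y"
  unfolding B_def by (rule trunc_nonneg_strict[where c = y]) (auto intro: integrable_quadratic)

lemma slope_eq:
  assumes "0 \<le> y"
  shows "slope n \<alpha> y = trunc y (\<lambda>x. (x - y) * (h n \<alpha> x - h n \<alpha> y)) / B y"
  unfolding slope_def B_def using assms
  by (simp add: trunc_integral[OF integrable_cross] trunc_integral[OF integrable_quadratic])

lemma Z_eq: "0 \<le> y \<Longrightarrow> Z_fun n \<alpha> y = trunc y (rest y)"
  unfolding Z_fun_def using trunc_integral[OF integrable_rest, of y] by (simp add: rest_def)

text \<open>The normal equation of the fit. As the line is pinned at y, it yields this single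
  relation; orthogonality to constants is the extra equation
  \<open>Z_fun n \<alpha> y = 0\<close>.\<close>

lemma rest_orthogonal:
  assumes "0 < y"
  shows "trunc y (\<lambda>x. (x - y) * rest y x) = 0"
proof -
  have "(\<lambda>x. (x - y) * rest y x) =
      (\<lambda>x. (x - y) * (h n \<alpha> x - h n \<alpha> y) - slope n \<alpha> y * (x - y)\<^sup>2)"
    by (simp add: fun_eq_iff rest_def algebra_simps power2_eq_square)
  then have "trunc y (\<lambda>x. (x - y) * rest y x) =
      trunc y (\<lambda>x. (x - y) * (h n \<alpha> x - h n \<alpha> y)) - slope n \<alpha> y * B y"
    unfolding B_def by (simp add: trunc_diff trunc_cmult integrable_cross integrable_quadratic)
  then show ?thesis
    using slope_eq[of y] B_pos[OF assms] assms by simp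
qed

lemma rest_deriv: "0 \<le> x \<Longrightarrow> (rest y has_real_derivative (h_deriv n \<alpha> x - slope n \<alpha> y)) (at x)"
  unfolding rest_def by (auto intro!: derivative_eq_intros h_DERIV)

lemma rest_MVT:
  assumes "0 \<le> x" "x < z"
  obtains u where "x < u" "u < z" "rest y z - rest y x = (z - x) * (h_deriv n \<alpha> u - slope n \<alpha> y)"
  using MVT2[OF assms(2), of "rest y" "\<lambda>u. h_deriv n \<alpha> u - slope n \<alpha> y"] rest_deriv assms(1)
  by (metis order_trans)

text \<open>If the fitted line is not steeper than \<open>h n \<alpha>\<close> at \<open>y\<close>, the residual changes sign at most once,
  from plus to minus; being orthogonal to \<open>x - y\<close>, it must have negative integral.\<close>

lemma Z_neg:
  assumes y: "0 < y" and slope: "slope n \<alpha> y \<le> h_deriv n \<alpha> y"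
  shows "Z_fun n \<alpha> y < 0"
proof -
  let ?l = "slope n \<alpha> y" and ?r = "rest y"
  \<comment> \<open>From \<open>x1\<close> to \<open>y\<close> the residual does not rise, so
    \<open>h_deriv\<close> is at most \<open>?l\<close> somewhere in between, while it is at least
    \<open>?l\<close> at \<open>y\<close>. Strict quasiconcavity puts it below \<open>?l\<close> at
    all earlier points, so \<open>?r\<close> decreases before \<open>x1\<close>.\<close>
  have left: "0 < ?r x" if x: "0 < x" "x < x1" and x1: "x1 < y" "0 \<le> ?r x1" for x x1
  proof -
    obtain u where u: "x1 < u" "u < y" "?r y - ?r x1 = (y - x1) * (h_deriv n \<alpha> u - ?l)"
      using rest_MVT[of x1 y y] x x1 by (metis less_imp_le less_trans)
    then have "(y - x1) * (h_deriv n \<alpha> u - ?l) \<le> 0" using x1(2) by simp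
    then have hu: "h_deriv n \<alpha> u \<le> ?l" using x1(1) by (simp add: mult_le_0_iff)
    obtain v where v: "x < v" "v < x1" "?r x1 - ?r x = (x1 - x) * (h_deriv n \<alpha> v - ?l)"
      using rest_MVT[of x x1 y] x by (metis less_imp_le)
    have "min (h_deriv n \<alpha> v) (h_deriv n \<alpha> y) < h_deriv n \<alpha> u"
      using v u x by (intro h_deriv_quasi_concave) auto
    with hu slope have "h_deriv n \<alpha> v < ?l" by auto
    then have "(x1 - x) * (h_deriv n \<alpha> v - ?l) < 0"
      using x by (intro mult_pos_neg) auto
    with v(3) x1(2) show ?thesis by linarith
  qed
  define A where "A = {x. 0 < x \<and> x < y \<and> 0 \<le> ?r x}"
  \<comment> \<open>The point of the sign change from plus to minus; 0 stands for a residual that is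
    negative throughout.\<close>
  define c where "c = (if A = {} then 0 else Sup A)"
  have bdd: "bdd_above A" by (auto simp: A_def intro!: bdd_aboveI[of _ y])
  have "c \<le> y"
    unfolding c_def using y by (auto simp: A_def intro!: cSup_least)
  have below: "0 < ?r x" if x: "0 < x" "x < c" for x
  proof -
    have "A \<noteq> {}" "x < Sup A" using x by (auto simp: c_def split: if_splits)
    then obtain x1 where "x1 \<in> A" "x < x1" using less_cSup_iff[OF _ bdd] by auto
    then show ?thesis using left x by (auto simp: A_def)
  qed
  have above: "?r x < 0" if x: "0 < x" "c < x" "x < y" for x
  proof (rule ccontr)
    assume "\<not> ?r x < 0"
    then have "x \<in> A" using x by (simp add: A_def)
    then have "x \<le> c" using cSup_upper[OF _ bdd] by (auto simp: c_def)
    with x show False by simp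
  qed
  \<comment> \<open>Since \<open>?r\<close> is orthogonal to \<open>x - y\<close>, the factor
    \<open>x - c\<close> acts like the constant \<open>y - c\<close>, so this integral decides the
    sign of \<open>Z_fun\<close>.\<close>
  have "0 < trunc y (\<lambda>x. (- 1) * ((x - c) * ?r x))"
  proof (rule trunc_nonneg_strict[where c = c, OF _ y])
    show "integrable (gpd \<alpha>) (\<lambda>x. (- 1) * ((x - c) * ?r x))"
      by (intro integrable_mult_right integrable_id_rest)
    have pos: "0 < (- 1) * ((x - c) * ?r x)" if "0 < x" "x < y" "x \<noteq> c" for x
    proof (cases "x < c")
      case True
      have "(x - c) * ?r x < 0" using below that True by (intro mult_neg_pos) auto
      then show ?thesis by linarith
    next
      case False
      have "(x - c) * ?r x < 0" using above that False by (intro mult_pos_neg) auto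
      then show ?thesis by linarith
    qed
    show "0 \<le> (- 1) * ((x - c) * ?r x)" if "0 < x" "x < y" for x
      using pos[OF that] by (cases "x = c") auto
    show "(- 1) * ((x - c) * ?r x) \<noteq> 0" if "0 < x" "x < y" "x \<noteq> c" for x
      using pos[OF that] by auto
  qed
  then have "trunc y (\<lambda>x. (x - c) * ?r x) < 0"
    unfolding trunc_cmult by simp
  also have "(\<lambda>x. (x - c) * ?r x) = (\<lambda>x. (x - y) * ?r x + (y - c) * ?r x)"
    by (simp add: fun_eq_iff algebra_simps)
  also have "trunc y \<dots> = (y - c) * trunc y ?r"
    using rest_orthogonal[OF y]
    by (simp add: trunc_add trunc_cmult integrable_id_rest integrable_rest)
  finally show ?thesis
    using \<open>c \<le> y\<close> y by (auto simp: Z_eq mult_less_0_iff)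
qed

text \<open>\<open>h_deriv\<close> is largest at \<open>mode\<close>. Were the line steeper than
  that, the residual would decrease to 0 at \<open>mode\<close> and be positive before it, against
  its orthogonality to \<open>x - mode\<close>; so \<open>Z_neg\<close> applies.\<close>

lemma Z_neg_mode: "Z_fun n \<alpha> mode < 0"
proof (rule Z_neg[OF mode_pos], rule ccontr)
  let ?l = "slope n \<alpha> mode" and ?r = "rest mode"
  assume "\<not> ?l \<le> h_deriv n \<alpha> mode"
  have pos: "0 < ?r x" if x: "0 < x" "x < mode" for x
  proof -
    obtain u where u: "x < u" "u < mode" "?r mode - ?r x = (mode - x) * (h_deriv n \<alpha> u - ?l)"
      using rest_MVT[of x mode mode] x by (metis less_imp_le)
    have "h_deriv n \<alpha> u < h_deriv n \<alpha> mode"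
      using u x by (intro h_deriv_less_before_mode) auto
    then have "(mode - x) * (h_deriv n \<alpha> u - ?l) < 0"
      using x \<open>\<not> ?l \<le> h_deriv n \<alpha> mode\<close> by (intro mult_pos_neg) auto
    with u(3) show ?thesis by simp
  qed
  have "0 < trunc mode (\<lambda>x. (- 1) * ((x - mode) * ?r x))"
  proof (rule trunc_nonneg_strict[where c = mode, OF _ mode_pos])
    show "integrable (gpd \<alpha>) (\<lambda>x. (- 1) * ((x - mode) * ?r x))"
      by (intro integrable_mult_right integrable_id_rest)
    have neg: "(x - mode) * ?r x < 0" if "0 < x" "x < mode" for x
      using pos[OF that] that by (intro mult_neg_pos) auto
    show "0 \<le> (- 1) * ((x - mode) * ?r x)" "(- 1) * ((x - mode) * ?r x) \<noteq> 0" if "0 < x" "x < mode" for x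
      using neg[OF that] by auto
  qed
  then show False
    unfolding trunc_cmult rest_orthogonal[OF mode_pos] by simp
qed

abbreviation "m0 y \<equiv> trunc y (\<lambda>_. 1)"
abbreviation "m1 y \<equiv> trunc y (\<lambda>x. x)"
abbreviation "m2 y \<equiv> trunc y (\<lambda>x. x\<^sup>2)"
abbreviation "k0 y \<equiv> trunc y (h n \<alpha>)"
abbreviation "k1 y \<equiv> trunc y (\<lambda>x. x * h n \<alpha> x)"

lemmas trunc_simps = trunc_add trunc_diff trunc_cmult integrable_intros

lemma B_moments: "B y = m2 y - 2 * y * m1 y + y\<^sup>2 * m0 y"
proof -
  have "(\<lambda>x. (x - y)\<^sup>2) = (\<lambda>x. (x\<^sup>2 - (2 * y) * x) + y\<^sup>2 * 1)"
    by (simp add: fun_eq_iff power2_diff)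
  then show ?thesis unfolding B_def by (simp only: trunc_simps)
qed

lemma cross_moments:
  "trunc y (\<lambda>x. (x - y) * (h n \<alpha> x - c)) = (k1 y - c * m1 y) - (y * k0 y - (y * c) * m0 y)"
proof -
  have "(\<lambda>x. (x - y) * (h n \<alpha> x - c)) = (\<lambda>x. (x * h n \<alpha> x - c * x) - (y * h n \<alpha> x - (y * c) * 1))"
    by (simp add: fun_eq_iff algebra_simps)
  then show ?thesis by (simp only: trunc_simps)
qed

lemma rest_moments:
  "trunc y (rest y) = (k0 y - h n \<alpha> y * m0 y) - slope n \<alpha> y * (m1 y - y * m0 y)"
proof -
  have "rest y = (\<lambda>x. (h n \<alpha> x - h n \<alpha> y * 1) - slope n \<alpha> y * (x - y * 1))"
    by (simp add: fun_eq_iff rest_def)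
  then show ?thesis by (simp only: trunc_simps)
qed

text \<open>In terms of \<open>h n \<alpha> y\<close> and truncated moments, all continuous in y,
  \<open>Z_fun\<close> is a rational expression whose denominator \<open>B y\<close> is positive for
  y > 0.\<close>

lemma Z_continuous:
  assumes "0 < a"
  shows "continuous_on {a..c} (Z_fun n \<alpha>)"
proof -
  have cont: "continuous_on {a..c} (\<lambda>y. trunc y f)"
    if "integrable (gpd \<alpha>) f" "f \<in> borel_measurable borel" for f
    using trunc_continuous[OF that, of c] by (rule continuous_on_subset) (use assms in auto)
  have ch: "continuous_on {a..c} (h n \<alpha>)"
    using assms by (intro continuous_at_imp_continuous_on ballI DERIV_isCont[OF h_DERIV]) auto
  have "continuous_on {a..c} (\<lambda>y. (k0 y - h n \<alpha> y * m0 y) -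
      ((k1 y - h n \<alpha> y * m1 y) - (y * k0 y - (y * h n \<alpha> y) * m0 y)) /
        (m2 y - 2 * y * m1 y + y\<^sup>2 * m0 y) * (m1 y - y * m0 y))"
  proof (intro continuous_intros cont ch integrable_intros)
    show "\<forall>y\<in>{a..c}. m2 y - 2 * y * m1 y + y\<^sup>2 * m0 y \<noteq> 0"
      unfolding B_moments[symmetric]
    proof
      fix y assume "y \<in> {a..c}"
      then have "0 < B y" using assms by (intro B_pos) auto
      then show "B y \<noteq> 0" by simp
    qed
  qed measurable
  then show ?thesis
    by (rule continuous_on_cong[THEN iffD1, rotated -1])
      (use assms in \<open>auto simp: Z_eq rest_moments slope_eq cross_moments B_moments\<close>)
qed

text \<open>On the hazard scale x grows exponentially, as \<alpha> < 0, while
  \<open>h n \<alpha>\<close> is a polynomial.\<close>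

lemma h_over_id_tendsto: "((\<lambda>y. h n \<alpha> y / y) \<longlongrightarrow> 0) at_top"
proof -
  let ?\<beta> = "- \<alpha>"
  have \<beta>: "0 < ?\<beta>" using \<alpha> by simp
  have top: "filterlim (hazard \<alpha>) at_top at_top"
  proof -
    have "filterlim (\<lambda>x. ln (1 + ?\<beta> * x) * (1 / ?\<beta>)) at_top at_top"
      using \<beta> by (intro filterlim_at_top_mult_tendsto_pos[OF tendsto_const]
        filterlim_compose[OF ln_at_top] filterlim_tendsto_add_at_top[OF tendsto_const]
        filterlim_tendsto_pos_mult_at_top[OF tendsto_const] filterlim_ident) auto
    moreover have "(\<lambda>x. ln (1 + ?\<beta> * x) * (1 / ?\<beta>)) = hazard \<alpha>"
      using \<alpha> by (auto simp: hazard_def fun_eq_iff)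
    ultimately show ?thesis by simp
  qed
  have "((\<lambda>s :: real. s ^ n / exp s) \<longlongrightarrow> 0) at_top"
    by (rule tendsto_power_div_exp_0)
  then have "((\<lambda>t. (?\<beta> * t) ^ n / exp (?\<beta> * t)) \<longlongrightarrow> 0) at_top"
    by (rule filterlim_compose) (intro filterlim_tendsto_pos_mult_at_top[OF tendsto_const \<beta>] filterlim_ident)
  then have "((\<lambda>y. (?\<beta> * hazard \<alpha> y) ^ n / exp (?\<beta> * hazard \<alpha> y)) \<longlongrightarrow> 0) at_top"
    by (rule filterlim_compose[OF _ top])
  then have "((\<lambda>y. (1 / (?\<beta> ^ n * fact n)) * ((?\<beta> * hazard \<alpha> y) ^ n / exp (?\<beta> * hazard \<alpha> y)) * (inverse y + ?\<beta>)
      - inverse y) \<longlongrightarrow> (1 / (?\<beta> ^ n * fact n)) * 0 * (0 + ?\<beta>) - 0) at_top"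
    by (intro tendsto_intros tendsto_inverse_0_at_top filterlim_ident)
  moreover have "eventually (\<lambda>y. (1 / (?\<beta> ^ n * fact n)) * ((?\<beta> * hazard \<alpha> y) ^ n / exp (?\<beta> * hazard \<alpha> y)) * (inverse y + ?\<beta>)
      - inverse y = h n \<alpha> y / y) at_top"
    using eventually_gt_at_top[of "0 :: real"]
  proof eventually_elim
    case (elim y)
    have d: "0 < 1 - \<alpha> * y" using dom[of y] elim by simp
    have e: "exp (?\<beta> * hazard \<alpha> y) = 1 + ?\<beta> * y"
      using exp_hazard[OF d] d by (simp add: exp_minus)
    have p: "(?\<beta> * hazard \<alpha> y) ^ n = ?\<beta> ^ n * hazard \<alpha> y ^ n" by (simp only: power_mult_distrib)
    have "(inverse y + ?\<beta>) / (1 + ?\<beta> * y) = inverse y"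
      using d elim by (simp add: field_simps)
    then have "(1 / (?\<beta> ^ n * fact n)) * ((?\<beta> ^ n * hazard \<alpha> y ^ n) / (1 + ?\<beta> * y)) * (inverse y + ?\<beta>) =
        (1 / (?\<beta> ^ n * fact n)) * (?\<beta> ^ n * hazard \<alpha> y ^ n) * inverse y"
      by (metis (no_types, opaque_lifting) mult.assoc times_divide_eq_left times_divide_eq_right)
    also have "\<dots> = hazard \<alpha> y ^ n / fact n * inverse y"
      using \<alpha> by simp
    finally show ?case
      unfolding e p h_eq[OF d] by (simp add: divide_inverse left_diff_distrib)
  qed
  ultimately show ?thesis
    using filterlim_cong[OF refl refl] by fastforce
qed

text \<open>Cancelling the leading terms of \<open>B y * Z_fun n \<alpha> y\<close> leaves \<open>y\<close> times the covariance of
  \<open>x\<close> and \<open>h n \<alpha> x\<close>, which is positive.\<close>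

lemma Z_pos_eventually: "eventually (\<lambda>y. 0 < Z_fun n \<alpha> y) at_top"
proof -
  interpret prob_space "gpd \<alpha>" by (rule prob_space_gpd)
  have cov: "0 < covariance n \<alpha>" using covariance_pos[of n \<alpha>] \<alpha> n by simp
  have lim: "((\<lambda>y. trunc y f) \<longlongrightarrow> I) at_top" if "has_bochner_integral (gpd \<alpha>) f I" for f I
    using trunc_tendsto[of f] that by (simp add: has_bochner_integral_iff)
  have \<alpha>1: "- 1 < \<alpha>" using \<alpha> by simp
  note l0 = lim[OF has_bochner_integral_const[of 1]]
    and l1 = lim[OF has_bochner_integral_gpd_id[OF \<alpha>1]] and l2 = lim[OF has_bochner_integral_gpd_square[OF \<alpha>(1)]]
    and lk0 = lim[OF has_bochner_integral_h[of \<alpha> n]] and lk1 = lim[OF has_bochner_integral_id_times_h[OF \<alpha>1, of n]]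
  have inv: "((\<lambda>y :: real. inverse y) \<longlongrightarrow> 0) at_top"
    by (intro tendsto_inverse_0_at_top filterlim_ident)
  \<comment> \<open>This is \<open>B y * Z_fun n \<alpha> y / y\<close>. In the limit only
    \<open>m0 y * k1 y\<close> survives, because \<open>k0 y\<close>,
    \<open>h n \<alpha> y / y\<close> and \<open>inverse y\<close> tend to 0.\<close>
  have "((\<lambda>y. (m0 y * k1 y - m1 y * k0 y) - (h n \<alpha> y / y) * (m0 y * m2 y - (m1 y)\<^sup>2) +
      (k0 y * m2 y - m1 y * k1 y) * inverse y) \<longlongrightarrow>
      (1 * covariance n \<alpha> - 1 / (1 + \<alpha>) * 0) - 0 * (1 * (2 / ((1 + \<alpha>) * (1 + 2 * \<alpha>))) - (1 / (1 + \<alpha>))\<^sup>2) +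
      (0 * (2 / ((1 + \<alpha>) * (1 + 2 * \<alpha>))) - 1 / (1 + \<alpha>) * covariance n \<alpha>) * 0) at_top"
    by (intro tendsto_intros l0 l1 l2 lk0 lk1 h_over_id_tendsto inv)
  then have "((\<lambda>y. (m0 y * k1 y - m1 y * k0 y) - (h n \<alpha> y / y) * (m0 y * m2 y - (m1 y)\<^sup>2) +
      (k0 y * m2 y - m1 y * k1 y) * inverse y) \<longlongrightarrow> covariance n \<alpha>) at_top"
    by simp
  from order_tendstoD(1)[OF this cov] show ?thesis
    using eventually_gt_at_top[of "0 :: real"]
  proof eventually_elim
    case (elim y)
    let ?q = "(m0 y * k1 y - m1 y * k0 y) - (h n \<alpha> y / y) * (m0 y * m2 y - (m1 y)\<^sup>2) +
      (k0 y * m2 y - m1 y * k1 y) * inverse y"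
    have "B y * slope n \<alpha> y = (k1 y - h n \<alpha> y * m1 y) - (y * k0 y - (y * h n \<alpha> y) * m0 y)"
      using elim B_pos[of y] by (simp only: slope_eq cross_moments) simp
    moreover have "B y * Z_fun n \<alpha> y = B y * (k0 y - h n \<alpha> y * m0 y) - (B y * slope n \<alpha> y) * (m1 y - y * m0 y)"
      using elim by (simp only: Z_eq rest_moments right_diff_distrib mult.assoc)
    ultimately have "B y * Z_fun n \<alpha> y = B y * (k0 y - h n \<alpha> y * m0 y) -
        ((k1 y - h n \<alpha> y * m1 y) - (y * k0 y - (y * h n \<alpha> y) * m0 y)) * (m1 y - y * m0 y)"
      by (simp only:)
    also have "\<dots> = y * (m0 y * k1 y - m1 y * k0 y) - h n \<alpha> y * (m0 y * m2 y - (m1 y)\<^sup>2) +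
      (k0 y * m2 y - m1 y * k1 y)"
      unfolding B_moments by (simp add: algebra_simps power2_eq_square)
    also have "\<dots> = y * ?q"
      using elim by (simp add: field_simps)
    finally have "0 < B y * Z_fun n \<alpha> y"
      using elim by simp
    then show ?case
      using B_pos[of y] elim by (simp add: zero_less_mult_iff)
  qed
qed

lemma slope_greater:
  assumes "0 < y" "0 \<le> Z_fun n \<alpha> y"
  shows "h_deriv n \<alpha> y < slope n \<alpha> y"
  using Z_neg[of y] assms by (meson not_le)

lemma Y_set_eq: "Y_set n \<alpha> = {y. mode < y \<and> Z_fun n \<alpha> y = 0}"
proof -
  have "0 \<le> Y_fun n \<alpha> y" if y: "mode < y" "Z_fun n \<alpha> y = 0" for y
  proof -
    have "0 < y" using y mode_pos by simp
    then have "deriv (h n \<alpha>) y = h_deriv n \<alpha> y"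
      by (intro DERIV_imp_deriv h_DERIV) simp
    then show ?thesis
      using slope_greater[of y] y \<open>0 < y\<close> by (simp add: Y_fun_def)
  qed
  then show ?thesis
    unfolding Y_set_def inflection_point_eq by auto
qed

lemma Y_set_nonempty: "Y_set n \<alpha> \<noteq> {}"
proof -
  obtain z where z: "mode < z" "0 < Z_fun n \<alpha> z"
    using eventually_happens[OF eventually_conj[OF Z_pos_eventually eventually_gt_at_top[of mode]]] by auto
  obtain y where "mode \<le> y" "y \<le> z" "Z_fun n \<alpha> y = 0"
    using IVT'[of "Z_fun n \<alpha>" mode 0 z] Z_continuous[OF mode_pos] Z_neg_mode z by auto
  moreover from this have "y \<noteq> mode" using Z_neg_mode by auto
  ultimately show ?thesis
    unfolding Y_set_eq by fastforce
qed

text \<open>The zeros between \<open>mode\<close> and any fixed zero form a compact set, so there is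
  a least one; it is not \<open>mode\<close> itself, where \<open>Z_fun\<close> is negative.\<close>

lemma y_star_in: "y_star n \<alpha> \<in> Y_set n \<alpha>"
proof -
  obtain z where z: "mode < z" "Z_fun n \<alpha> z = 0"
    using Y_set_nonempty unfolding Y_set_eq by auto
  define K where "K = {y \<in> {mode..z}. Z_fun n \<alpha> y = 0}"
  have "closed K"
    unfolding K_def using continuous_closed_preimage_constant[OF Z_continuous[OF mode_pos]] by simp
  then have "compact K"
    using compact_Int_closed[of "{mode..z}" K] by (simp add: K_def Int_def conj_commute cong: conj_cong)
  moreover have "z \<in> K" using z by (simp add: K_def)
  ultimately obtain k where k: "k \<in> K" "\<And>y. y \<in> K \<Longrightarrow> k \<le> y"
    using compact_attains_inf[of K] by blast
  have "k \<noteq> mode" using k(1) Z_neg_mode by (auto simp: K_def)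
  then have "k \<in> Y_set n \<alpha>" using k(1) by (auto simp: K_def Y_set_eq)
  moreover have "k \<le> y" if "y \<in> Y_set n \<alpha>" for y
  proof (cases "y \<le> z")
    case True
    then show ?thesis using that k(2)[of y] by (auto simp: K_def Y_set_eq)
  next
    case False
    then show ?thesis using k(2)[OF \<open>z \<in> K\<close>] by simp
  qed
  ultimately have "y_star n \<alpha> = k"
    unfolding y_star_def by (rule cInf_eq_minimum)
  with \<open>k \<in> Y_set n \<alpha>\<close> show ?thesis by simp
qed

end

lemma exp_sum_deriv:
  "((\<lambda>t. exp (- t) * (\<Sum>i\<le>n. t ^ i / fact i)) has_real_derivative - (exp (- t) * (t ^ n / fact n))) (at t)"
proof (induction n)
  case 0
  show ?case by (auto intro!: derivative_eq_intros)
next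
  case (Suc n)
  have "((\<lambda>t. t ^ Suc n / fact (Suc n)) has_real_derivative (1 + real n) * (1 * t ^ n) / fact (Suc n)) (at t)"
    by (intro DERIV_cdivide DERIV_power_Suc DERIV_ident)
  also have "(1 + real n) * (1 * t ^ n) / fact (Suc n) = t ^ n / fact n"
    unfolding fact_Suc by (simp add: divide_simps)
  finally have p: "((\<lambda>t. t ^ Suc n / fact (Suc n)) has_real_derivative t ^ n / fact n) (at t)" .
  have e: "((\<lambda>t. exp (- t)) has_real_derivative - exp (- t)) (at t)"
    by (auto intro!: derivative_eq_intros)
  have "((\<lambda>t. exp (- t) * (\<Sum>i\<le>n. t ^ i / fact i) + exp (- t) * (t ^ Suc n / fact (Suc n))) has_real_derivative
      - (exp (- t) * (t ^ n / fact n)) + (- exp (- t) * (t ^ Suc n / fact (Suc n)) + t ^ n / fact n * exp (- t))) (at t)"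
    by (rule DERIV_add[OF Suc.IH DERIV_mult[OF e p]])
  then show ?case
    by (simp add: distrib_left mult.commute del: power_Suc fact_Suc)
qed

context negative_parameter
begin

section \<open>The closed form of the bound\<close>

lemma trunc_FTC:
  assumes "integrable (gpd \<alpha>) f" "f \<in> borel_measurable borel" "0 \<le> y"
    and deriv: "\<And>x. 0 \<le> x \<Longrightarrow> x \<le> y \<Longrightarrow> (F has_real_derivative f x * w \<alpha> x) (at x)"
  shows "trunc y f = F y - F 0"
proof -
  have "((\<lambda>x. f x * w \<alpha> x) has_integral F y - F 0) {0..y}"
  proof (rule fundamental_theorem_of_calculus[OF assms(3)])
    fix x assume "x \<in> {0..y}"
    then have "(F has_real_derivative f x * w \<alpha> x) (at x)" by (intro deriv) auto
    then show "(F has_vector_derivative f x * w \<alpha> x) (at x within {0..y})"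
      unfolding has_real_derivative_iff_has_vector_derivative[symmetric] by (rule DERIV_subset) simp
  qed
  then show ?thesis
    using trunc_has_integral[OF assms(1-3)] by (rule has_integral_unique[rotated])
qed

text \<open>\<open>W1\<close> and \<open>W2\<close> are the iterated integrals of
  \<open>W \<alpha>\<close> from 0; by parts, the truncated moments of \<open>y - x\<close> and of
  its square are \<open>W1 y\<close> and \<open>2 * W2 y\<close>.\<close>

definition W1 where "W1 x = x - (1 - (1 - \<alpha> * x) powr (1 / \<alpha> + 1)) / (1 + \<alpha>)"

definition W2 where
  "W2 x = x\<^sup>2 / 2 - x / (1 + \<alpha>) + (1 - (1 - \<alpha> * x) powr (1 / \<alpha> + 2)) / ((1 + \<alpha>) * (1 + 2 * \<alpha>))"

lemma powr_deriv:
  assumes "0 \<le> x"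
  shows "((\<lambda>x. (1 - \<alpha> * x) powr r) has_real_derivative - \<alpha> * r * (1 - \<alpha> * x) powr (r - 1)) (at x)"
proof -
  have "((\<lambda>x. 1 - \<alpha> * x) has_real_derivative - \<alpha>) (at x)"
    by (auto intro!: derivative_eq_intros)
  from DERIV_fun_powr[OF this dom[OF assms], of r] show ?thesis
    by (simp add: mult_ac)
qed

lemma W1_deriv: "0 \<le> x \<Longrightarrow> (W1 has_real_derivative W \<alpha> x) (at x)"
proof -
  assume x: "0 \<le> x"
  have "(W1 has_real_derivative 1 - (0 - - \<alpha> * (1 / \<alpha> + 1) * (1 - \<alpha> * x) powr (1 / \<alpha> + 1 - 1)) / (1 + \<alpha>)) (at x)"
    unfolding W1_def by (intro DERIV_diff DERIV_cdivide powr_deriv x DERIV_ident DERIV_const)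
  moreover have "- \<alpha> * (1 / \<alpha> + 1) = - (1 + \<alpha>)" using \<alpha> by (simp add: field_simps)
  moreover have "1 - (0 - - (1 + \<alpha>) * p) / (1 + \<alpha>) = 1 - p" for p
    using \<alpha> by (simp add: divide_simps) (simp add: algebra_simps)
  ultimately have "(W1 has_real_derivative 1 - (1 - \<alpha> * x) powr (1 / \<alpha> + 1 - 1)) (at x)"
    by (simp only:)
  then show ?thesis
    using \<alpha> by (simp add: W_def)
qed

lemma W2_deriv: "0 \<le> x \<Longrightarrow> (W2 has_real_derivative W1 x) (at x)"
proof -
  assume x: "0 \<le> x"
  have "((\<lambda>x :: real. x\<^sup>2 / 2) has_real_derivative x) (at x)"
    by (auto intro!: derivative_eq_intros)
  then have "(W2 has_real_derivative x - 1 / (1 + \<alpha>) +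
      (0 - - \<alpha> * (1 / \<alpha> + 2) * (1 - \<alpha> * x) powr (1 / \<alpha> + 2 - 1)) / ((1 + \<alpha>) * (1 + 2 * \<alpha>))) (at x)"
    unfolding W2_def by (intro DERIV_add DERIV_diff DERIV_cdivide powr_deriv x DERIV_ident DERIV_const)
  moreover have "- \<alpha> * (1 / \<alpha> + 2) = - (1 + 2 * \<alpha>)" using \<alpha> by (simp add: field_simps)
  moreover have "x - 1 / (1 + \<alpha>) + (0 - - (1 + 2 * \<alpha>) * p) / ((1 + \<alpha>) * (1 + 2 * \<alpha>)) =
      x - (1 - p) / (1 + \<alpha>)" for p
  proof -
    have "1 + \<alpha> \<noteq> 0" "1 + 2 * \<alpha> \<noteq> 0" using \<alpha> by auto
    then show ?thesis by (simp add: divide_simps) (simp add: algebra_simps)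
  qed
  moreover have "1 / \<alpha> + 2 - 1 = 1 / \<alpha> + 1" by simp
  ultimately have "(W2 has_real_derivative x - (1 - (1 - \<alpha> * x) powr (1 / \<alpha> + 1)) / (1 + \<alpha>)) (at x)"
    by (simp only:)
  then show ?thesis
    by (simp add: W1_def)
qed

lemma m0_eq: "0 \<le> y \<Longrightarrow> m0 y = W \<alpha> y"
  using trunc_FTC[of "\<lambda>_. 1" y "W \<alpha>"] by (auto intro: integrable_one W_has_derivative dom)

lemma trunc_linear: "0 \<le> y \<Longrightarrow> trunc y (\<lambda>x. y - x) = W1 y"
proof -
  assume y: "0 \<le> y"
  have "trunc y (\<lambda>x. y - x) = ((y - y) * W \<alpha> y + W1 y) - ((y - 0) * W \<alpha> 0 + W1 0)"
  proof (rule trunc_FTC[OF _ _ y])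
    show "integrable (gpd \<alpha>) (\<lambda>x. y - x)" by (intro integrable_intros)
    fix x assume x: "0 \<le> x" "x \<le> y"
    have "((\<lambda>x. (y - x) * W \<alpha> x + W1 x) has_real_derivative
        ((0 - 1) * W \<alpha> x + w \<alpha> x * (y - x)) + W \<alpha> x) (at x)"
      by (intro DERIV_add DERIV_mult DERIV_diff DERIV_const DERIV_ident W_has_derivative dom W1_deriv x)
    then show "((\<lambda>x. (y - x) * W \<alpha> x + W1 x) has_real_derivative (y - x) * w \<alpha> x) (at x)"
      by (simp add: mult.commute)
  qed measurable
  then show ?thesis by (simp add: W1_def)
qed

lemma B_eq: "0 \<le> y \<Longrightarrow> B y = 2 * W2 y"
proof -
  assume y: "0 \<le> y"
  have "B y = ((y - y) * ((y - y) * W \<alpha> y) + 2 * ((y - y) * W1 y + W2 y)) -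
      ((y - 0) * ((y - 0) * W \<alpha> 0) + 2 * ((y - 0) * W1 0 + W2 0))"
    unfolding B_def
  proof (rule trunc_FTC[OF integrable_quadratic _ y])
    fix x assume x: "0 \<le> x" "x \<le> y"
    have "((\<lambda>x. (y - x) * ((y - x) * W \<alpha> x) + 2 * ((y - x) * W1 x + W2 x)) has_real_derivative
        ((0 - 1) * ((y - x) * W \<alpha> x) + ((0 - 1) * W \<alpha> x + w \<alpha> x * (y - x)) * (y - x)) +
        2 * (((0 - 1) * W1 x + W \<alpha> x * (y - x)) + W1 x)) (at x)"
      by (intro DERIV_add DERIV_mult DERIV_cmult DERIV_diff DERIV_const DERIV_ident W_has_derivative dom
        W1_deriv W2_deriv x)
    then show "((\<lambda>x. (y - x) * ((y - x) * W \<alpha> x) + 2 * ((y - x) * W1 x + W2 x)) has_real_derivative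
        (x - y)\<^sup>2 * w \<alpha> x) (at x)"
      by (simp add: algebra_simps power2_eq_square)
  qed measurable
  then show ?thesis by (simp add: W1_def W2_def)
qed

lemma G_hat_deriv:
  assumes "0 \<le> x"
  shows "(G_hat 1 n \<alpha> has_real_derivative (h n \<alpha> x + 1) * w \<alpha> x) (at x)"
proof -
  have d: "0 < 1 - \<alpha> * x" using dom[OF assms] .
  have "((\<lambda>x. exp (- hazard \<alpha> x) * (\<Sum>i\<le>n. hazard \<alpha> x ^ i / fact i)) has_real_derivative
      - (exp (- hazard \<alpha> x) * (hazard \<alpha> x ^ n / fact n)) * (1 / (1 - \<alpha> * x))) (at x)"
    by (rule DERIV_chain2[OF exp_sum_deriv hazard_has_derivative[OF d]])
  then have "((\<lambda>x. 1 - exp (- hazard \<alpha> x) * (\<Sum>i\<le>n. hazard \<alpha> x ^ i / fact i)) has_real_derivative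
      0 - - (exp (- hazard \<alpha> x) * (hazard \<alpha> x ^ n / fact n)) * (1 / (1 - \<alpha> * x))) (at x)"
    by (intro DERIV_diff DERIV_const)
  also have "0 - - (exp (- hazard \<alpha> x) * (hazard \<alpha> x ^ n / fact n)) * (1 / (1 - \<alpha> * x)) = (h n \<alpha> x + 1) * w \<alpha> x"
    using d by (simp add: h_eq w_eq)
  finally show ?thesis using d G_hat_eq by (rule DERIV_transform_support)
qed

lemma integrable_weighted: "integrable (gpd \<alpha>) (\<lambda>x. (y - x) * (h n \<alpha> x + 1))"
proof -
  have "(\<lambda>x. (y - x) * (h n \<alpha> x + 1)) = (\<lambda>x. (- 1) * ((x - y) * (h n \<alpha> x - (- 1))))"
    by (simp add: fun_eq_iff algebra_simps)
  then show ?thesis by (simp only:) (intro integrable_mult_right integrable_cross)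
qed

text \<open>Integration by parts with \<open>(y - x) * G_hat 1 n \<alpha> x\<close>, which vanishes
  at both ends.\<close>

lemma trunc_G_hat:
  assumes y: "0 \<le> y"
  shows "trunc y (\<lambda>x. (y - x) * (h n \<alpha> x + 1)) = integral {0..y} (G_hat 1 n \<alpha>)"
proof -
  have "continuous_on {0..y} (G_hat 1 n \<alpha>)"
    by (intro continuous_at_imp_continuous_on ballI DERIV_isCont[OF G_hat_deriv]) auto
  then have "(G_hat 1 n \<alpha> has_integral integral {0..y} (G_hat 1 n \<alpha>)) {0..y}"
    by (intro integrable_integral integrable_continuous_real)
  with trunc_has_integral[OF integrable_weighted _ y]
  have "((\<lambda>x. (y - x) * (h n \<alpha> x + 1) * w \<alpha> x - G_hat 1 n \<alpha> x) has_integral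
      (trunc y (\<lambda>x. (y - x) * (h n \<alpha> x + 1)) - integral {0..y} (G_hat 1 n \<alpha>))) {0..y}"
    by (intro has_integral_diff) simp_all
  moreover have "((\<lambda>x. (y - x) * (h n \<alpha> x + 1) * w \<alpha> x - G_hat 1 n \<alpha> x) has_integral
      ((y - y) * G_hat 1 n \<alpha> y - (y - 0) * G_hat 1 n \<alpha> 0)) {0..y}"
  proof (rule fundamental_theorem_of_calculus[OF y])
    fix x assume x: "x \<in> {0..y}"
    have "((\<lambda>x. (y - x) * G_hat 1 n \<alpha> x) has_real_derivative
        (0 - 1) * G_hat 1 n \<alpha> x + ((h n \<alpha> x + 1) * w \<alpha> x) * (y - x)) (at x)"
      using x by (intro DERIV_mult DERIV_diff DERIV_const DERIV_ident G_hat_deriv) auto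
    then have "((\<lambda>x. (y - x) * G_hat 1 n \<alpha> x) has_real_derivative
        (y - x) * (h n \<alpha> x + 1) * w \<alpha> x - G_hat 1 n \<alpha> x) (at x)"
      by (simp add: mult_ac)
    then show "((\<lambda>x. (y - x) * G_hat 1 n \<alpha> x) has_vector_derivative
        (y - x) * (h n \<alpha> x + 1) * w \<alpha> x - G_hat 1 n \<alpha> x) (at x within {0..y})"
      unfolding has_real_derivative_iff_has_vector_derivative[symmetric] by (rule DERIV_subset) simp
  qed
  ultimately have "trunc y (\<lambda>x. (y - x) * (h n \<alpha> x + 1)) - integral {0..y} (G_hat 1 n \<alpha>) =
      (y - y) * G_hat 1 n \<alpha> y - (y - 0) * G_hat 1 n \<alpha> 0"
    by (rule has_integral_unique)
  moreover have "G_hat 1 n \<alpha> 0 = 0"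
    using G_hat_eq[of \<alpha> 0 n] by (simp add: sum.atMost_shift)
  ultimately show ?thesis by simp
qed

lemma slope_closed_form:
  assumes y: "0 < y"
  shows "slope n \<alpha> y = ((h n \<alpha> y + 1) * W1 y - integral {0..y} (G_hat 1 n \<alpha>)) / B y"
proof -
  have "(\<lambda>x. (x - y) * (h n \<alpha> x - h n \<alpha> y)) =
      (\<lambda>x. (h n \<alpha> y + 1) * (y - x) - (y - x) * (h n \<alpha> x + 1))"
    by (simp add: fun_eq_iff algebra_simps)
  then have "trunc y (\<lambda>x. (x - y) * (h n \<alpha> x - h n \<alpha> y)) =
      (h n \<alpha> y + 1) * trunc y (\<lambda>x. y - x) - trunc y (\<lambda>x. (y - x) * (h n \<alpha> x + 1))"
    by (simp only: trunc_simps integrable_weighted)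
  also have "\<dots> = (h n \<alpha> y + 1) * W1 y - integral {0..y} (G_hat 1 n \<alpha>)"
    using y by (simp add: trunc_linear trunc_G_hat)
  finally show ?thesis
    using y by (simp only: slope_eq less_imp_le)
qed

text \<open>The denominator of the closed form is
  \<open>(1 + \<alpha>) * (1 + 2 * \<alpha>) * B y\<close>, its recurring factor is
  \<open>(1 + \<alpha>) * W1 y\<close>, and the combination with the integral of
  \<open>G_hat\<close> is the numerator of \<open>slope\<close>.\<close>

lemma C_sq_eq:
  assumes y: "0 < y"
  shows "C_sq n \<alpha> y = (h n \<alpha> y)\<^sup>2 * W \<alpha> y + integral {y..} (\<lambda>x. (h n \<alpha> x)\<^sup>2 * w \<alpha> x)
    - 2 * h n \<alpha> y * slope n \<alpha> y * W1 y + (slope n \<alpha> y)\<^sup>2 * B y"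
proof -
  define c where "c = h n \<alpha> y"
  define A where "A = W1 y"
  define b where "b = B y"
  define I where "I = integral {0..y} (G_hat 1 n \<alpha>)"
  define q where "q = (1 + \<alpha>) * (1 + 2 * \<alpha>) * b"
  define T where "T = integral {y..} (\<lambda>x. (h n \<alpha> x)\<^sup>2 * w \<alpha> x)"
  have nz: "1 + \<alpha> \<noteq> 0" "1 + 2 * \<alpha> \<noteq> 0" using \<alpha> by auto
  have "b \<noteq> 0" using B_pos[OF y] by (simp add: b_def)
  have gy: "g_hat 1 n \<alpha> x = h n \<alpha> x + 1" for x by (simp add: h_def)
  have Q: "2 - 2 * (1 - \<alpha> * y) powr (1 / \<alpha> + 2) + y * (1 + 2 * \<alpha>) * (\<alpha> * y + y - 2) = q"
    unfolding q_def b_def B_eq[OF less_imp_le[OF y]] W2_def using nz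
    by (simp add: divide_simps) (simp add: algebra_simps power2_eq_square)
  have A1: "y * (1 + \<alpha>) - 1 + (1 - \<alpha> * y) powr (1 / \<alpha> + 1) = (1 + \<alpha>) * A"
    unfolding A_def W1_def using nz by (simp add: divide_simps)
  have A2: "1 - y * (1 + \<alpha>) - (1 - \<alpha> * y) powr (1 / \<alpha> + 1) = - ((1 + \<alpha>) * A)"
    using A1 by simp
  have w0: "1 - (1 - \<alpha> * y) powr (1 / \<alpha>) = W \<alpha> y"
    using \<alpha> by (simp add: W_def)
  have sl: "slope n \<alpha> y = ((c + 1) * A - I) / b"
    unfolding slope_closed_form[OF y] c_def A_def I_def b_def ..
  have "C_sq n \<alpha> y = W \<alpha> y * (c + 1 - 1)\<^sup>2 + T
      + 2 * (1 + 2 * \<alpha>) * (c + 1 - 1) * (- ((1 + \<alpha>) * A)) / q * ((c + 1) * ((1 + \<alpha>) * A / (1 + \<alpha>)) - I)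
      + (1 + 2 * \<alpha>) * ((1 + \<alpha>) * A * (c + 1) - (1 + \<alpha>) * I)\<^sup>2 / ((1 + \<alpha>) * q)"
    unfolding C_sq_def Let_def gy Q A1 A2 w0 c_def[symmetric] I_def[symmetric] T_def by simp
  also have "\<dots> = c\<^sup>2 * W \<alpha> y + T - 2 * c * (((c + 1) * A - I) / b) * A + (((c + 1) * A - I) / b)\<^sup>2 * b"
  proof -
    let ?D = "(c + 1) * A - I"
    have "2 * (1 + 2 * \<alpha>) * (c + 1 - 1) * (- ((1 + \<alpha>) * A)) / q * ((c + 1) * ((1 + \<alpha>) * A / (1 + \<alpha>)) - I) =
        - (2 * c * (?D / b) * A)"
      unfolding q_def using nz \<open>b \<noteq> 0\<close> by (simp add: divide_simps)
    moreover have "(1 + 2 * \<alpha>) * ((1 + \<alpha>) * A * (c + 1) - (1 + \<alpha>) * I)\<^sup>2 / ((1 + \<alpha>) * q) = (?D / b)\<^sup>2 * b"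
    proof -
      have "(1 + \<alpha>) * A * (c + 1) - (1 + \<alpha>) * I = (1 + \<alpha>) * ?D" by (simp add: algebra_simps)
      then show ?thesis
        unfolding q_def using nz \<open>b \<noteq> 0\<close> by (simp only:) (simp add: divide_simps power2_eq_square)
    qed
    ultimately show ?thesis by simp
  qed
  finally show ?thesis
    by (simp only: sl c_def[symmetric] A_def[symmetric] b_def[symmetric] T_def[symmetric])
qed

section \<open>The projection\<close>

definition ystar where "ystar = y_star n \<alpha>"

text \<open>As \<open>h n \<alpha>\<close> minus the truncated residual, it inherits the
  orthogonality relations of the residual literally; up to \<open>ystar\<close> it is the fitted
  line.\<close>

definition proj :: "real \<Rightarrow> real" where
  "proj x = h n \<alpha> x - indicator {..ystar} x * rest ystar x"

lemma ystar: "mode < ystar" "0 < ystar" "Z_fun n \<alpha> ystar = 0"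
  "h_deriv n \<alpha> ystar < slope n \<alpha> ystar"
  using y_star_in mode_pos slope_greater[of ystar] unfolding Y_set_eq ystar_def[symmetric] by auto

lemma measurable_proj [measurable]: "proj \<in> borel_measurable borel"
  unfolding proj_def by measurable

lemma proj_below: "x \<le> ystar \<Longrightarrow> proj x = h n \<alpha> ystar + slope n \<alpha> ystar * (x - ystar)"
  by (simp add: proj_def rest_def)

lemma proj_above: "ystar \<le> x \<Longrightarrow> proj x = h n \<alpha> x"
  by (cases "x = ystar") (simp_all add: proj_def)

abbreviation "res x \<equiv> indicator {..ystar} x * rest ystar x"

text \<open>This relation is where \<open>ystar\<close> being a zero of \<open>Z_fun\<close> enters;
  the next one, with the factor \<open>x - ystar\<close>, comes from the least-squares slope
  alone.\<close>

lemma res_0: "has_bochner_integral (gpd \<alpha>) res 0"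
  using ystar integrable_trunc[OF integrable_rest, of ystar ystar]
  by (simp add: has_bochner_integral_iff Z_eq trunc_def)

lemma res_id: "has_bochner_integral (gpd \<alpha>) (\<lambda>x. (x - ystar) * res x) 0"
  using rest_orthogonal[OF ystar(2)] integrable_trunc[OF integrable_id_rest, of ystar ystar ystar]
  by (simp add: has_bochner_integral_iff trunc_def mult_ac)

lemma res_affine: "has_bochner_integral (gpd \<alpha>) (\<lambda>x. (c + d * (x - ystar)) * res x) 0"
  using has_bochner_integral_add[OF has_bochner_integral_mult_right[OF res_0, of c]
    has_bochner_integral_mult_right[OF res_id, of d]]
  by (simp add: algebra_simps)

text \<open>The residual lives where \<open>proj\<close> is affine.\<close>

lemma proj_res: "has_bochner_integral (gpd \<alpha>) (\<lambda>x. proj x * res x) 0"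
proof -
  have "(\<lambda>x. proj x * res x) = (\<lambda>x. (h n \<alpha> ystar + slope n \<alpha> ystar * (x - ystar)) * res x)"
    by (auto simp: fun_eq_iff proj_below split: split_indicator)
  then show ?thesis using res_affine by (simp only:)
qed

text \<open>Negative values occur only before \<open>ystar\<close>, where the residual returns to 0.
  A pattern negative, nonnegative, negative, zero would make \<open>h_deriv\<close> exceed the
  slope, fall below it and exceed it again, against quasiconcavity.\<close>

lemma res_negative_between:
  assumes "0 < x1" "x1 < x2" "x2 < x3" "res x1 < 0" "res x3 < 0"
  shows "res x2 < 0"
proof (rule ccontr)
  let ?r = "rest ystar" and ?s = "slope n \<alpha> ystar"
  have x3: "x3 < ystar" "x2 < ystar" "x1 < ystar"
    using assms by (cases "x3 < ystar"; cases "x3 = ystar"; auto split: split_indicator_asm)+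
  assume "\<not> res x2 < 0"
  with assms x3 have r: "?r x1 < 0" "0 \<le> ?r x2" "?r x3 < 0" by auto
  obtain u1 where u1: "x1 < u1" "u1 < x2" "?r x2 - ?r x1 = (x2 - x1) * (h_deriv n \<alpha> u1 - ?s)"
    using rest_MVT[of x1 x2 ystar] assms by (metis less_imp_le)
  obtain u2 where u2: "x2 < u2" "u2 < x3" "?r x3 - ?r x2 = (x3 - x2) * (h_deriv n \<alpha> u2 - ?s)"
    using rest_MVT[of x2 x3 ystar] assms by (metis less_imp_le less_trans)
  obtain u3 where u3: "x3 < u3" "u3 < ystar" "?r ystar - ?r x3 = (ystar - x3) * (h_deriv n \<alpha> u3 - ?s)"
    using rest_MVT[of x3 ystar ystar] assms x3 by (metis less_imp_le less_trans)
  have "0 < (x2 - x1) * (h_deriv n \<alpha> u1 - ?s)" using u1(3) r by linarith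
  then have 1: "?s < h_deriv n \<alpha> u1" using assms(2) by (simp add: zero_less_mult_iff)
  have "(x3 - x2) * (h_deriv n \<alpha> u2 - ?s) < 0" using u2(3) r by linarith
  then have 2: "h_deriv n \<alpha> u2 < ?s" using assms(3) by (simp add: mult_less_0_iff)
  have "0 < (ystar - x3) * (h_deriv n \<alpha> u3 - ?s)" using u3(3) r by simp
  then have 3: "?s < h_deriv n \<alpha> u3" using x3 by (simp add: zero_less_mult_iff)
  have "min (h_deriv n \<alpha> u1) (h_deriv n \<alpha> u3) < h_deriv n \<alpha> u2"
    using u1 u2 u3 assms by (intro h_deriv_quasi_concave) auto
  with 1 2 3 show False by auto
qed

lemma has_integral_tail:
  assumes "0 < y"
  shows "((\<lambda>x. (h n \<alpha> x)\<^sup>2 * w \<alpha> x) has_integral (LINT x|gpd \<alpha>. indicator {y..} x * (h n \<alpha> x)\<^sup>2)) {y..}"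
proof -
  have "integrable (gpd \<alpha>) (\<lambda>x. indicator {y..} x * (h n \<alpha> x)\<^sup>2)"
    using integrable_mult_indicator[OF _ integrable_h_squared, of "{y..}" \<alpha> n] by simp
  then have "((\<lambda>x. indicator {y..} x * (h n \<alpha> x)\<^sup>2 * w \<alpha> x) has_integral
      (LINT x|gpd \<alpha>. indicator {y..} x * (h n \<alpha> x)\<^sup>2)) {0<..}"
    using has_integral_gpd[of \<alpha> "\<lambda>x. indicator {y..} x * (h n \<alpha> x)\<^sup>2"] unfolding support by simp
  also have "(\<lambda>x. indicator {y..} x * (h n \<alpha> x)\<^sup>2 * w \<alpha> x) = (\<lambda>x. if x \<in> {y..} then (h n \<alpha> x)\<^sup>2 * w \<alpha> x else 0)"
    by (auto split: split_indicator)
  finally have "((\<lambda>x. (h n \<alpha> x)\<^sup>2 * w \<alpha> x) has_integral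
      (LINT x|gpd \<alpha>. indicator {y..} x * (h n \<alpha> x)\<^sup>2)) ({y..} \<inter> {0<..})"
    by (simp only: has_integral_restrict_Int)
  moreover have "{y..} \<inter> {0<..} = {y..}" using assms by auto
  ultimately show ?thesis by simp
qed

lemma proj_squared: "has_bochner_integral (gpd \<alpha>) (\<lambda>x. (proj x)\<^sup>2) (C_sq n \<alpha> ystar)"
proof -
  let ?y = ystar and ?c = "h n \<alpha> ystar" and ?s = "slope n \<alpha> ystar"
  let ?f = "\<lambda>x. (?c\<^sup>2 * 1 - (2 * ?c * ?s) * (?y - x)) + ?s\<^sup>2 * (x - ?y)\<^sup>2"
  have int_f: "integrable (gpd \<alpha>) ?f"
    by (intro integrable_intros integrable_quadratic)
  have trunc_f: "trunc ?y ?f = ?c\<^sup>2 * W \<alpha> ?y - (2 * ?c * ?s) * W1 ?y + ?s\<^sup>2 * B ?y"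
    unfolding B_def m0_eq[OF less_imp_le[OF ystar(2)], symmetric]
      trunc_linear[OF less_imp_le[OF ystar(2)], symmetric]
    by (simp only: trunc_simps integrable_quadratic)
  have "has_bochner_integral (gpd \<alpha>) (\<lambda>x. indicator {..?y} x * ?f x) (trunc ?y ?f)"
    unfolding trunc_def by (rule has_bochner_integral_integrable) (rule integrable_trunc[OF int_f])
  moreover have "has_bochner_integral (gpd \<alpha>) (\<lambda>x. indicator {?y..} x * (h n \<alpha> x)\<^sup>2)
      (integral {?y..} (\<lambda>x. (h n \<alpha> x)\<^sup>2 * w \<alpha> x))"
    unfolding integral_unique[OF has_integral_tail[OF ystar(2)]]
    using integrable_mult_indicator[OF _ integrable_h_squared, of "{?y..}" \<alpha> n]
    by (intro has_bochner_integral_integrable) simp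
  ultimately have "has_bochner_integral (gpd \<alpha>) (\<lambda>x. indicator {..?y} x * ?f x + indicator {?y..} x * (h n \<alpha> x)\<^sup>2)
      (trunc ?y ?f + integral {?y..} (\<lambda>x. (h n \<alpha> x)\<^sup>2 * w \<alpha> x))"
    by (rule has_bochner_integral_add)
  also have "trunc ?y ?f + integral {?y..} (\<lambda>x. (h n \<alpha> x)\<^sup>2 * w \<alpha> x) = C_sq n \<alpha> ?y"
    unfolding trunc_f C_sq_eq[OF ystar(2)] by simp
  finally have 1: "has_bochner_integral (gpd \<alpha>) (\<lambda>x. indicator {..?y} x * ?f x + indicator {?y..} x * (h n \<alpha> x)\<^sup>2)
      (C_sq n \<alpha> ?y)" .
  have ev: "AE x in gpd \<alpha>. indicator {..?y} x * ?f x + indicator {?y..} x * (h n \<alpha> x)\<^sup>2 = (proj x)\<^sup>2"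
    using AE_gpd_neq[of ?y \<alpha>]
  proof eventually_elim
    case (elim x)
    show ?case
    proof (cases "x < ?y")
      case True
      then have "(proj x)\<^sup>2 = ?f x"
        by (simp add: proj_below power2_eq_square algebra_simps)
      with True show ?thesis by simp
    next
      case False
      with elim show ?thesis by (simp add: proj_above)
    qed
  qed
  show ?thesis
    by (rule has_bochner_integral_cong_AE[THEN iffD1, OF _ _ ev 1]; measurable)
qed

lemma proj_is_projection: "is_projection n \<alpha> proj (C_bound n \<alpha> ystar)"
proof -
  have h0: "has_bochner_integral (gpd \<alpha>) (h n \<alpha>) 0" by (rule has_bochner_integral_h)
  have p0: "has_bochner_integral (gpd \<alpha>) proj 0"
    unfolding proj_def[abs_def] using has_bochner_integral_diff[OF h0 res_0] by simp
  have ph: "has_bochner_integral (gpd \<alpha>) (\<lambda>x. proj x * h n \<alpha> x) (C_sq n \<alpha> ystar)"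
    using has_bochner_integral_add[OF proj_squared proj_res]
    by (simp add: proj_def power2_eq_square algebra_simps)
  have x_res: "has_bochner_integral (gpd \<alpha>) (\<lambda>x. x * res x) 0"
    using res_affine[of ystar 1] by simp
  have xp: "has_bochner_integral (gpd \<alpha>) (\<lambda>x. x * proj x) (covariance n \<alpha>)"
    using has_bochner_integral_diff[OF has_bochner_integral_id_times_h[of \<alpha> n] x_res] \<alpha>
    by (simp add: proj_def right_diff_distrib)
  have "0 \<le> C_sq n \<alpha> ystar"
    using proj_squared integral_nonneg_AE[of "\<lambda>x. (proj x)\<^sup>2" "gpd \<alpha>"]
    by (simp add: has_bochner_integral_iff)
  \<comment> \<open>\<open>proj\<close> has the same inner product with x as
    \<open>h n \<alpha>\<close>, the positive covariance, so it cannot vanish almost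
    everywhere.\<close>
  moreover have "C_sq n \<alpha> ystar \<noteq> 0"
  proof
    assume "C_sq n \<alpha> ystar = 0"
    then have "AE x in gpd \<alpha>. (proj x)\<^sup>2 = 0"
      using proj_squared integral_nonneg_eq_0_iff_AE[of "gpd \<alpha>" "\<lambda>x. (proj x)\<^sup>2"]
      by (simp add: has_bochner_integral_iff)
    then have "AE x in gpd \<alpha>. x * proj x = 0"
      by eventually_elim simp
    then have "(LINT x|gpd \<alpha>. x * proj x) = 0"
      by (rule integral_eq_zero_AE)
    then show False
      using xp covariance_pos[of n \<alpha>] \<alpha> n by (simp add: has_bochner_integral_iff)
  qed
  ultimately have C: "0 < C_bound n \<alpha> ystar" "(C_bound n \<alpha> ystar)\<^sup>2 = C_sq n \<alpha> ystar"
    by (auto simp: C_bound_def)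
  have le: "(LINT x|gpd \<alpha>. \<phi> x * (h n \<alpha> x - proj x)) \<le> 0"
    if \<phi>: "concave_on (W_support \<alpha>) \<phi>" and [measurable]: "\<phi> \<in> borel_measurable borel"
      and int: "integrable (gpd \<alpha>) (\<lambda>x. (\<phi> x)\<^sup>2)" for \<phi>
  proof -
    have "integrable (gpd \<alpha>) (\<lambda>x. \<phi> x * h n \<alpha> x - \<phi> x * proj x)"
      using proj_squared integrable_h_squared int
      by (intro Bochner_Integration.integrable_diff integrable_mult_of_squares)
        (auto simp: has_bochner_integral_iff)
    then have "integrable (gpd \<alpha>) (\<lambda>x. \<phi> x * res x)"
      by (simp add: proj_def algebra_simps)
    then have "(LINT x|gpd \<alpha>. \<phi> x * res x) \<le> 0"
      by (intro integral_concave_times_le_0[OF convex_W_support AE_gpd AE_gpd_neq \<phi> _ res_0 x_res])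
        (use res_negative_between in \<open>auto simp only: support greaterThan_iff\<close>)
    then show ?thesis by (simp add: proj_def)
  qed
  show ?thesis
    unfolding is_projection_def C(2)
    by (intro conjI allI impI C(1) measurable_proj p0 proj_squared ph le)
qed

text \<open>Beyond \<open>mode\<close> the derivative of \<open>h n \<alpha>\<close> decreases, and
  at \<open>ystar\<close> it lies below the slope of the line, so the kink there is concave and the
  tangents of each piece also bound the other piece.\<close>

lemma proj_supergradient:
  assumes "0 < x" "0 < z"
  shows "proj z \<le> proj x + (if x < ystar then slope n \<alpha> ystar else h_deriv n \<alpha> x) * (z - x)"
proof -
  let ?y = ystar and ?s = "slope n \<alpha> ystar"
  have tangent: "h n \<alpha> b \<le> h n \<alpha> a + h_deriv n \<alpha> a * (b - a)" if ab: "?y \<le> a" "?y \<le> b" for a b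
  proof -
    have pos: "0 \<le> a" "0 \<le> b" using ab ystar by auto
    consider "a < b" | "a = b" | "b < a" by linarith
    then show ?thesis
    proof cases
      case 1
      obtain u where u: "a < u" "u < b" "h n \<alpha> b - h n \<alpha> a = (b - a) * h_deriv n \<alpha> u"
        using MVT2[OF 1, of "h n \<alpha>" "h_deriv n \<alpha>"] h_DERIV pos by (metis order_trans)
      have "h_deriv n \<alpha> u \<le> h_deriv n \<alpha> a"
        using h_deriv_less_after_mode[of a u] u ab ystar by auto
      then have "(b - a) * h_deriv n \<alpha> u \<le> (b - a) * h_deriv n \<alpha> a" using 1 by (intro mult_left_mono) auto
      then show ?thesis using u(3) by (simp add: mult.commute)
    next
      case 3
      obtain u where u: "b < u" "u < a" "h n \<alpha> a - h n \<alpha> b = (a - b) * h_deriv n \<alpha> u"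
        using MVT2[OF 3, of "h n \<alpha>" "h_deriv n \<alpha>"] h_DERIV pos by (metis order_trans)
      have "h_deriv n \<alpha> a \<le> h_deriv n \<alpha> u"
        using h_deriv_less_after_mode[of u a] u ab ystar by auto
      then have "(a - b) * h_deriv n \<alpha> a \<le> (a - b) * h_deriv n \<alpha> u" using 3 by (intro mult_left_mono) auto
      then show ?thesis using u(3) by (simp add: algebra_simps)
    qed simp
  qed
  have above: "h n \<alpha> b \<le> h n \<alpha> ?y + ?s * (b - ?y)" if "?y \<le> b" for b
  proof -
    have "h_deriv n \<alpha> ?y * (b - ?y) \<le> ?s * (b - ?y)"
      using ystar that by (intro mult_right_mono) auto
    with tangent[of ?y b] that show ?thesis by simp
  qed
  show ?thesis
  proof (cases "x < ?y")
    case True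
    then have "proj x + ?s * (z - x) = h n \<alpha> ?y + ?s * (z - ?y)"
      by (simp add: proj_below algebra_simps)
    moreover have "proj z \<le> h n \<alpha> ?y + ?s * (z - ?y)"
      using above[of z] by (cases "z \<le> ?y") (simp_all add: proj_below proj_above)
    ultimately show ?thesis using True by simp
  next
    case False
    have "proj z \<le> h n \<alpha> x + h_deriv n \<alpha> x * (z - x)"
    proof (cases "?y \<le> z")
      case True
      then show ?thesis using tangent[of x z] False by (simp add: proj_above)
    next
      case z: False
      have "h_deriv n \<alpha> x \<le> ?s"
        using h_deriv_less_after_mode[of ?y x] ystar False by (cases "x = ?y") auto
      then have "?s * (z - ?y) \<le> h_deriv n \<alpha> x * (z - ?y)"
        using z by (intro mult_right_mono_neg) auto
      moreover have "h n \<alpha> ?y \<le> h n \<alpha> x + h_deriv n \<alpha> x * (?y - x)"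
        using tangent[of x ?y] False by simp
      ultimately show ?thesis
        using z by (simp add: proj_below algebra_simps)
    qed
    then show ?thesis using False by (simp add: proj_above)
  qed
qed

section \<open>Existence of the extremal distribution\<close>

lemma proj_less:
  assumes "0 \<le> x" "x < z"
  shows "proj x < proj z"
proof -
  have s: "0 < slope n \<alpha> ystar" using ystar h_deriv_pos[of ystar] by simp
  have below: "proj a < proj b" if "a < b" "b \<le> ystar" for a b
    using that s by (simp add: proj_below)
  have above: "proj a < proj b" if "ystar \<le> a" "a < b" for a b
    using that ystar by (simp add: proj_above h_less)
  consider "z \<le> ystar" | "ystar \<le> x" | "x < ystar" "ystar < z" by linarith
  then show ?thesis
    using below[of x z] above[of x z] below[of x ystar] above[of ystar z] assms by cases auto
qed

text \<open>Needed to pass from \<open>W \<alpha> x \<le> E z\<close> to \<open>p x \<le> z\<close>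
  in the Galois relation, where \<open>E z\<close> is only a supremum.\<close>

lemma proj_left_continuous:
  assumes "0 < x" "z < proj x"
  obtains x' where "0 < x'" "x' < x" "z < proj x'"
proof -
  have "(proj \<longlongrightarrow> proj x) (at_left x)"
  proof (cases "x \<le> ystar")
    case True
    have "((\<lambda>x. h n \<alpha> ystar + slope n \<alpha> ystar * (x - ystar)) \<longlongrightarrow> proj x) (at_left x)"
      unfolding proj_below[OF True] by (intro tendsto_intros)
    then show ?thesis
      by (rule Lim_transform_eventually)
        (use True in \<open>auto simp: eventually_at_filter proj_below\<close>)
  next
    case False
    have "(h n \<alpha> \<longlongrightarrow> proj x) (at_left x)"
      using DERIV_isCont[OF h_DERIV[of x]] assms False
      by (auto simp: isCont_def proj_above intro: tendsto_within_subset)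
    moreover have "eventually (\<lambda>u. h n \<alpha> u = proj u) (at_left x)"
      using eventually_at_left_real[of ystar x] False
      by (auto elim!: eventually_mono simp: proj_above)
    ultimately show ?thesis by (rule Lim_transform_eventually)
  qed
  then have "eventually (\<lambda>u. z < proj u) (at_left x)"
    using assms(2) by (rule order_tendstoD)
  moreover have "eventually (\<lambda>u. u \<in> {0<..<x}) (at_left x)"
    using assms(1) by (rule eventually_at_left_real)
  ultimately have "eventually (\<lambda>u. z < proj u \<and> u \<in> {0<..<x}) (at_left x)"
    by (rule eventually_conj)
  then obtain u where "z < proj u" "u \<in> {0<..<x}"
    using eventually_happens[of _ "at_left x"] by (auto simp: trivial_limit_at_left_real)
  with that show thesis by auto
qed

lemma W_less: "0 \<le> x \<Longrightarrow> x < z \<Longrightarrow> W \<alpha> x < W \<alpha> z"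
  using dom[of x] dom[of z] hazard_less[of x z] by (simp add: W_eq)

lemma W_less_1: "0 \<le> x \<Longrightarrow> W \<alpha> x < 1"
  using dom[of x] by (simp add: W_eq)

text \<open>Instead of inverting the two pieces of \<open>proj\<close>, \<open>E z\<close> collects
  the levels of the points with \<open>p x \<le> z\<close>. The end-point x = 0 is included because
  the extremal quantile is prescribed at \<open>W \<alpha> 0 = 0\<close> as well.\<close>

lemma extremal_exists:
  assumes "0 < s"
  obtains E where "E \<in> IGFR \<alpha>" "\<And>x. 0 \<le> x \<Longrightarrow> quantile E (W \<alpha> x) = \<mu> + s * proj x"
proof -
  define p where "p x = \<mu> + s * proj x" for x
  have p_less: "p x < p z" if "0 \<le> x" "x < z" for x z
    using proj_less[OF that] assms by (simp add: p_def)
  \<comment> \<open>Inserting 0 keeps the set nonempty and gives \<open>E z = 0\<close> below the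
    range of \<open>p\<close>.\<close>
  define A where "A z = insert 0 (W \<alpha> ` {x. 0 < x \<and> p x \<le> z})" for z
  define E where "E z = Sup (A z)" for z
  have A_le: "a \<le> 1" if "a \<in> A z" for a z
    using that W_less_1 by (auto simp: A_def intro: less_imp_le)
  have bdd: "bdd_above (A z)" for z
    using A_le by (rule bdd_aboveI)
  have "0 \<in> A z" for z by (simp add: A_def)
  then have E0: "0 \<le> E z" for z unfolding E_def using bdd by (rule cSup_upper)
  have E1: "E z \<le> 1" for z
    unfolding E_def using A_le by (intro cSup_least) (auto simp: A_def)
  have galois: "p x \<le> z \<longleftrightarrow> W \<alpha> x \<le> E z" if "x \<in> W_support \<alpha>" for x z
  proof
    assume "p x \<le> z"
    with that have "W \<alpha> x \<in> A z" by (auto simp: A_def support)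
    then show "W \<alpha> x \<le> E z" unfolding E_def using bdd by (rule cSup_upper)
  next
    assume le: "W \<alpha> x \<le> E z"
    have x: "0 < x" using that by (simp add: support)
    show "p x \<le> z"
    proof (rule ccontr)
      assume "\<not> p x \<le> z"
      then have "(z - \<mu>) / s < proj x" using assms by (simp add: p_def field_simps)
      then obtain x' where x': "0 < x'" "x' < x" "(z - \<mu>) / s < proj x'"
        by (rule proj_left_continuous[OF x])
      then have zp: "z < p x'" using assms by (simp add: p_def field_simps)
      have "E z \<le> W \<alpha> x'"
        unfolding E_def
      proof (rule cSup_least)
        fix a assume "a \<in> A z"
        then consider "a = 0" | u where "0 < u" "p u \<le> z" "a = W \<alpha> u" by (auto simp: A_def)
        then show "a \<le> W \<alpha> x'"
        proof cases
          case 1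
          then show ?thesis using W_less[of 0 x'] x' by simp
        next
          case 2
          then have "u < x'" using p_less[of x' u] zp x'(1) by (cases u x' rule: linorder_cases) auto
          then show ?thesis using W_less[of u x'] 2 by simp
        qed
      qed (simp add: A_def)
      then show False using W_less[of x' x] x' le by simp
    qed
  qed
  have [measurable]: "p \<in> borel_measurable borel" unfolding p_def by measurable
  have "concave_on (W_support \<alpha>) p"
  proof (rule concave_on_supergradient[OF convex_W_support])
    fix x assume "x \<in> W_support \<alpha>"
    then have x: "0 < x" by (simp add: support)
    let ?d = "if x < ystar then slope n \<alpha> ystar else h_deriv n \<alpha> x"
    have "p z \<le> p x + (s * ?d) * (z - x)" if "z \<in> W_support \<alpha>" for z
    proof -
      have "proj z \<le> proj x + ?d * (z - x)"
        using that x by (intro proj_supergradient) (auto simp: support)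
      then have "s * proj z \<le> s * (proj x + ?d * (z - x))"
        using assms by (intro mult_left_mono) auto
      then show ?thesis unfolding p_def distrib_left mult.assoc by simp
    qed
    then show "\<exists>d. \<forall>z\<in>W_support \<alpha>. p z \<le> p x + d * (z - x)" by blast
  qed
  note E = IGFR_of_galois[of p \<alpha> E, OF _ galois E0 E1 this]
  have "quantile E (W \<alpha> x) = p x" if "0 \<le> x" for x
  proof (cases "x = 0")
    case False
    with that E(2)[of x] show ?thesis by (simp add: support)
  next
    case True
    \<comment> \<open>At level 0 \<open>quantile\<close> is the infimum of the points where
      \<open>E\<close> is positive.\<close>
    have "0 < E z \<longleftrightarrow> p 0 < z" for z
    proof
      assume "0 < E z"
      then obtain a where "a \<in> A z" "0 < a"
        using less_cSup_iff[OF _ bdd, of z 0] by (auto simp: E_def A_def)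
      then obtain x where "0 < x" "p x \<le> z" by (auto simp: A_def)
      then show "p 0 < z" using p_less[of 0 x] by simp
    next
      assume z: "p 0 < z"
      \<comment> \<open>A point of the affine piece close enough to 0 that
        \<open>p u \<le> z\<close>.\<close>
      define u where "u = min ystar ((z - p 0) / (s * slope n \<alpha> ystar))"
      have sl: "0 < s * slope n \<alpha> ystar"
        using assms ystar h_deriv_pos[of ystar] by (intro mult_pos_pos) auto
      have u: "0 < u" "u \<le> ystar" using z sl ystar by (auto simp: u_def)
      have "p u = p 0 + (s * slope n \<alpha> ystar) * u"
        using u ystar by (simp add: p_def proj_below algebra_simps)
      also have "\<dots> \<le> p 0 + (s * slope n \<alpha> ystar) * ((z - p 0) / (s * slope n \<alpha> ystar))"
        using sl by (intro add_left_mono mult_left_mono) (auto simp: u_def)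
      also have "\<dots> = z" using sl by (auto simp: zero_less_mult_iff)
      finally have "W \<alpha> u \<le> E z" using galois[of u z] u by (simp add: support)
      then show "0 < E z" using W_less[of 0 u] u by simp
    qed
    then have "{z. 0 < E z} = {p 0<..}" by auto
    then show ?thesis using True by (simp add: quantile_def)
  qed
  with E(1) that show thesis by (simp add: p_def)
qed

end

text \<open>Covers \<alpha> < 0 with \<open>n = 1\<close>, where \<open>P\<close> is
  \<open>h 1 \<alpha>\<close>, and \<alpha> = 0, where \<open>P\<close> is the regression line; both
  are \<open>C\<close> times \<open>hazard \<alpha> x - 1\<close>.\<close>

lemma exponential_attains:
  assumes "\<alpha> \<le> 0" "0 < \<sigma>" "is_projection n \<alpha> P C"
    and "\<And>x. x \<in> W_support \<alpha> \<Longrightarrow> P x = C * (hazard \<alpha> x - 1)"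
  shows "attains_equality n \<alpha> \<mu> \<sigma> C (exponential_cdf \<mu> \<sigma>)"
proof (rule attains_equalityI[OF exponential_cdf_IGFR(1) assms(3)])
  have "0 < C" using assms(3) by (simp add: is_projection_def)
  then show "quantile (exponential_cdf \<mu> \<sigma>) (W \<alpha> x) = \<mu> + \<sigma> / C * P x" if "x \<in> W_support \<alpha>" for x
    using exponential_cdf_IGFR(2)[OF assms(1,2) that] assms(4)[OF that] by simp
qed (use assms in auto)

theorem proposition3:
  fixes n :: nat and \<alpha> \<mu> \<sigma> :: real and F :: "real \<Rightarrow> real"
    and M :: "'a measure" and X :: "nat \<Rightarrow> 'a \<Rightarrow> real"
  assumes "n \<ge> 1" and "\<alpha> > - 1 / 2"
    and "F \<in> IGFR \<alpha>" and "has_mean_variance F \<mu> (\<sigma>\<^sup>2)" and "\<sigma> > 0"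
    and "iid_sample M X F"
  shows "integrable M (record_value 1 X n)
    \<and> (\<alpha> < 0 \<and> n = 1 \<longrightarrow>
         std_record_mean M 1 X n \<mu> \<sigma> \<le> 1
         \<and> attains_equality n \<alpha> \<mu> \<sigma> 1 (exponential_cdf \<mu> \<sigma>))
    \<and> (\<alpha> < 0 \<and> n \<ge> 2 \<longrightarrow>
         Y_set n \<alpha> \<noteq> {}
         \<and> std_record_mean M 1 X n \<mu> \<sigma> \<le> C_bound n \<alpha> (y_star n \<alpha>)
         \<and> (let y = y_star n \<alpha>; C = C_bound n \<alpha> y;
                extremal = (\<lambda>E. E \<in> IGFR \<alpha> \<and>
                  (\<forall>x. 0 \<le> x \<and> x < y \<longrightarrow>
                     quantile E (W \<alpha> x) = \<sigma> / C * (g_hat 1 n \<alpha> y - 1 + slope n \<alpha> y * (x - y)) + \<mu>) \<and>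
                  (\<forall>x. y \<le> x \<longrightarrow>
                     quantile E (W \<alpha> x) = \<sigma> / C * (g_hat 1 n \<alpha> x - 1) + \<mu>))
            in (\<exists>E. extremal E) \<and> (\<forall>E. extremal E \<longrightarrow> attains_equality n \<alpha> \<mu> \<sigma> C E)))
    \<and> (\<alpha> = 0 \<longrightarrow>
         std_record_mean M 1 X n \<mu> \<sigma> \<le> real n
         \<and> attains_equality n \<alpha> \<mu> \<sigma> (real n) (exponential_cdf \<mu> \<sigma>))
    \<and> (\<alpha> > 0 \<longrightarrow>
         std_record_mean M 1 X n \<mu> \<sigma> \<le> D_bound n \<alpha>
         \<and> attains_equality n \<alpha> \<mu> \<sigma> (D_bound n \<alpha>) (pareto_cdf n \<alpha> \<mu> \<sigma>))"
proof -
  interpret iid_observations M X F by standard (rule assms(6))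
  note F = assms(3,4,5)
  have "integrable M (record_value 1 X n)"
    by (rule record_mean(1)[OF F])
  moreover have "std_record_mean M 1 X n \<mu> \<sigma> \<le> 1 \<and> attains_equality n \<alpha> \<mu> \<sigma> 1 (exponential_cdf \<mu> \<sigma>)"
    if "\<alpha> < 0" "n = 1"
  proof
    show "std_record_mean M 1 X n \<mu> \<sigma> \<le> 1"
      unfolding \<open>n = 1\<close> by (rule std_record_mean_le[OF F trivial_projection])
    show "attains_equality n \<alpha> \<mu> \<sigma> 1 (exponential_cdf \<mu> \<sigma>)"
      unfolding \<open>n = 1\<close>
      by (rule exponential_attains[OF _ \<open>\<sigma> > 0\<close> trivial_projection])
        (use that in \<open>auto simp: h_eq[of _ _ 1, unfolded One_nat_def] W_support_iff\<close>)
  qed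
  moreover have "Y_set n \<alpha> \<noteq> {}
         \<and> std_record_mean M 1 X n \<mu> \<sigma> \<le> C_bound n \<alpha> (y_star n \<alpha>)
         \<and> (let y = y_star n \<alpha>; C = C_bound n \<alpha> y;
                extremal = (\<lambda>E. E \<in> IGFR \<alpha> \<and>
                  (\<forall>x. 0 \<le> x \<and> x < y \<longrightarrow>
                     quantile E (W \<alpha> x) = \<sigma> / C * (g_hat 1 n \<alpha> y - 1 + slope n \<alpha> y * (x - y)) + \<mu>) \<and>
                  (\<forall>x. y \<le> x \<longrightarrow>
                     quantile E (W \<alpha> x) = \<sigma> / C * (g_hat 1 n \<alpha> x - 1) + \<mu>))
            in (\<exists>E. extremal E) \<and> (\<forall>E. extremal E \<longrightarrow> attains_equality n \<alpha> \<mu> \<sigma> C E))"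
    if "\<alpha> < 0" "n \<ge> 2"
  proof -
    interpret negative_parameter n \<alpha>
      using assms(2) that by unfold_locales auto
    let ?C = "C_bound n \<alpha> ystar"
    have "0 < ?C" using proj_is_projection by (simp add: is_projection_def)
    have gh: "g_hat 1 n \<alpha> x - 1 = h n \<alpha> x" for x
      by (simp add: h_def)
    define extremal where "extremal E \<longleftrightarrow> E \<in> IGFR \<alpha> \<and>
        (\<forall>x. 0 \<le> x \<and> x < ystar \<longrightarrow>
          quantile E (W \<alpha> x) = \<sigma> / ?C * (h n \<alpha> ystar + slope n \<alpha> ystar * (x - ystar)) + \<mu>) \<and>
        (\<forall>x. ystar \<le> x \<longrightarrow> quantile E (W \<alpha> x) = \<sigma> / ?C * h n \<alpha> x + \<mu>)" for E
    have "\<exists>E. extremal E"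
    proof -
      have "0 < \<sigma> / ?C" using \<open>\<sigma> > 0\<close> \<open>0 < ?C\<close> by simp
      from extremal_exists[OF this, of \<mu>] obtain E where E: "E \<in> IGFR \<alpha>"
        "\<And>x. 0 \<le> x \<Longrightarrow> quantile E (W \<alpha> x) = \<mu> + \<sigma> / ?C * proj x" by blast
      then have "extremal E"
        using ystar(2) by (auto simp: extremal_def proj_below proj_above)
      then show ?thesis by (intro exI[of _ E])
    qed
    moreover have "attains_equality n \<alpha> \<mu> \<sigma> ?C E" if "extremal E" for E
    proof (rule attains_equalityI[OF _ proj_is_projection \<open>\<sigma> > 0\<close>])
      fix x assume "x \<in> W_support \<alpha>"
      then show "quantile E (W \<alpha> x) = \<mu> + \<sigma> / ?C * proj x"
        using \<open>extremal E\<close>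
        by (cases "x < ystar") (auto simp: extremal_def proj_below proj_above support)
    qed (use that in \<open>simp add: extremal_def\<close>)
    moreover have "std_record_mean M 1 X n \<mu> \<sigma> \<le> ?C"
      by (rule std_record_mean_le[OF F proj_is_projection])
    ultimately show ?thesis
      using Y_set_nonempty unfolding Let_def ystar_def[symmetric] gh extremal_def by simp
  qed
  moreover have "std_record_mean M 1 X n \<mu> \<sigma> \<le> real n
         \<and> attains_equality n \<alpha> \<mu> \<sigma> (real n) (exponential_cdf \<mu> \<sigma>)" if "\<alpha> = 0"
  proof -
    \<comment> \<open>At \<alpha> = 0 the law has mean and variance 1 and the covariance is
      \<open>n\<close>, so slope and norm both equal \<open>n\<close>.\<close>
    have P: "is_projection n \<alpha> (\<lambda>x. real n * (x - 1)) (real n)"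
      using affine_projection_nonneg[of 0 n] assms(1) that by (simp add: covariance_def gpd_variance_def)
    have "attains_equality n \<alpha> \<mu> \<sigma> (real n) (exponential_cdf \<mu> \<sigma>)"
      by (rule exponential_attains[OF _ \<open>\<sigma> > 0\<close> P]) (use that in \<open>auto simp: hazard_def\<close>)
    with std_record_mean_le[OF F P] show ?thesis by blast
  qed
  moreover have "std_record_mean M 1 X n \<mu> \<sigma> \<le> D_bound n \<alpha>
         \<and> attains_equality n \<alpha> \<mu> \<sigma> (D_bound n \<alpha>) (pareto_cdf n \<alpha> \<mu> \<sigma>)" if "\<alpha> > 0"
  proof -
    have P: "is_projection n \<alpha> (\<lambda>x. a_star n \<alpha> * (x - 1 / (1 + \<alpha>))) (D_bound n \<alpha>)"
      using affine_projection_nonneg[of \<alpha> n] assms(1) that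
      unfolding D_bound_eq(2)[OF that assms(1)] a_star_eq[OF that] by simp
    have "attains_equality n \<alpha> \<mu> \<sigma> (D_bound n \<alpha>) (pareto_cdf n \<alpha> \<mu> \<sigma>)"
      by (rule attains_equalityI[OF pareto_cdf_IGFR(1) P \<open>\<sigma> > 0\<close> pareto_cdf_IGFR(2)])
        (use that assms in auto)
    with std_record_mean_le[OF F P] show ?thesis by blast
  qed
  ultimately show ?thesis by blast
qed

end
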